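(* Fix $K\in\mathbb{N}$. The Diophantine problem over the lamplighter group $L_2$ for the class of quadratic equations with number of constants $k\le K$ is decidable in polynomial time. Moreover, the Diophantine problem for quadratic equations over $L_2$, parametrized by $k$, belongs to the complexity class $\mathbf{XP}$.
   Context: Let $\mathbb{Z}_2^{\mathbb{Z}}$ denote the abelian group of finitely supported functions $f:\mathbb{Z}\to\mathbb{Z}_2$ under pointwise addition, and for $b\in\mathbb{Z}$ put $f^b(x)=f(x+b)$. The lamplighter group is $L_2=\mathbb{Z}\ltimes\mathbb{Z}_2^{\mathbb{Z}}$, the set of pairs $(\delta,f)$ with product $(\delta_1,f_1)(\delta_2,f_2)=(\delta_1+\delta_2,\,f_1^{\delta_2}+f_2)$. It is generated by $a=(0,\mathbf 1_0)$, where $\mathbf 1_0$ is the indicator function of $\{0\}$, and $t=(1,0)$; elements of $L_2$ are given as words in $a^{\pm1},t^{\pm1}$. Quadratic equations are considered in one of the three standard forms, with variables $x_i,y_i,z_j$ and constants $c_j\in L_2$: (1) spherical: $\prod_{j=1}^k z_j^{-1}c_jz_j=1$, $k\ge1$; (2) orientable of genus $g$: $\prod_{i=1}^g[x_i,y_i]\prod_{j=1}^k z_j^{-1}c_jz_j=1$, $g\ge1$, $k\ge0$; (3) non-orientable of genus $g$: $\prod_{i=1}^g x_i^2\prod_{j=1}^k z_j^{-1}c_jz_j=1$, $g\ge1$, $k\ge0$. The number of constants is $k$. The Diophantine problem for a class of equations asks whether a given equation of the class has a solution with all variables taking values in $L_2$. The size of an equation $W=1$ is the length $|W|$ of its left-hand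 side. $\mathbf{XP}$ ("slicewise polynomial time") is the class of parametrized problems that are solvable in time $O(n^{h(k)})$ for some computable function $h$, where $n$ is the input size and $k$ the parameter. *)

theory Defs
  imports "HOL-Algebra.Group" "HOL-Library.Poly_Mapping" "HOL-Library.Z2"
begin

section \<open>The lamplighter group\<close>

type_synonym lamp = "int \<times> (int \<Rightarrow>\<^sub>0 bit)"

definition shift :: "int \<Rightarrow> (int \<Rightarrow>\<^sub>0 bit) \<Rightarrow> (int \<Rightarrow>\<^sub>0 bit)" where
  "shift b f = Poly_Mapping.map_key (\<lambda>x. x + b) f"

text \<open>The function \<open>map_key\<close> is only meaningful for injective maps; this is the intended reading.\<close>

lemma lookup_shift: "Poly_Mapping.lookup (shift b f) x = Poly_Mapping.lookup f (x + b)"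
  by (simp add: shift_def map_key.rep_eq inj_on_def)

definition L2 :: "lamp monoid" where
  "L2 = \<lparr>carrier = UNIV,
         mult = (\<lambda>(d1, f1) (d2, f2). (d1 + d2, shift d2 f1 + f2)),
         one = (0, 0)\<rparr>"

lemma shift_add: "shift b (f + g) = shift b f + shift b g"
  by (rule poly_mapping_eqI) (simp add: lookup_shift lookup_add)

lemma shift_shift: "shift b (shift c f) = shift (b + c) f"
  by (rule poly_mapping_eqI) (simp add: lookup_shift add.assoc)

lemma shift_0: "shift 0 f = f"
  by (rule poly_mapping_eqI) (simp add: lookup_shift)

lemma shift_zero: "shift b 0 = 0"
  by (rule poly_mapping_eqI) (simp add: lookup_shift)

lemma group_L2: "group L2"
proof (rule groupI)
  fix x assume "x \<in> carrier L2"
  obtain d f where x: "x = (d, f)" by (cases x)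
  have "(- d, - shift (- d) f) \<otimes>\<^bsub>L2\<^esub> x = \<one>\<^bsub>L2\<^esub>"
    by (auto simp: L2_def x intro!: poly_mapping_eqI simp: lookup_shift lookup_add)
  moreover have "(- d, - shift (- d) f) \<in> carrier L2"
    by (simp add: L2_def)
  ultimately show "\<exists>y\<in>carrier L2. y \<otimes>\<^bsub>L2\<^esub> x = \<one>\<^bsub>L2\<^esub>" by blast
qed (auto simp: L2_def shift_add shift_shift shift_0 shift_zero add.assoc add.commute)

datatype gen = Gen_a | Gen_t

fun gen_val :: "gen \<Rightarrow> lamp" where
  "gen_val Gen_a = (0, Poly_Mapping.single 0 1)"
| "gen_val Gen_t = (1, 0)"

section \<open>Quadratic equations in standard form\<close>

datatype var = X nat | Y nat | Z nat

datatype atom = Gen gen | Var var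

text \<open>A letter is a symbol together with a flag; the flag \<^const>\<open>True\<close> stands for the exponent
  \<open>-1\<close>. Words need not be reduced.\<close>

type_synonym 'a word = "('a \<times> bool) list"

datatype quadratic_equation =
    Spherical "gen word list"
  | Orientable nat "gen word list"
  | Nonorientable nat "gen word list"

fun constants :: "quadratic_equation \<Rightarrow> gen word list" where
  "constants (Spherical cs) = cs"
| "constants (Orientable g cs) = cs"
| "constants (Nonorientable g cs) = cs"

definition num_constants :: "quadratic_equation \<Rightarrow> nat" where
  "num_constants E = length (constants E)"

fun standard_form :: "quadratic_equation \<Rightarrow> bool" where
  "standard_form (Spherical cs) \<longleftrightarrow> length cs \<ge> 1"
| "standard_form (Orientable g cs) \<longleftrightarrow> g \<ge> 1"
| "standard_form (Nonorientable g cs) \<longleftrightarrow> g \<ge> 1"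

definition conjugates_word :: "gen word list \<Rightarrow> atom word" where
  "conjugates_word cs = concat (map
     (\<lambda>j. [(Var (Z j), True)] @ map (\<lambda>(s, e). (Gen s, e)) (cs ! j) @ [(Var (Z j), False)])
     [0..<length cs])"

text \<open>The commutator is \<open>[x, y] = x\<^sup>-\<^sup>1 y\<^sup>-\<^sup>1 x y\<close>.\<close>

definition commutators_word :: "nat \<Rightarrow> atom word" where
  "commutators_word g = concat (map
     (\<lambda>i. [(Var (X i), True), (Var (Y i), True), (Var (X i), False), (Var (Y i), False)]) [0..<g])"

definition squares_word :: "nat \<Rightarrow> atom word" where
  "squares_word g = concat (map (\<lambda>i. [(Var (X i), False), (Var (X i), False)]) [0..<g])"

fun lhs :: "quadratic_equation \<Rightarrow> atom word" where
  "lhs (Spherical cs) = conjugates_word cs"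
| "lhs (Orientable g cs) = commutators_word g @ conjugates_word cs"
| "lhs (Nonorientable g cs) = squares_word g @ conjugates_word cs"

definition equation_size :: "quadratic_equation \<Rightarrow> nat" where
  "equation_size E = length (lhs E)"

fun atom_val :: "(var \<Rightarrow> lamp) \<Rightarrow> atom \<Rightarrow> lamp" where
  "atom_val \<sigma> (Gen s) = gen_val s"
| "atom_val \<sigma> (Var v) = \<sigma> v"

fun letter_val :: "(var \<Rightarrow> lamp) \<Rightarrow> atom \<times> bool \<Rightarrow> lamp" where
  "letter_val \<sigma> (s, e) = (if e then inv\<^bsub>L2\<^esub> (atom_val \<sigma> s) else atom_val \<sigma> s)"

definition word_val :: "(var \<Rightarrow> lamp) \<Rightarrow> atom word \<Rightarrow> lamp" where
  "word_val \<sigma> w = foldr (\<lambda>l x. letter_val \<sigma> l \<otimes>\<^bsub>L2\<^esub> x) w \<one>\<^bsub>L2\<^esub>"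

definition solvable_L2 :: "quadratic_equation \<Rightarrow> bool" where
  "solvable_L2 E \<longleftrightarrow> (\<exists>\<sigma>. word_val \<sigma> (lhs E) = \<one>\<^bsub>L2\<^esub>)"

section \<open>Deterministic multi-tape Turing machines\<close>

datatype move = Move_Left | Stay | Move_Right

text \<open>States and tape symbols are natural numbers; the symbol \<open>0\<close> is the blank. The transition
  function maps a state and the list of scanned symbols (one per tape) to a new state and, for each
  tape, the symbol to be written and the head movement.\<close>

record tm =
  ntapes :: nat
  nsymbols :: nat
  nstates :: nat
  start :: nat
  accept :: nat
  reject :: nat
  delta :: "nat \<Rightarrow> nat list \<Rightarrow> nat \<times> (nat \<times> move) list"

definition tm_wf :: "tm \<Rightarrow> bool" where
  "tm_wf M \<longleftrightarrow>
     ntapes M \<ge> 1 \<and> nsymbols M \<ge> 1 \<and>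
     start M < nstates M \<and> accept M < nstates M \<and> reject M < nstates M \<and>
     accept M \<noteq> reject M \<and>
     (\<forall>q < nstates M. \<forall>ss. length ss = ntapes M \<and> set ss \<subseteq> {..<nsymbols M} \<longrightarrow>
        (case delta M q ss of (q', acts) \<Rightarrow>
           q' < nstates M \<and> length acts = ntapes M \<and> fst ` set acts \<subseteq> {..<nsymbols M}))"

text \<open>A tape is two-way infinite and comes with the position of its head.\<close>

type_synonym tape = "(int \<Rightarrow> nat) \<times> int"
type_synonym config = "nat \<times> tape list"

definition scanned :: "tape \<Rightarrow> nat" where
  "scanned tp = fst tp (snd tp)"

fun act :: "nat \<times> move \<Rightarrow> tape \<Rightarrow> tape" where
  "act (s, m) (c, p) =
     (c(p := s), (case m of Move_Left \<Rightarrow> p - 1 | Stay \<Rightarrow> p | Move_Right \<Rightarrow> p + 1))"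

fun tm_step :: "tm \<Rightarrow> config \<Rightarrow> config" where
  "tm_step M (q, tps) =
     (if q = accept M \<or> q = reject M then (q, tps)
      else case delta M q (map scanned tps) of (q', acts) \<Rightarrow> (q', map2 act acts tps))"

definition word_tape :: "nat list \<Rightarrow> int \<Rightarrow> nat" where
  "word_tape w i = (if 0 \<le> i \<and> i < int (length w) then w ! nat i else 0)"

definition tm_init :: "tm \<Rightarrow> nat list \<Rightarrow> config" where
  "tm_init M w = (start M, (word_tape w, 0) # replicate (ntapes M - 1) (word_tape [], 0))"

definition tm_run :: "tm \<Rightarrow> nat list \<Rightarrow> nat \<Rightarrow> config" where
  "tm_run M w n = (tm_step M ^^ n) (tm_init M w)"

text \<open>A function is computed with argument and value written in unary on the first tape.\<close>

definition computable :: "(nat \<Rightarrow> nat) \<Rightarrow> bool" where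
  "computable h \<longleftrightarrow> (\<exists>M. tm_wf M \<and> 1 < nsymbols M \<and>
     (\<forall>k. \<exists>n. fst (tm_run M (replicate k 1) n) = accept M \<and>
              fst (hd (snd (tm_run M (replicate k 1) n))) = word_tape (replicate (h k) 1)))"

section \<open>Decision problems\<close>

text \<open>A problem is given by a set \<open>I\<close> of instances, a predicate \<open>P\<close> singling out the yes-instances
  and an encoding \<open>enc\<close> of the instances as words over the nonblank symbols. Only the behaviour on
  encodings of elements of \<open>I\<close> is prescribed.\<close>

definition decides_in_time ::
    "tm \<Rightarrow> ('i \<Rightarrow> nat list) \<Rightarrow> 'i set \<Rightarrow> ('i \<Rightarrow> bool) \<Rightarrow> ('i \<Rightarrow> nat) \<Rightarrow> bool" where
  "decides_in_time M enc I P T \<longleftrightarrow> tm_wf M \<and>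
     (\<forall>x\<in>I. set (enc x) \<subseteq> {0<..<nsymbols M} \<and>
        (\<exists>n \<le> T x. fst (tm_run M (enc x) n) = (if P x then accept M else reject M)))"

text \<open>The bounds \<open>C * n ^ d\<close> and \<open>C * n ^ h k\<close> below are required for all instances, with \<open>C\<close> not
  depending on the parameter. They are appropriate for problems whose instances have size
  \<open>n \<ge> 2\<close>: then lower order terms and computable factors \<open>f k\<close> can be absorbed.\<close>

definition polynomial_time ::
    "('i \<Rightarrow> nat list) \<Rightarrow> ('i \<Rightarrow> nat) \<Rightarrow> 'i set \<Rightarrow> ('i \<Rightarrow> bool) \<Rightarrow> bool" where
  "polynomial_time enc len I P \<longleftrightarrow>
     (\<exists>M C d. decides_in_time M enc I P (\<lambda>x. C * len x ^ d))"

definition in_XP ::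
    "('i \<Rightarrow> nat list) \<Rightarrow> ('i \<Rightarrow> nat) \<Rightarrow> ('i \<Rightarrow> nat) \<Rightarrow> 'i set \<Rightarrow> ('i \<Rightarrow> bool) \<Rightarrow> bool" where
  "in_XP enc len param I P \<longleftrightarrow>
     (\<exists>M h C. computable h \<and> decides_in_time M enc I P (\<lambda>x. C * len x ^ h (param x)))"

section \<open>Encoding of equations\<close>

text \<open>An equation is written as a symbol for its form, its genus in unary (as in the left-hand
  side, to whose length the genus contributes linearly), and its constants, each preceded by
  the symbol \<open>5\<close>.\<close>

fun letter_code :: "gen \<times> bool \<Rightarrow> nat" where
  "letter_code (Gen_a, False) = 6"
| "letter_code (Gen_a, True) = 7"
| "letter_code (Gen_t, False) = 8"
| "letter_code (Gen_t, True) = 9"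

definition constants_code :: "gen word list \<Rightarrow> nat list" where
  "constants_code cs = concat (map (\<lambda>c. 5 # map letter_code c) cs)"

fun equation_code :: "quadratic_equation \<Rightarrow> nat list" where
  "equation_code (Spherical cs) = 1 # constants_code cs"
| "equation_code (Orientable g cs) = 2 # replicate g 4 @ constants_code cs"
| "equation_code (Nonorientable g cs) = 3 # replicate g 4 @ constants_code cs"

lemma inj_letter_code: "inj letter_code"
proof (rule injI)
  fix x y :: "gen \<times> bool"
  assume "letter_code x = letter_code y"
  then show "x = y"
    by (cases x rule: letter_code.cases; cases y rule: letter_code.cases; simp)
qed

lemma letter_code_bounds: "5 < letter_code l \<and> letter_code l < 10"
  by (cases l rule: letter_code.cases) auto

lemma constants_code_inject: "constants_code cs = constants_code ds \<longleftrightarrow> cs = ds"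
proof (induction cs arbitrary: ds)
  case Nil
  then show ?case by (cases ds) (auto simp: constants_code_def)
next
  case (Cons c cs)
  have tw: "takeWhile ((\<noteq>) 5) (map letter_code c @ constants_code cs) = map letter_code c"
    for c cs
  proof -
    have "\<forall>x \<in> set (map letter_code c). 5 \<noteq> x"
      using letter_code_bounds by (auto dest: sym simp: less_le)
    moreover have "takeWhile ((\<noteq>) 5) (constants_code cs) = []"
      by (cases cs) (auto simp: constants_code_def)
    ultimately show ?thesis by (subst takeWhile_append2) auto
  qed
  have unfold: "constants_code (c # cs) = 5 # map letter_code c @ constants_code cs" for c cs
    by (simp add: constants_code_def)
  show ?case
  proof (cases ds)
    case Nil
    then show ?thesis by (simp add: constants_code_def)
  next
    case (Cons d ds')
    have "c = d \<and> cs = ds'" if "constants_code (c # cs) = constants_code (d # ds')"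
    proof -
      have eq: "map letter_code c @ constants_code cs = map letter_code d @ constants_code ds'"
        using that by (simp add: unfold)
      then have m: "map letter_code c = map letter_code d" by (metis tw)
      then have "c = d" using inj_letter_code by (simp add: inj_map_eq_map)
      moreover have "constants_code cs = constants_code ds'" using eq m by simp
      ultimately show ?thesis using Cons.IH by blast
    qed
    then show ?thesis using Cons by auto
  qed
qed

lemma inj_equation_code: "inj equation_code"
proof (rule injI)
  have tw: "takeWhile ((=) 4) (replicate g 4 @ constants_code cs) = replicate g 4" for g cs
  proof -
    have "takeWhile ((=) 4) (constants_code cs) = []"
      by (cases cs) (auto simp: constants_code_def)
    then show ?thesis by (subst takeWhile_append2) auto
  qed
  have main: "g = g' \<and> cs = ds"
    if "replicate g 4 @ constants_code cs = replicate g' 4 @ constants_code ds" for g g' cs ds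
  proof -
    have "replicate g (4::nat) = replicate g' 4" using that by (metis tw)
    then have "g = g'" by (metis length_replicate)
    then show ?thesis using that constants_code_inject by auto
  qed
  fix E F :: quadratic_equation
  assume "equation_code E = equation_code F"
  then show "E = F"
    by (cases E; cases F) (auto simp: constants_code_inject dest: main)
qed

lemma length_conjugates_word: "length (conjugates_word cs) = 2 * length cs + sum_list (map length cs)"
proof -
  have "length (conjugates_word cs) = (\<Sum>j\<leftarrow>[0..<length cs]. 2 + length (cs ! j))"
    by (simp add: conjugates_word_def length_concat o_def)
  also have "\<dots> = (\<Sum>c\<leftarrow>map ((!) cs) [0..<length cs]. 2 + length c)"
    by (simp only: map_map o_def)
  also have "\<dots> = (\<Sum>c\<leftarrow>cs. 2 + length c)"
    by (simp only: map_nth)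
  also have "\<dots> = 2 * length cs + sum_list (map length cs)"
    by (induction cs) auto
  finally show ?thesis .
qed

lemma length_constants_code: "length (constants_code cs) = length cs + sum_list (map length cs)"
  by (induction cs) (auto simp: constants_code_def)

lemma length_commutators_word: "length (commutators_word g) = 4 * g"
  by (simp add: commutators_word_def length_concat o_def sum_list_triv)

lemma length_squares_word: "length (squares_word g) = 2 * g"
  by (simp add: squares_word_def length_concat o_def sum_list_triv)

lemmas length_simps = length_conjugates_word length_constants_code length_commutators_word
  length_squares_word equation_size_def

lemma equation_size_ge_2: "standard_form E \<Longrightarrow> 2 \<le> equation_size E"
  by (cases E) (auto simp: length_simps)

text \<open>Hence measuring running time in terms of the length of the left-hand side is the same, up
  to constant factors, as measuring it in terms of the length of the input word.\<close>

lemma length_equation_code_le: "standard_form E \<Longrightarrow> length (equation_code E) \<le> equation_size E"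
  by (cases E) (auto simp: length_simps)

lemma equation_size_le: "equation_size E \<le> 4 * length (equation_code E)"
  by (cases E) (auto simp: length_simps)

end

theory Submission
  imports Defs "HOL-Library.Countable_Set"
begin

text \<open>A configuration of lamps is a Laurent polynomial over the field with two elements, and shifting
  it is multiplication by a power of \<open>X\<close>. The values of \<open>z\<inverse> (d, f) z\<close> are the pairs
  \<open>(d, X\<^sup>i f + (1 + X\<^sup>d) h)\<close>; products of commutators and squares contribute ideals
  generated by some \<open>1 + X\<^sup>e\<close>. Hence an equation is solvable if and only if a condition on the sum of
  the cursors \<open>d\<close> holds and some sum of translates of the \<open>f\<close> lies in the ideal of \<open>1 + X\<^sup>D\<close>, where
  \<open>D\<close> is the gcd of the numbers involved. If \<open>D = 0\<close>, the ideal is zero, and it may be replaced by that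
  of any \<open>D\<close> larger than the total length of the supports: on a circle that long there is a
  point which no support covers, and the circle can be cut there. So \<open>D\<close> is linear in the size \<open>n\<close>
  of the equation, and it suffices to try translations modulo \<open>D\<close>, which leaves \<open>D\<^sup>k\<close> cases for \<open>k\<close>
  constants.

  This search needs a fixed number of counters with values at most \<open>(4 n)\<^bsup>k + 1\<^esup>\<close>. A Turing machine
  can store a counter as the position of a head on an otherwise unused tape, and a deterministic
  machine that halts never repeats a configuration; so its running time is bounded by the number of
  configurations, which is \<open>n\<^bsup>O(k + 1)\<^esup>\<close>.\<close>

section \<open>Counter programs and their compilation to Turing machines\<close>

text \<open>Apart from its result, all that has to be proved about the program is a bound on its
  registers, since time follows by counting configurations. So it may be wasteful, and it never
  computes a gcd. With n the length of the input, it tests every D from 1 to 2n that divides all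
  cursors and half of their sum. The ideal of 1 + X^D shrinks when D is replaced by a multiple;
  hence a nonzero gcd, which is at most n, is itself tested and decides, while for gcd 0 every D
  qualifies, among them 2n, which exceeds the total length of the supports.

  Half of the sum comes from the single square of a non-orientable equation of genus 1: the square
  of (a, u) has cursor 2a and lamps (1 + X^a) u, so the cursor condition fixes a. For spherical
  equations the sum must be 0 and this divisibility is void, so one test serves both. A commutator
  or a second square removes the tie: the ideal becomes that of 1 + X, and only the parity of the
  number of lamps matters.

  The number of registers does not depend on the equation; k enters the time only through the bound
  on their values.\<close>

datatype com =
    Nop
  | Inc nat
  | Dec nat
  | Then com com
  | Branch nat nat com com
  | Until nat nat com

fun next_com :: "(nat \<Rightarrow> nat) \<Rightarrow> com \<Rightarrow> com" where
  "next_com \<sigma> Nop = Nop"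
| "next_com \<sigma> (Inc i) = Nop"
| "next_com \<sigma> (Dec i) = Nop"
| "next_com \<sigma> (Then c1 c2) = (if c1 = Nop then c2 else Then (next_com \<sigma> c1) c2)"
| "next_com \<sigma> (Branch i a c1 c2) = (if \<sigma> i = a then c1 else c2)"
| "next_com \<sigma> (Until i a c) = (if \<sigma> i = a then Nop else Then c (Until i a c))"

fun move_of :: "com \<Rightarrow> nat \<Rightarrow> move" where
  "move_of (Inc i) j = (if j = i then Move_Right else Stay)"
| "move_of (Dec i) j = (if j = i then Move_Left else Stay)"
| "move_of (Then c1 c2) j = move_of c1 j"
| "move_of _ j = Stay"

fun moved :: "move \<Rightarrow> nat \<Rightarrow> nat" where
  "moved Move_Left p = p - 1"
| "moved Stay p = p"
| "moved Move_Right p = p + 1"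

text \<open>Register \<open>i\<close> is the position of the head on tape \<open>i\<close>. Tape \<open>0\<close> holds the input \<open>w\<close>; every other
  tape has a single \<open>1\<close>, at position \<open>0\<close>, so that scanning a \<open>1\<close> there means that the register is
  zero.\<close>

definition cell :: "nat list \<Rightarrow> nat \<Rightarrow> nat \<Rightarrow> nat" where
  "cell w i p = (if i = 0 then (if p < length w then w ! p else 0) else (if p = 0 then 1 else 0))"

definition bounded :: "nat \<Rightarrow> (nat \<Rightarrow> nat) \<Rightarrow> bool" where
  "bounded B \<rho> \<longleftrightarrow> (\<forall>i. \<rho> i \<le> B)"

text \<open>The bound \<open>B\<close> is part of the relation, so every run certifies that all its
  configurations lie in one finite set. Moves to the left of 0 are excluded because the tapes are
  two-way infinite, while registers are natural numbers.\<close>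

inductive step :: "nat list \<Rightarrow> nat \<Rightarrow> com \<times> (nat \<Rightarrow> nat) \<Rightarrow> com \<times> (nat \<Rightarrow> nat) \<Rightarrow> bool" for w B where
  "c \<noteq> Nop \<Longrightarrow> (\<And>i. move_of c i = Move_Left \<Longrightarrow> 0 < \<rho> i) \<Longrightarrow> bounded B \<rho> \<Longrightarrow> bounded B \<rho>' \<Longrightarrow>
   \<rho>' = (\<lambda>i. moved (move_of c i) (\<rho> i)) \<Longrightarrow>
   step w B (c, \<rho>) (next_com (\<lambda>i. cell w i (\<rho> i)) c, \<rho>')"

definition runs :: "nat list \<Rightarrow> nat \<Rightarrow> com \<Rightarrow> (nat \<Rightarrow> nat) \<Rightarrow> (nat \<Rightarrow> nat) \<Rightarrow> bool" where
  "runs w B c \<rho> \<rho>' \<longleftrightarrow> bounded B \<rho> \<and> (step w B)\<^sup>*\<^sup>* (c, \<rho>) (Nop, \<rho>')"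

lemma bounded_upd: "bounded B \<rho> \<Longrightarrow> v \<le> B \<Longrightarrow> bounded B (\<rho>(i := v))"
  by (simp add: bounded_def)

lemma runs_bounded: "runs w B c \<rho> \<rho>' \<Longrightarrow> bounded B \<rho>'"
  unfolding runs_def by (auto elim!: rtranclp.cases step.cases)

lemma runs_Nop: "bounded B \<rho> \<Longrightarrow> runs w B Nop \<rho> \<rho>"
  by (simp add: runs_def)

lemma runs_Inc: "bounded B \<rho> \<Longrightarrow> \<rho> i < B \<Longrightarrow> runs w B (Inc i) \<rho> (\<rho>(i := Suc (\<rho> i)))"
proof -
  assume *: "bounded B \<rho>" "\<rho> i < B"
  have "step w B (Inc i, \<rho>) (next_com (\<lambda>j. cell w j (\<rho> j)) (Inc i), \<rho>(i := Suc (\<rho> i)))"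
    using * by (intro step.intros) (auto simp: bounded_upd split: if_splits)
  then show ?thesis using * by (auto simp: runs_def)
qed

lemma runs_Dec: "bounded B \<rho> \<Longrightarrow> 0 < \<rho> i \<Longrightarrow> runs w B (Dec i) \<rho> (\<rho>(i := \<rho> i - 1))"
proof -
  assume *: "bounded B \<rho>" "0 < \<rho> i"
  then have "\<rho> i - 1 \<le> B" using le_trans[OF diff_le_self] by (auto simp: bounded_def)
  then have "step w B (Dec i, \<rho>) (next_com (\<lambda>j. cell w j (\<rho> j)) (Dec i), \<rho>(i := \<rho> i - 1))"
    using * by (intro step.intros) (auto simp: bounded_upd split: if_splits)
  then show ?thesis using * by (auto simp: runs_def)
qed

lemma step_Then:
  assumes "step w B x y"
  shows "step w B (Then (fst x) c2, snd x) (Then (fst y) c2, snd y)"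
  using assms
proof cases
  case (1 c \<rho> \<rho>')
  then show ?thesis using step.intros[of "Then c c2" \<rho> B \<rho>' w] by simp
qed

lemma steps_Then:
  "(step w B)\<^sup>*\<^sup>* x y \<Longrightarrow> (step w B)\<^sup>*\<^sup>* (Then (fst x) c2, snd x) (Then (fst y) c2, snd y)"
  by (induction rule: rtranclp_induct) (auto dest: step_Then intro: rtranclp.rtrancl_into_rtrancl)

lemma runs_silent:
  assumes "c \<noteq> Nop" "\<And>i. move_of c i = Stay" "next_com (\<lambda>i. cell w i (\<rho> i)) c = c'"
    "runs w B c' \<rho> \<rho>'"
  shows "runs w B c \<rho> \<rho>'"
proof -
  have "step w B (c, \<rho>) (c', \<rho>)"
    using assms step.intros[of c \<rho> B \<rho> w] by (auto simp: runs_def)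
  then show ?thesis
    using assms(4) unfolding runs_def by (auto intro: converse_rtranclp_into_rtranclp)
qed

lemma runs_Then:
  assumes "runs w B c1 \<rho> \<rho>1" "runs w B c2 \<rho>1 \<rho>2"
  shows "runs w B (Then c1 c2) \<rho> \<rho>2"
proof -
  have "(step w B)\<^sup>*\<^sup>* (Then c1 c2, \<rho>) (Then Nop c2, \<rho>1)"
    using assms(1) steps_Then[of w B "(c1, \<rho>)" "(Nop, \<rho>1)" c2] by (simp add: runs_def)
  moreover have "runs w B (Then Nop c2) \<rho>1 \<rho>2"
    by (rule runs_silent[OF _ _ _ assms(2)]) auto
  ultimately show ?thesis
    using assms(1) by (auto simp: runs_def)
qed

lemma runs_Branch:
  assumes "runs w B (if cell w i (\<rho> i) = a then c1 else c2) \<rho> \<rho>'"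
  shows "runs w B (Branch i a c1 c2) \<rho> \<rho>'"
  by (rule runs_silent[OF _ _ _ assms]) auto

lemma runs_Until_done:
  "bounded B \<rho> \<Longrightarrow> cell w i (\<rho> i) = a \<Longrightarrow> runs w B (Until i a c) \<rho> \<rho>"
  by (rule runs_silent[OF _ _ _ runs_Nop]) auto

lemma runs_Until_loop:
  assumes "cell w i (\<rho> i) \<noteq> a" "runs w B c \<rho> \<rho>1" "runs w B (Until i a c) \<rho>1 \<rho>2"
  shows "runs w B (Until i a c) \<rho> \<rho>2"
  using assms by (intro runs_silent[OF _ _ _ runs_Then[OF assms(2,3)]]) auto

lemma runs_Until:
  assumes "bounded B (F (N::nat))" "cell w i (F N i) = a"
    and "\<And>j. j < N \<Longrightarrow> cell w i (F j i) \<noteq> a"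
    and "\<And>j. j < N \<Longrightarrow> runs w B c (F j) (F (Suc j))"
  shows "runs w B (Until i a c) (F 0) (F N)"
proof -
  have "j \<le> N \<Longrightarrow> runs w B (Until i a c) (F (N - j)) (F N)" for j
  proof (induction j)
    case 0
    then show ?case using assms by (simp add: runs_Until_done)
  next
    case (Suc j)
    then have j: "Suc (N - Suc j) = N - j" "N - Suc j < N" by linarith+
    show ?case
      using runs_Until_loop[OF assms(3,4)[OF j(2)]] Suc unfolding j(1) by simp
  qed
  from this[of N] show ?thesis by simp
qed

text \<open>The commands to which a command can evolve form a finite set, whose elements serve as the
  states of a Turing machine.\<close>

fun residuals :: "com \<Rightarrow> com set" where
  "residuals Nop = {Nop}"
| "residuals (Inc i) = {Inc i, Nop}"
| "residuals (Dec i) = {Dec i, Nop}"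
| "residuals (Then c1 c2) = (\<lambda>c. Then c c2) ` residuals c1 \<union> residuals c2"
| "residuals (Branch i a c1 c2) = insert (Branch i a c1 c2) (residuals c1 \<union> residuals c2)"
| "residuals (Until i a c) = {Until i a c, Nop} \<union> (\<lambda>c'. Then c' (Until i a c)) ` residuals c"

lemma finite_residuals: "finite (residuals c)"
  by (induction c) simp_all

lemma self_residual: "c \<in> residuals c"
  by (induction c) simp_all

lemma Nop_residual: "Nop \<in> residuals c"
  by (induction c) simp_all

lemma residual_next: "x \<in> residuals c \<Longrightarrow> next_com \<sigma> x \<in> residuals c"
proof (induction c arbitrary: x)
  case (Until i a c)
  from Until.prems consider "x = Until i a c" | "x = Nop"
    | c' where "x = Then c' (Until i a c)" "c' \<in> residuals c" by auto
  then show ?case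
    by cases (simp_all add: Until.IH self_residual)
next
  case (Then c1 c2)
  from Then.prems consider "x \<in> residuals c2"
    | c where "x = Then c c2" "c \<in> residuals c1" by auto
  then show ?case
    by cases (simp_all add: Then.IH self_residual)
qed (auto simp: self_residual)

fun regs_below :: "nat \<Rightarrow> com \<Rightarrow> bool" where
  "regs_below m Nop \<longleftrightarrow> True"
| "regs_below m (Inc i) \<longleftrightarrow> i < m"
| "regs_below m (Dec i) \<longleftrightarrow> i < m"
| "regs_below m (Then c1 c2) \<longleftrightarrow> regs_below m c1 \<and> regs_below m c2"
| "regs_below m (Branch i a c1 c2) \<longleftrightarrow> i < m \<and> regs_below m c1 \<and> regs_below m c2"
| "regs_below m (Until i a c) \<longleftrightarrow> i < m \<and> regs_below m c"

lemma regs_below_mono: "regs_below m c \<Longrightarrow> m \<le> m' \<Longrightarrow> regs_below m' c"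
  by (induction c) auto

lemma ex_regs_below: "\<exists>m. regs_below m c"
proof (induction c)
  case (Then c1 c2)
  then obtain m1 m2 where "regs_below m1 c1" "regs_below m2 c2" by auto
  then have "regs_below (max m1 m2) (Then c1 c2)" by (auto intro: regs_below_mono)
  then show ?case ..
next
  case (Branch i a c1 c2)
  then obtain m1 m2 where "regs_below m1 c1" "regs_below m2 c2" by auto
  then have "regs_below (max (Suc i) (max m1 m2)) (Branch i a c1 c2)"
    by (auto intro: regs_below_mono)
  then show ?case ..
next
  case (Until i a c)
  then obtain m where "regs_below m c" by auto
  then have "regs_below (max (Suc i) m) (Until i a c)" by (auto intro: regs_below_mono)
  then show ?case ..
qed auto

lemma regs_below_residual: "x \<in> residuals c \<Longrightarrow> regs_below m c \<Longrightarrow> regs_below m x"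
  by (induction c arbitrary: x) auto

lemma next_com_cong:
  "regs_below m c \<Longrightarrow> (\<And>i. i < m \<Longrightarrow> \<sigma> i = \<tau> i) \<Longrightarrow> next_com \<sigma> c = next_com \<tau> c"
  by (induction c) auto

section \<open>The Turing machine of a command\<close>

definition code_of :: "com \<Rightarrow> com \<Rightarrow> nat" where
  "code_of c x = 3 + to_nat_on (residuals c) x"

definition com_of :: "com \<Rightarrow> nat \<Rightarrow> com" where
  "com_of c q = from_nat_into (residuals c) (q - 3)"

text \<open>The codes of commands start at 3, leaving 0, 1, 2 for the start, accepting and rejecting
  states. The start state spends one step on writing the marks at position 0 of all tapes but the
  first. On \<open>Nop\<close>, a mark scanned on tape 1 means that register 1 is zero, and the
  input is rejected. Ten symbols are the blank and the codes 1 to 9.\<close>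

definition machine :: "nat \<Rightarrow> com \<Rightarrow> tm" where
  "machine m c = \<lparr>ntapes = m, nsymbols = 10, nstates = 3 + card (residuals c),
     start = 0, accept = 1, reject = 2,
     delta = (\<lambda>q ss.
       if q = 0 then (code_of c c, map (\<lambda>i. (if i = 0 then ss ! 0 else 1, Stay)) [0..<m])
       else let x = com_of c q in
         if x = Nop then (if ss ! 1 = 1 then 2 else 1, map (\<lambda>i. (ss ! i, Stay)) [0..<m])
         else (code_of c (next_com (\<lambda>i. ss ! i) x), map (\<lambda>i. (ss ! i, move_of x i)) [0..<m]))\<rparr>"

lemma machine_simps:
  "ntapes (machine m c) = m" "nsymbols (machine m c) = 10"
  "accept (machine m c) = 1" "reject (machine m c) = 2"
  by (simp_all add: machine_def)

lemma code_of_less: "x \<in> residuals c \<Longrightarrow> code_of c x < 3 + card (residuals c)"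
  using bij_betwE[OF to_nat_on_finite[OF finite_residuals[of c]]] by (auto simp: code_of_def)

lemma com_of_code_of: "x \<in> residuals c \<Longrightarrow> com_of c (code_of c x) = x"
  by (simp add: com_of_def code_of_def finite_residuals countable_finite)

lemma com_of_residual: "com_of c q \<in> residuals c"
  using self_residual[of c] by (auto simp: com_of_def intro: from_nat_into)

lemma machine_wf:
  assumes "1 < m" shows "tm_wf (machine m c)"
proof -
  have "ss ! i < 10" if "length ss = m" "set ss \<subseteq> {..<10}" "i < m" for ss :: "nat list" and i
    using that nth_mem[of i ss] by blast
  then show ?thesis
    using assms unfolding tm_wf_def
    by (auto simp: machine_def code_of_less self_residual residual_next com_of_residual Let_def
        split: if_splits)
qed

definition tapes :: "nat \<Rightarrow> nat list \<Rightarrow> (nat \<Rightarrow> nat) \<Rightarrow> tape list" where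
  "tapes m w \<rho> =
     map (\<lambda>i. (if i = 0 then word_tape w else (\<lambda>p. if p = 0 then 1 else 0), int (\<rho> i))) [0..<m]"

lemma length_tapes [simp]: "length (tapes m w \<rho>) = m"
  by (simp add: tapes_def)

lemma tapes_cong: "(\<And>i. i < m \<Longrightarrow> \<rho> i = \<rho>' i) \<Longrightarrow> tapes m w \<rho> = tapes m w \<rho>'"
  by (simp add: tapes_def)

lemma scanned_tapes: "i < m \<Longrightarrow> map scanned (tapes m w \<rho>) ! i = cell w i (\<rho> i)"
  by (simp add: tapes_def scanned_def cell_def word_tape_def)

lemma act_tapes:
  assumes "i < m" "mv = Move_Left \<Longrightarrow> 0 < \<rho> i"
  shows "act (cell w i (\<rho> i), mv) (tapes m w \<rho> ! i) = tapes m w (\<lambda>i. moved mv (\<rho> i)) ! i"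
  using assms by (cases mv) (auto simp: tapes_def cell_def word_tape_def fun_eq_iff)

text \<open>Every scanned symbol is written back, so the contents of the tapes are constant and a
  step of the command is exactly one step of the machine.\<close>

lemma machine_step:
  assumes "step w B (x, \<rho>) (y, \<rho>')" "x \<in> residuals c" "regs_below m c" "1 < m"
  shows "tm_step (machine m c) (code_of c x, tapes m w \<rho>) = (code_of c y, tapes m w \<rho>')"
  using assms(1)
proof cases
  case 1
  let ?ss = "map scanned (tapes m w \<rho>)"
  have "next_com (\<lambda>i. ?ss ! i) x = y"
    unfolding 1 using regs_below_residual[OF assms(2,3)] by (intro next_com_cong) (auto simp: scanned_tapes simp del: nth_map)
  moreover have "map2 act (map (\<lambda>i. (?ss ! i, move_of x i)) [0..<m]) (tapes m w \<rho>) = tapes m w \<rho>'"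
  proof (rule nth_equalityI)
    fix i assume "i < length (map2 act (map (\<lambda>i. (?ss ! i, move_of x i)) [0..<m]) (tapes m w \<rho>))"
    then have i: "i < m" by simp
    then have "map2 act (map (\<lambda>i. (?ss ! i, move_of x i)) [0..<m]) (tapes m w \<rho>) ! i
        = act (cell w i (\<rho> i), move_of x i) (tapes m w \<rho> ! i)"
      using scanned_tapes[of i m w \<rho>] by simp
    also have "\<dots> = tapes m w \<rho>' ! i"
      using act_tapes[OF i, of "move_of x i" \<rho> w] 1 i by (simp add: tapes_def)
    finally show "map2 act (map (\<lambda>i. (?ss ! i, move_of x i)) [0..<m]) (tapes m w \<rho>) ! i
        = tapes m w \<rho>' ! i" .
  qed simp
  moreover have "code_of c x \<noteq> 0" "code_of c x \<noteq> 1" "code_of c x \<noteq> 2"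
    by (auto simp: code_of_def)
  ultimately show ?thesis
    using 1 assms(2) by (simp add: tm_step.simps machine_def com_of_code_of Let_def)
qed

lemma machine_init:
  assumes "1 < m"
  shows "tm_step (machine m c) (tm_init (machine m c) w) = (code_of c c, tapes m w (\<lambda>_. 0))"
proof -
  let ?tps = "(word_tape w, 0) # replicate (m - 1) (word_tape [], 0)"
  have len: "length ?tps = m" using assms by simp
  have nth: "?tps ! i = (if i = 0 then (word_tape w, 0) else (word_tape [], 0))" if "i < m" for i
    using that by (cases i) auto
  have "map2 act (map (\<lambda>i. (if i = 0 then map scanned ?tps ! 0 else 1, Stay)) [0..<m]) ?tps
      = tapes m w (\<lambda>_. 0)"
  proof (rule nth_equalityI)
    fix i assume "i < length (map2 act (map (\<lambda>i. (if i = 0 then map scanned ?tps ! 0 else 1, Stay)) [0..<m]) ?tps)"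
    then have i: "i < m" by simp
    then show "map2 act (map (\<lambda>i. (if i = 0 then map scanned ?tps ! 0 else 1, Stay)) [0..<m]) ?tps ! i
        = tapes m w (\<lambda>_. 0) ! i"
      using len by (auto simp: nth tapes_def scanned_def fun_eq_iff word_tape_def)
  qed (use assms in simp)
  moreover have "tm_step (machine m c) (0, tps) = (code_of c c,
      map2 act (map (\<lambda>i. (if i = 0 then map scanned tps ! 0 else 1, Stay)) [0..<m]) tps)" for tps
    by (simp add: machine_def)
  moreover have "tm_init (machine m c) w = (0, ?tps)"
    by (simp add: tm_init_def machine_def)
  ultimately show ?thesis by (simp only:)
qed

lemma machine_finish:
  assumes "1 < m"
  shows "fst (tm_step (machine m c) (code_of c Nop, tapes m w \<rho>)) = (if \<rho> 1 = 0 then 2 else 1)"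
proof -
  have "code_of c Nop \<noteq> 0" "code_of c Nop \<noteq> 1" "code_of c Nop \<noteq> 2"
    by (auto simp: code_of_def)
  then show ?thesis
    using assms scanned_tapes[of 1 m w \<rho>]
    by (simp add: machine_def com_of_code_of Nop_residual Let_def cell_def)
qed

text \<open>Until it reaches a given point of the orbit for the first time, a deterministic process does
  not repeat itself; so the time is bounded by the number of configurations.\<close>

lemma funpow_reach_bound:
  fixes f :: "'a \<Rightarrow> 'a"
  assumes "(f ^^ t) x = y" "\<And>s. s \<le> t \<Longrightarrow> (f ^^ s) x \<in> S" "finite S"
  shows "\<exists>s \<le> card S. (f ^^ s) x = y"
proof -
  define l where "l = (LEAST s. (f ^^ s) x = y)"
  have l: "(f ^^ l) x = y" unfolding l_def using assms(1) by (rule LeastI)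
  have least: "(f ^^ s) x \<noteq> y" if "s < l" for s
    using that not_less_Least unfolding l_def by blast
  have "l \<le> t" unfolding l_def using assms(1) by (rule Least_le)
  have "inj_on (\<lambda>s. (f ^^ s) x) {..l}"
  proof (rule linorder_inj_onI')
    fix i j assume ij: "i \<in> {..l}" "j \<in> {..l}" "i < j"
    show "(f ^^ i) x \<noteq> (f ^^ j) x"
    proof
      assume eq: "(f ^^ i) x = (f ^^ j) x"
      \<comment> \<open>A repetition at times \<open>i < j\<close> could be cut out of the orbit,
        which would bring the process to \<open>y\<close> before the first time
        \<open>l\<close>.\<close>
      have "(f ^^ (l - j + i)) x = (f ^^ (l - j)) ((f ^^ j) x)"
        using eq by (simp add: funpow_add)
      also have "\<dots> = (f ^^ (l - j + j)) x"
        by (simp only: funpow_add o_apply)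
      also have "\<dots> = y" using ij l by simp
      finally have "(f ^^ (l - j + i)) x = y" .
      moreover have "l - j + i < l" using ij by simp
      ultimately show False using least by blast
    qed
  qed
  then have "card {..l} \<le> card S"
    using assms(2,3) \<open>l \<le> t\<close> by (intro card_inj_on_le[of "\<lambda>s. (f ^^ s) x"]) auto
  then have "l \<le> card S" by simp
  then show ?thesis using l by blast
qed

text \<open>The length of the run does not matter: the orbit stays within the pairs of a residual
  command and \<open>m\<close> register values up to \<open>B\<close>. The additional 2 counts the
  step that writes the marks and the one that gives the verdict.\<close>

lemma machine_decides:
  assumes run: "runs w B c (\<lambda>_. 0) \<rho>" and m: "1 < m" "regs_below m c"
  shows "\<exists>n \<le> 2 + card (residuals c) * (B + 1) ^ m.
           fst (tm_run (machine m c) w n) = (if \<rho> 1 = 0 then 2 else 1)"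
proof -
  let ?f = "tm_step (machine m c)"
  let ?x = "(code_of c c, tapes m w (\<lambda>_. 0))"
  define S where "S = (\<lambda>(x, ps). (code_of c x, tapes m w (\<lambda>i. ps ! i))) `
    (residuals c \<times> {ps. set ps \<subseteq> {..B} \<and> length ps = m})"
  have fin: "finite S"
    unfolding S_def by (intro finite_imageI finite_cartesian_product finite_residuals finite_lists_length_eq) simp
  have "card S \<le> card (residuals c \<times> {ps. set ps \<subseteq> {..B} \<and> length ps = m})"
    unfolding S_def by (intro card_image_le finite_cartesian_product finite_residuals finite_lists_length_eq) simp
  then have card: "card S \<le> card (residuals c) * (B + 1) ^ m"
    by (simp add: card_cartesian_product card_lists_length_eq)
  have inS: "(code_of c x, tapes m w \<rho>') \<in> S" if "x \<in> residuals c" "bounded B \<rho>'" for x \<rho>'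
  proof -
    have "tapes m w \<rho>' = tapes m w (\<lambda>i. map \<rho>' [0..<m] ! i)"
      by (rule tapes_cong) simp
    then show ?thesis
      using that unfolding S_def bounded_def
      by (intro image_eqI[of _ _ "(x, map \<rho>' [0..<m])"]) auto
  qed
  have orbit: "fst y \<in> residuals c \<and> bounded B (snd y) \<and>
      (\<exists>t. (?f ^^ t) ?x = (code_of c (fst y), tapes m w (snd y)) \<and> (\<forall>s\<le>t. (?f ^^ s) ?x \<in> S))"
    if "(step w B)\<^sup>*\<^sup>* (c, \<lambda>_. 0) y" for y
    using that
  proof (induction rule: rtranclp_induct)
    case base
    have "bounded B (\<lambda>_. 0)" by (simp add: bounded_def)
    then show ?case by (auto simp: self_residual inS intro!: exI[of _ 0])
  next
    case (step y z)
    then obtain t where t: "(?f ^^ t) ?x = (code_of c (fst y), tapes m w (snd y))"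
      "\<forall>s\<le>t. (?f ^^ s) ?x \<in> S" by blast
    have z: "fst z \<in> residuals c" "bounded B (snd z)"
      using step by (auto elim!: step.cases intro: residual_next)
    have "(?f ^^ Suc t) ?x = (code_of c (fst z), tapes m w (snd z))"
      using t machine_step[of w B "fst y" "snd y" "fst z" "snd z"] step m by simp
    then show ?case
      using z t(2) inS[OF z] by (intro conjI exI[of _ "Suc t"]) (auto simp del: funpow.simps elim: le_SucE)
  qed
  then obtain t where "(?f ^^ t) ?x = (code_of c Nop, tapes m w \<rho>)" "\<forall>s\<le>t. (?f ^^ s) ?x \<in> S"
    using orbit[of "(Nop, \<rho>)"] run unfolding runs_def by auto
  then obtain s where s: "s \<le> card S" "(?f ^^ s) ?x = (code_of c Nop, tapes m w \<rho>)"
    using funpow_reach_bound[of t ?f ?x _ S] fin by blast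
  have "tm_run (machine m c) w (Suc (s + 1)) = ?f ((?f ^^ s) (?f (tm_init (machine m c) w)))"
    by (simp add: tm_run_def funpow_swap1)
  also have "\<dots> = ?f (code_of c Nop, tapes m w \<rho>)"
    using s machine_init[OF m(1)] by simp
  finally have "fst (tm_run (machine m c) w (Suc (s + 1))) = (if \<rho> 1 = 0 then 2 else 1)"
    using machine_finish[OF m(1)] by simp
  then show ?thesis using s(1) card by (intro exI[of _ "Suc (s + 1)"]) auto
qed

section \<open>Programs that evaluate expressions\<close>

abbreviation (input) seq :: "com \<Rightarrow> com \<Rightarrow> com" (infixr ";;" 60) where
  "c1 ;; c2 \<equiv> Then c1 c2"

definition clear :: "nat \<Rightarrow> com" where
  "clear x = Until x 1 (Dec x)"

definition transfer :: "nat \<Rightarrow> nat \<Rightarrow> com" where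
  "transfer x y = Until x 1 (Dec x ;; Inc y)"

definition transfer2 :: "nat \<Rightarrow> nat \<Rightarrow> nat \<Rightarrow> com" where
  "transfer2 x y z = Until x 1 (Dec x ;; Inc y ;; Inc z)"

definition retract :: "nat \<Rightarrow> nat \<Rightarrow> com" where
  "retract x y = Until x 1 (Dec x ;; Dec y)"

lemma runs_countdown:
  assumes "x \<noteq> 0" "bounded B (F (N::nat))" "\<And>j. j \<le> N \<Longrightarrow> F j x = N - j"
    and "\<And>j. j < N \<Longrightarrow> runs w B c (F j) (F (Suc j))"
  shows "runs w B (Until x 1 c) (F 0) (F N)"
  using assms by (intro runs_Until) (auto simp: cell_def)

lemma runs_eq: "runs w B c \<rho> \<rho>1 \<Longrightarrow> \<rho>1 = \<rho>2 \<Longrightarrow> runs w B c \<rho> \<rho>2"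
  by simp

lemma runs_Inc_Then:
  "bounded B \<rho> \<Longrightarrow> \<rho> i < B \<Longrightarrow> runs w B c (\<rho>(i := Suc (\<rho> i))) \<rho>' \<Longrightarrow> runs w B (Inc i ;; c) \<rho> \<rho>'"
  by (rule runs_Then[OF runs_Inc])

lemma runs_Dec_Then:
  "bounded B \<rho> \<Longrightarrow> 0 < \<rho> i \<Longrightarrow> runs w B c (\<rho>(i := \<rho> i - 1)) \<rho>' \<Longrightarrow> runs w B (Dec i ;; c) \<rho> \<rho>'"
  by (rule runs_Then[OF runs_Dec])

lemma runs_Inc': "bounded B \<rho> \<Longrightarrow> \<rho> i < B \<Longrightarrow> \<rho>' = \<rho>(i := Suc (\<rho> i)) \<Longrightarrow> runs w B (Inc i) \<rho> \<rho>'"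
  using runs_Inc by simp

lemma runs_Dec': "bounded B \<rho> \<Longrightarrow> 0 < \<rho> i \<Longrightarrow> \<rho>' = \<rho>(i := \<rho> i - 1) \<Longrightarrow> runs w B (Dec i) \<rho> \<rho>'"
  using runs_Dec by simp

lemma bounded_diff: "bounded B \<rho> \<Longrightarrow> \<rho> i - v \<le> B"
  unfolding bounded_def by (meson diff_le_self le_trans)

lemma runs_clear:
  assumes "bounded B \<rho>" "x \<noteq> 0"
  shows "runs w B (clear x) \<rho> (\<rho>(x := 0))"
proof -
  have "runs w B (Until x 1 (Dec x)) (\<rho>(x := \<rho> x - 0)) (\<rho>(x := \<rho> x - \<rho> x))"
    using assms
    by (intro runs_countdown[where F = "\<lambda>j. \<rho>(x := \<rho> x - j)"])
      (auto intro!: runs_Dec' bounded_upd simp: bounded_diff[OF assms(1)] fun_eq_iff)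
  then show ?thesis by (simp add: clear_def)
qed

lemma runs_transfer:
  assumes "bounded B \<rho>" "x \<noteq> 0" "x \<noteq> y" "\<rho> y + \<rho> x \<le> B"
  shows "runs w B (transfer x y) \<rho> (\<rho>(x := 0, y := \<rho> y + \<rho> x))"
proof -
  have "runs w B (Until x 1 (Dec x ;; Inc y)) (\<rho>(x := \<rho> x - 0, y := \<rho> y + 0))
      (\<rho>(x := \<rho> x - \<rho> x, y := \<rho> y + \<rho> x))"
    using assms
    by (intro runs_countdown[where F = "\<lambda>j. \<rho>(x := \<rho> x - j, y := \<rho> y + j)"]
          runs_Dec_Then runs_Inc')
      (auto intro!: bounded_upd simp: bounded_diff[OF assms(1)] fun_eq_iff)
  then show ?thesis by (simp add: transfer_def)
qed

lemma runs_transfer2: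
  assumes "bounded B \<rho>" "x \<noteq> 0" "x \<noteq> y" "x \<noteq> z" "y \<noteq> z" "\<rho> y + \<rho> x \<le> B" "\<rho> z + \<rho> x \<le> B"
  shows "runs w B (transfer2 x y z) \<rho> (\<rho>(x := 0, y := \<rho> y + \<rho> x, z := \<rho> z + \<rho> x))"
proof -
  have "runs w B (Until x 1 (Dec x ;; Inc y ;; Inc z)) (\<rho>(x := \<rho> x - 0, y := \<rho> y + 0, z := \<rho> z + 0))
      (\<rho>(x := \<rho> x - \<rho> x, y := \<rho> y + \<rho> x, z := \<rho> z + \<rho> x))"
    using assms
    by (intro runs_countdown[where F = "\<lambda>j. \<rho>(x := \<rho> x - j, y := \<rho> y + j, z := \<rho> z + j)"]
          runs_Dec_Then runs_Inc_Then runs_Inc')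
      (auto intro!: bounded_upd simp: bounded_diff[OF assms(1)] fun_eq_iff)
  then show ?thesis by (simp add: transfer2_def)
qed

lemma runs_retract:
  assumes "bounded B \<rho>" "x \<noteq> 0" "x \<noteq> y" "\<rho> x \<le> \<rho> y"
  shows "runs w B (retract x y) \<rho> (\<rho>(x := 0, y := \<rho> y - \<rho> x))"
proof -
  have "runs w B (Until x 1 (Dec x ;; Dec y)) (\<rho>(x := \<rho> x - 0, y := \<rho> y - 0))
      (\<rho>(x := \<rho> x - \<rho> x, y := \<rho> y - \<rho> x))"
    using assms
    by (intro runs_countdown[where F = "\<lambda>j. \<rho>(x := \<rho> x - j, y := \<rho> y - j)"]
          runs_Dec_Then runs_Dec')
      (auto intro!: bounded_upd simp: bounded_diff[OF assms(1)] fun_eq_iff)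
  then show ?thesis by (simp add: retract_def)
qed

text \<open>An expression at depth \<open>d\<close> is a program that may use the registers from \<open>d\<close> on as a stack
  (they are zero at the beginning) and leaves its value in register \<open>d\<close>, without changing the other
  registers. Variables bound by an expression are passed as expressions to its body.\<close>

type_synonym expr = "nat \<Rightarrow> com"

text \<open>Reading a register by counting down destroys it; the second copy on the stack serves to
  restore it.\<close>

definition var_expr :: "nat \<Rightarrow> expr" where
  "var_expr l = (\<lambda>d. transfer2 l d (d + 1) ;; transfer (d + 1) l)"

definition zero_expr :: expr where
  "zero_expr = (\<lambda>d. Nop)"

definition suc_expr :: "expr \<Rightarrow> expr" where
  "suc_expr e = (\<lambda>d. e d ;; Inc d)"

definition plus_expr :: "expr \<Rightarrow> expr \<Rightarrow> expr" where
  "plus_expr e f = (\<lambda>d. e d ;; f (d + 1) ;; transfer (d + 1) d)"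

definition minus_expr :: "expr \<Rightarrow> expr \<Rightarrow> expr" where
  "minus_expr e f = (\<lambda>d. e d ;; f (d + 1) ;;
     Until (d + 1) 1 (Dec (d + 1) ;; Branch d 1 Nop (Dec d)))"

definition ifz_expr :: "expr \<Rightarrow> expr \<Rightarrow> expr \<Rightarrow> expr" where
  "ifz_expr e f g = (\<lambda>d. e d ;; Branch d 1 (f d) (clear d ;; g d))"

text \<open>The head on the input is driven to the position and then back to 0, the copy in register
  \<open>d + 1\<close> remembering the distance.\<close>

definition symbol_expr :: "nat \<Rightarrow> expr \<Rightarrow> expr" where
  "symbol_expr a e = (\<lambda>d. e d ;; transfer2 d 0 (d + 1) ;; Branch 0 a (Inc d) Nop ;; retract (d + 1) 0)"

definition length_expr :: expr where
  "length_expr = (\<lambda>d. Until 0 0 (Inc 0 ;; Inc d ;; Inc (d + 1)) ;; retract (d + 1) 0)"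

text \<open>Register \<open>d\<close> holds the accumulator, \<open>d + 1\<close> the index of the
  round and \<open>d + 2\<close> the number of rounds left; the body works from \<open>d + 3\<close>
  on and sees the first two as variables.\<close>

definition iter_expr :: "expr \<Rightarrow> expr \<Rightarrow> (expr \<Rightarrow> expr \<Rightarrow> expr) \<Rightarrow> expr" where
  "iter_expr n a f = (\<lambda>d. a d ;; n (d + 2) ;;
     Until (d + 2) 1 (Dec (d + 2) ;; f (var_expr d) (var_expr (d + 1)) (d + 3) ;; clear d ;;
       transfer (d + 3) d ;; Inc (d + 1)) ;;
     clear (d + 1))"

type_synonym state = "nat \<times> (nat \<Rightarrow> nat)"

definition valid_state :: "nat \<Rightarrow> state \<Rightarrow> bool" where
  "valid_state B W \<longleftrightarrow>
     1 \<le> fst W \<and> snd W 0 = 0 \<and> (\<forall>i\<ge>fst W. snd W i = 0) \<and> bounded B (snd W)"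

definition extends :: "nat \<Rightarrow> state \<Rightarrow> state \<Rightarrow> bool" where
  "extends B W W' \<longleftrightarrow> valid_state B W' \<and> fst W \<le> fst W' \<and> (\<forall>i<fst W. snd W' i = snd W i)"

text \<open>The quantification over the extensions of \<open>W\<close> makes evaluation persistent, so that an expression
  can also be used at greater depth, inside the body of an iteration.\<close>

definition evaluates :: "nat list \<Rightarrow> nat \<Rightarrow> state \<Rightarrow> expr \<Rightarrow> nat \<Rightarrow> bool" where
  "evaluates w B W e v \<longleftrightarrow>
     (\<forall>d \<rho>. extends B W (d, \<rho>) \<longrightarrow> runs w B (e d) \<rho> (\<rho>(d := v)))"

lemma extends_trans: "extends B W W' \<Longrightarrow> extends B W' W'' \<Longrightarrow> extends B W W''"
  by (auto simp: extends_def)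

lemma evaluatesI:
  "(\<And>d \<rho>. extends B W (d, \<rho>) \<Longrightarrow> runs w B (e d) \<rho> (\<rho>(d := v))) \<Longrightarrow> evaluates w B W e v"
  by (simp add: evaluates_def)

lemma evaluatesD:
  "evaluates w B W e v \<Longrightarrow> extends B W (d, \<rho>) \<Longrightarrow> \<rho>' = \<rho>(d := v) \<Longrightarrow> runs w B (e d) \<rho> \<rho>'"
  by (simp add: evaluates_def)

lemma evaluates_mono: "evaluates w B W e v \<Longrightarrow> extends B W W' \<Longrightarrow> evaluates w B W' e v"
  unfolding evaluates_def using extends_trans by blast

text \<open>A computed value ends up in a register of a bounded run. So bounds on subexpressions
  come for free and need no hypotheses of their own, provided that some extension of the state
  exists.\<close>

lemma evaluates_le: "evaluates w B W e v \<Longrightarrow> extends B W W' \<Longrightarrow> v \<le> B"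
  using runs_bounded[OF evaluatesD[of w B W e v "fst W'" "snd W'", OF _ _ refl]]
  by (auto simp: bounded_def dest: spec[of _ "fst W'"])

lemma extends_push: "extends B W (d, \<rho>) \<Longrightarrow> v \<le> B \<Longrightarrow> d < d' \<Longrightarrow> extends B W (d', \<rho>(d := v))"
  by (auto simp: extends_def valid_state_def bounded_upd)

lemma extendsD:
  assumes "extends B W (d, \<rho>)"
  shows "bounded B \<rho>" "d \<noteq> 0" "\<rho> 0 = 0" "\<And>i. d \<le> i \<Longrightarrow> \<rho> i = 0"
  using assms by (auto simp: extends_def valid_state_def)

lemma evaluates_var:
  assumes "0 < l" "l < fst W" "v = snd W l"
  shows "evaluates w B W (var_expr l) v"
proof (rule evaluatesI)
  fix d \<rho> assume W: "extends B W (d, \<rho>)"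
  note [simp] = extendsD(4)[OF W]
  have v: "\<rho> l = v" "l < d" "v \<le> B" using W assms by (auto simp: extends_def valid_state_def bounded_def dest: spec[of _ l])
  have "runs w B (transfer2 l d (d + 1)) \<rho> (\<rho>(l := 0, d := v, d + 1 := v))"
    by (rule runs_eq[OF runs_transfer2]) (use v W assms in \<open>auto simp: extendsD(1)\<close>)
  moreover have "runs w B (transfer (d + 1) l) (\<rho>(l := 0, d := v, d + 1 := v)) (\<rho>(d := v))"
    by (rule runs_eq[OF runs_transfer])
      (use v W assms in \<open>auto simp: extendsD(1) bounded_upd fun_eq_iff\<close>)
  ultimately show "runs w B (var_expr l d) \<rho> (\<rho>(d := v))"
    unfolding var_expr_def by (rule runs_Then)
qed

lemma evaluates_zero: "evaluates w B W zero_expr 0"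
proof (rule evaluatesI)
  fix d \<rho> assume W: "extends B W (d, \<rho>)"
  then have "\<rho>(d := 0) = \<rho>" using extendsD(4)[of B W d \<rho> d] by auto
  then show "runs w B (zero_expr d) \<rho> (\<rho>(d := 0))"
    using W by (simp add: zero_expr_def runs_Nop extendsD)
qed

lemma evaluates_suc:
  assumes "evaluates w B W e v" "Suc v \<le> B"
  shows "evaluates w B W (suc_expr e) (Suc v)"
proof (rule evaluatesI)
  fix d \<rho> assume W: "extends B W (d, \<rho>)"
  show "runs w B (suc_expr e d) \<rho> (\<rho>(d := Suc v))"
    unfolding suc_expr_def
    using assms extendsD(1)[OF W] by (intro runs_Then[OF evaluatesD[OF assms(1) W refl] runs_Inc'])
      (auto simp: bounded_upd)
qed

lemma evaluates_plus:
  assumes "evaluates w B W e v" "evaluates w B W f u" "v + u \<le> B"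
  shows "evaluates w B W (plus_expr e f) (v + u)"
proof (rule evaluatesI)
  fix d \<rho> assume W: "extends B W (d, \<rho>)"
  note [simp] = extendsD(4)[OF W]
  have "runs w B (transfer (d + 1) d) (\<rho>(d := v, d + 1 := u)) (\<rho>(d := v + u))"
    by (rule runs_eq[OF runs_transfer])
      (use assms W in \<open>auto simp: extendsD(1) bounded_upd fun_eq_iff\<close>)
  moreover have "extends B W (d + 1, \<rho>(d := v))"
    using assms by (intro extends_push[OF W]) auto
  ultimately show "runs w B (plus_expr e f d) \<rho> (\<rho>(d := v + u))"
    unfolding plus_expr_def
    by (intro runs_Then[OF evaluatesD[OF assms(1) W refl] runs_Then[OF evaluatesD[OF assms(2) _ refl]]])
qed

lemma evaluates_minus:
  assumes "evaluates w B W e v" "evaluates w B W f u"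
  shows "evaluates w B W (minus_expr e f) (v - u)"
proof (rule evaluatesI)
  fix d \<rho> assume W: "extends B W (d, \<rho>)"
  note [simp] = extendsD(4)[OF W]
  have le: "v \<le> B" "u \<le> B" using assms W evaluates_le by blast+
  let ?F = "\<lambda>j. \<rho>(d := v - j, d + 1 := u - j)"
  have bounded: "bounded B (?F j)" for j
    using W le by (intro bounded_upd) (auto simp: extendsD)
  have "runs w B (Until (d + 1) 1 (Dec (d + 1) ;; Branch d 1 Nop (Dec d))) (?F 0) (?F u)"
  proof (rule runs_countdown[where F = ?F])
    fix j assume j: "j < u"
    have b: "bounded B ((?F j)(d + 1 := u - Suc j))"
      by (rule bounded_upd[OF bounded]) (use le in auto)
    show "runs w B (Dec (d + 1) ;; Branch d 1 Nop (Dec d)) (?F j) (?F (Suc j))"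
    proof (rule runs_Then[OF runs_Dec' runs_Branch])
      show "runs w B (if cell w d (((?F j)(d + 1 := u - Suc j)) d) = 1 then Nop else Dec d)
        ((?F j)(d + 1 := u - Suc j)) (?F (Suc j))"
      proof (cases "v \<le> j")
        case True
        then show ?thesis
          using b runs_Nop[OF b, of w] extendsD(2)[OF W] by (simp add: cell_def fun_upd_twist)
      next
        case False
        then show ?thesis
          using b extendsD(2)[OF W] by (auto simp: cell_def fun_eq_iff intro!: runs_Dec')
      qed
    qed (use j bounded in \<open>auto\<close>)
  qed (use bounded[of u] in auto)
  moreover have "?F 0 = (\<rho>(d := v))(d + 1 := u)" "?F u = \<rho>(d := v - u)"
    by (auto simp: fun_eq_iff)
  moreover have "extends B W (d + 1, \<rho>(d := v))"
    using le by (intro extends_push[OF W]) auto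
  ultimately show "runs w B (minus_expr e f d) \<rho> (\<rho>(d := v - u))"
    unfolding minus_expr_def
    by (intro runs_Then[OF evaluatesD[OF assms(1) W refl] runs_Then[OF evaluatesD[OF assms(2) _ refl]]])
      simp_all
qed

lemma evaluates_ifz:
  assumes "evaluates w B W e v" "v = 0 \<Longrightarrow> evaluates w B W f u" "v \<noteq> 0 \<Longrightarrow> evaluates w B W g u"
  shows "evaluates w B W (ifz_expr e f g) u"
proof (rule evaluatesI)
  fix d \<rho> assume W: "extends B W (d, \<rho>)"
  note W' = extendsD[OF W]
  have upd: "\<rho>(d := 0) = \<rho>" using W' by auto
  have "v \<le> B" using assms(1) W evaluates_le by blast
  then have b: "bounded B (\<rho>(d := v))" using W' by (simp add: bounded_upd)
  show "runs w B (ifz_expr e f g d) \<rho> (\<rho>(d := u))"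
    unfolding ifz_expr_def
  proof (rule runs_Then[OF evaluatesD[OF assms(1) W refl] runs_Branch])
    show "runs w B (if cell w d ((\<rho>(d := v)) d) = 1 then f d else clear d ;; g d) (\<rho>(d := v)) (\<rho>(d := u))"
    proof (cases "v = 0")
      case True
      then show ?thesis
        using evaluatesD[OF assms(2) W refl] upd W' by (simp add: cell_def)
    next
      case False
      have "runs w B (clear d) (\<rho>(d := v)) \<rho>"
        by (rule runs_eq[OF runs_clear]) (use b upd W' in auto)
      then show ?thesis
        using False runs_Then[OF _ evaluatesD[OF assms(3) W refl]] W' by (simp add: cell_def)
    qed
  qed
qed

lemma evaluates_symbol:
  assumes "evaluates w B W e p" "1 \<le> B"
  shows "evaluates w B W (symbol_expr a e) (of_bool ((if p < length w then w ! p else 0) = a))"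
proof (rule evaluatesI)
  fix d \<rho> assume W: "extends B W (d, \<rho>)"
  note W' = extendsD[OF W]
  note [simp] = W'(4)
  let ?v = "of_bool ((if p < length w then w ! p else 0) = a) :: nat"
  have p: "p \<le> B" using assms(1) W evaluates_le by blast
  have "runs w B (transfer2 d 0 (d + 1)) (\<rho>(d := p)) (\<rho>(0 := p, d + 1 := p))"
    by (rule runs_eq[OF runs_transfer2]) (use p W' in \<open>auto simp: bounded_upd fun_eq_iff\<close>)
  moreover have "runs w B (Branch 0 a (Inc d) Nop) (\<rho>(0 := p, d + 1 := p))
      (\<rho>(0 := p, d + 1 := p, d := ?v))"
    using p W' assms(2)
    by (intro runs_Branch)
      (auto simp: bounded_upd fun_eq_iff cell_def intro!: runs_Inc' runs_eq[OF runs_Nop])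
  moreover have "runs w B (retract (d + 1) 0) (\<rho>(0 := p, d + 1 := p, d := ?v)) (\<rho>(d := ?v))"
    by (rule runs_eq[OF runs_retract])
      (use p W' assms(2) in \<open>auto simp: bounded_upd fun_eq_iff\<close>)
  ultimately show "runs w B (symbol_expr a e d) \<rho> (\<rho>(d := ?v))"
    unfolding symbol_expr_def by (intro runs_Then[OF evaluatesD[OF assms(1) W refl]] runs_Then)
qed

lemma evaluates_input_length:
  assumes "0 \<notin> set w" "length w \<le> B"
  shows "evaluates w B W length_expr (length w)"
proof (rule evaluatesI)
  fix d \<rho> assume W: "extends B W (d, \<rho>)"
  note W' = extendsD[OF W]
  note [simp] = W'(4)
  let ?F = "\<lambda>j. \<rho>(0 := j, d := j, d + 1 := j)"
  have "runs w B (Until 0 0 (Inc 0 ;; Inc d ;; Inc (d + 1))) (?F 0) (?F (length w))"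
  proof (rule runs_Until[where F = ?F])
    fix j assume j: "j < length w"
    then have "w ! j \<noteq> 0" using assms(1) nth_mem by metis
    then show "cell w 0 (?F j 0) \<noteq> 0" using j W' by (simp add: cell_def)
    show "runs w B (Inc 0 ;; Inc d ;; Inc (d + 1)) (?F j) (?F (Suc j))"
      using j W' assms(2)
      by (intro runs_Inc_Then runs_Inc')
        (auto simp: bounded_upd fun_eq_iff)
  qed (use W' assms(2) in \<open>auto simp: bounded_upd cell_def\<close>)
  moreover have "?F 0 = \<rho>" using W' by (auto simp: fun_eq_iff)
  moreover have "runs w B (retract (d + 1) 0) (?F (length w)) (\<rho>(d := length w))"
    by (rule runs_eq[OF runs_retract]) (use W' assms(2) in \<open>auto simp: bounded_upd fun_eq_iff\<close>)
  ultimately show "runs w B (length_expr d) \<rho> (\<rho>(d := length w))"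
    unfolding length_expr_def by (auto intro: runs_Then)
qed

text \<open>The sequence \<open>A\<close> is the loop invariant for the accumulator. The body is
  assumed to evaluate in every extension, since it is run above the three loop registers.\<close>

lemma evaluates_iter:
  assumes n: "evaluates w B W n N" and a: "evaluates w B W a (A 0)"
    and f: "\<And>i W' x y. i < N \<Longrightarrow> extends B W W' \<Longrightarrow> evaluates w B W' x (A i) \<Longrightarrow>
      evaluates w B W' y i \<Longrightarrow> evaluates w B W' (f x y) (A (Suc i))"
  shows "evaluates w B W (iter_expr n a f) (A N)"
proof (rule evaluatesI)
  fix d \<rho> assume W: "extends B W (d, \<rho>)"
  note W' = extendsD[OF W]
  note [simp] = W'(4)
  have N: "N \<le> B" using n W evaluates_le by blast
  have A0: "A 0 \<le> B" using a W evaluates_le by blast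
  define F where "F = (\<lambda>i. \<rho>(d := A i, d + 1 := i, d + 2 := N - i))"
  define G where "G = (\<lambda>i. \<rho>(d := A i, d + 1 := i, d + 2 := N - Suc i))"
  have G: "extends B W (d + 3, G i)" if "i < N" "A i \<le> B" for i
    using W that N unfolding G_def by (auto simp: extends_def valid_state_def bounded_upd)
  have A_Suc: "evaluates w B (d + 3, G i) (f (var_expr d) (var_expr (d + 1))) (A (Suc i))"
    if "i < N" "A i \<le> B" for i
    using W' by (intro f[OF that(1) G[OF that]] evaluates_var) (auto simp: G_def)
  \<comment> \<open>The intermediate values are bounded by induction: as long as \<open>A i\<close>
    fits, the body runs in a valid state, and its result fits because that run is bounded.\<close>
  have A: "i \<le> N \<Longrightarrow> A i \<le> B" for i
  proof (induction i)
    case (Suc i)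
    have "extends B (d + 3, G i) (d + 3, G i)"
      using G[of i] Suc by (auto simp: extends_def)
    then show ?case
      using A_Suc[of i] Suc evaluates_le by simp
  qed (rule A0)
  have b: "bounded B (F i)" if "i \<le> N" for i
    using that W' A[OF that] N unfolding F_def by (intro bounded_upd) auto
  have loop: "runs w B (Until (d + 2) 1 (Dec (d + 2) ;; f (var_expr d) (var_expr (d + 1)) (d + 3) ;;
      clear d ;; transfer (d + 3) d ;; Inc (d + 1))) (F 0) (F N)"
  proof (rule runs_countdown[where F = F])
    fix i assume i: "i < N"
    have "runs w B (Dec (d + 2)) (F i) (G i)"
      using i b[of i] by (intro runs_Dec') (auto simp: F_def G_def fun_eq_iff)
    moreover have "runs w B (f (var_expr d) (var_expr (d + 1)) (d + 3)) (G i) ((G i)(d + 3 := A (Suc i)))"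
      using A_Suc[of i] A[of i] G[of i] i by (intro evaluatesD) (auto simp: extends_def)
    moreover have "runs w B (clear d) ((G i)(d + 3 := A (Suc i))) ((G i)(d + 3 := A (Suc i), d := 0))"
      using W' extendsD(1)[OF G[of i]] A[of i] A[of "Suc i"] i by (intro runs_clear) (auto simp: bounded_upd)
    moreover have "runs w B (transfer (d + 3) d) ((G i)(d + 3 := A (Suc i), d := 0))
        ((G i)(d := A (Suc i)))"
      by (rule runs_eq[OF runs_transfer])
        (use W' extendsD(1)[OF G[of i]] A[of i] A[of "Suc i"] i in
          \<open>auto simp: bounded_upd fun_eq_iff\<close>, auto simp: G_def)
    moreover have "runs w B (Inc (d + 1)) ((G i)(d := A (Suc i))) (F (Suc i))"
      by (rule runs_Inc')
        (use W' extendsD(1)[OF G[of i]] A[of i] A[of "Suc i"] i N in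
          \<open>auto simp: bounded_upd fun_eq_iff G_def F_def\<close>)
    ultimately show "runs w B (Dec (d + 2) ;; f (var_expr d) (var_expr (d + 1)) (d + 3) ;;
      clear d ;; transfer (d + 3) d ;; Inc (d + 1)) (F i) (F (Suc i))"
      by (intro runs_Then)
  qed (use b[of N] in \<open>auto simp: F_def\<close>)
  have "runs w B (a d) \<rho> (\<rho>(d := A 0))"
    by (rule evaluatesD[OF a W refl])
  moreover have "runs w B (n (d + 2)) (\<rho>(d := A 0)) (F 0)"
    by (rule evaluatesD[OF n extends_push[OF W A0]]) (auto simp: F_def fun_eq_iff)
  moreover have "runs w B (clear (d + 1)) (F N) (\<rho>(d := A N))"
    by (rule runs_eq[OF runs_clear[OF b[of N]]]) (auto simp: F_def fun_eq_iff)
  ultimately show "runs w B (iter_expr n a f d) \<rho> (\<rho>(d := A N))"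
    unfolding iter_expr_def using loop by (intro runs_Then)
qed

section \<open>Boolean and arithmetic expressions\<close>

definition one_expr :: expr where
  "one_expr = suc_expr zero_expr"

definition two_expr :: expr where
  "two_expr = suc_expr one_expr"

definition neg_expr :: "expr \<Rightarrow> expr" where
  "neg_expr e = ifz_expr e one_expr zero_expr"

definition conj_expr :: "expr \<Rightarrow> expr \<Rightarrow> expr" where
  "conj_expr e f = ifz_expr e zero_expr f"

definition eq_expr :: "expr \<Rightarrow> expr \<Rightarrow> expr" where
  "eq_expr e f = ifz_expr (minus_expr e f) (ifz_expr (minus_expr f e) one_expr zero_expr) zero_expr"

definition count_expr :: "expr \<Rightarrow> (expr \<Rightarrow> expr) \<Rightarrow> expr" where
  "count_expr n \<phi> = iter_expr n zero_expr (\<lambda>acc i. plus_expr acc (\<phi> i))"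

text \<open>All witnesses are counted, without leaving the loop early; the time bound is insensitive
  to this, and the count is bounded by the range.\<close>

definition exists_less_expr :: "expr \<Rightarrow> (expr \<Rightarrow> expr) \<Rightarrow> expr" where
  "exists_less_expr n \<phi> = ifz_expr (count_expr n \<phi>) zero_expr one_expr"

definition all_less_expr :: "expr \<Rightarrow> (expr \<Rightarrow> expr) \<Rightarrow> expr" where
  "all_less_expr n \<phi> = neg_expr (exists_less_expr n (\<lambda>i. neg_expr (\<phi> i)))"

definition times_expr :: "expr \<Rightarrow> expr \<Rightarrow> expr" where
  "times_expr e f = iter_expr f zero_expr (\<lambda>acc i. plus_expr acc e)"

definition power_expr :: "expr \<Rightarrow> expr \<Rightarrow> expr" where
  "power_expr e f = iter_expr f one_expr (\<lambda>acc i. times_expr acc e)"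

text \<open>A counter that is reset whenever it reaches the modulus. With modulus 0 it is never
  reset, in agreement with \<open>v mod 0 = v\<close>.\<close>

definition modulo_expr :: "expr \<Rightarrow> expr \<Rightarrow> expr" where
  "modulo_expr e f = iter_expr e zero_expr (\<lambda>acc i. ifz_expr (eq_expr (suc_expr acc) f) (suc_expr acc) zero_expr)"

definition divide_expr :: "expr \<Rightarrow> expr \<Rightarrow> expr" where
  "divide_expr e f = iter_expr e zero_expr (\<lambda>acc i. ifz_expr (modulo_expr (suc_expr i) f) (suc_expr acc) acc)"

definition digit_expr :: "expr \<Rightarrow> expr \<Rightarrow> expr \<Rightarrow> expr" where
  "digit_expr m D j = modulo_expr (iter_expr j m (\<lambda>acc i. divide_expr acc D)) D"

definition even_expr :: "expr \<Rightarrow> expr" where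
  "even_expr e = neg_expr (modulo_expr e two_expr)"

lemma evaluates_vacuous: "(\<And>W'. \<not> extends B W W') \<Longrightarrow> evaluates w B W e v"
  by (simp add: evaluates_def)

text \<open>Evaluation is vacuous in a state without extensions; otherwise an extension is at hand,
  which is what \<open>evaluates_le\<close> asks for.\<close>

lemma evaluatesI2:
  "(\<And>W'. extends B W W' \<Longrightarrow> evaluates w B W e v) \<Longrightarrow> evaluates w B W e v"
  by (metis evaluates_vacuous)

lemma evaluates_one: "1 \<le> B \<Longrightarrow> evaluates w B W one_expr 1"
  unfolding one_expr_def using evaluates_suc[OF evaluates_zero] by simp

lemma evaluates_two: "2 \<le> B \<Longrightarrow> evaluates w B W two_expr 2"
  unfolding two_expr_def using evaluates_suc[OF evaluates_one, of B w W] by (simp add: numeral_2_eq_2)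

lemma evaluates_neg:
  assumes "evaluates w B W e (of_bool P)" "1 \<le> B"
  shows "evaluates w B W (neg_expr e) (of_bool (\<not> P))"
  unfolding neg_expr_def
  using assms by (intro evaluates_ifz[OF assms(1)]) (auto intro: evaluates_one[simplified] evaluates_zero)

lemma evaluates_conj:
  assumes "evaluates w B W e (of_bool P)" "P \<Longrightarrow> evaluates w B W f (of_bool Q)"
  shows "evaluates w B W (conj_expr e f) (of_bool (P \<and> Q))"
  unfolding conj_expr_def
  using assms by (intro evaluates_ifz[OF assms(1)]) (auto intro: evaluates_zero)

lemma evaluates_ifz_bool:
  assumes "evaluates w B W e (of_bool P)" "\<not> P \<Longrightarrow> evaluates w B W f (of_bool Q)"
    "P \<Longrightarrow> evaluates w B W g (of_bool R)"
  shows "evaluates w B W (ifz_expr e f g) (of_bool (if P then R else Q))"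
  using assms by (intro evaluates_ifz[OF assms(1)]) auto

lemma evaluates_eq:
  assumes "evaluates w B W e v" "evaluates w B W f u" "1 \<le> B"
  shows "evaluates w B W (eq_expr e f) (of_bool (v = u))"
  unfolding eq_expr_def
proof (rule evaluates_ifz[OF evaluates_minus[OF assms(1,2)] evaluates_ifz[OF evaluates_minus[OF assms(2,1)]]])
qed (use assms(3) evaluates_one[of B w W] evaluates_zero in \<open>auto simp: of_bool_def\<close>)

lemma evaluates_count:
  assumes "evaluates w B W n N" "1 \<le> B"
    and "\<And>i W' y. i < N \<Longrightarrow> extends B W W' \<Longrightarrow> evaluates w B W' y i \<Longrightarrow>
      evaluates w B W' (\<phi> y) (of_bool (P i))"
  shows "evaluates w B W (count_expr n \<phi>) (card {i. i < N \<and> P i})"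
proof (rule evaluatesI2)
  fix W' assume "extends B W W'"
  then have N: "N \<le> B" using assms(1) evaluates_le by blast
  have Suc: "card {j. j < Suc i \<and> P j} = card {j. j < i \<and> P j} + of_bool (P i)" for i
  proof -
    have "{j. j < Suc i \<and> P j} = {j. j < i \<and> P j} \<union> (if P i then {i} else {})"
      by (auto simp: less_Suc_eq)
    then show ?thesis by (simp add: card_insert_if)
  qed
  have le: "card {j. j < i \<and> P j} \<le> i" for i
    using card_mono[of "{..<i}" "{j. j < i \<and> P j}"] by auto
  show "evaluates w B W (count_expr n \<phi>) (card {i. i < N \<and> P i})"
    unfolding count_expr_def
  proof (rule evaluates_iter[OF assms(1)])
    fix i W' x y
    assume i: "i < N" "extends B W W'" "evaluates w B W' x (card {j. j < i \<and> P j})"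
      "evaluates w B W' y i"
    have "card {j. j < i \<and> P j} + of_bool (P i) \<le> B"
      using le[of "Suc i"] i(1) N Suc by simp
    then show "evaluates w B W' (plus_expr x (\<phi> y)) (card {j. j < Suc i \<and> P j})"
      unfolding Suc using i by (intro evaluates_plus assms(3)) auto
  qed (simp add: evaluates_zero)
qed

lemma evaluates_exists_less:
  assumes "evaluates w B W n N" "1 \<le> B"
    and "\<And>i W' y. i < N \<Longrightarrow> extends B W W' \<Longrightarrow> evaluates w B W' y i \<Longrightarrow>
      evaluates w B W' (\<phi> y) (of_bool (P i))"
  shows "evaluates w B W (exists_less_expr n \<phi>) (of_bool (\<exists>i<N. P i))"
  unfolding exists_less_expr_def
  using assms(2)
  by (intro evaluates_ifz[OF evaluates_count[OF assms]])
    (auto simp: evaluates_zero evaluates_one[simplified])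

lemma evaluates_all_less:
  assumes "evaluates w B W n N" "1 \<le> B"
    and "\<And>i W' y. i < N \<Longrightarrow> extends B W W' \<Longrightarrow> evaluates w B W' y i \<Longrightarrow>
      evaluates w B W' (\<phi> y) (of_bool (P i))"
  shows "evaluates w B W (all_less_expr n \<phi>) (of_bool (\<forall>i<N. P i))"
proof -
  have "evaluates w B W (all_less_expr n \<phi>) (of_bool (\<not> (\<exists>i<N. \<not> P i)))"
    unfolding all_less_expr_def using assms by (intro evaluates_neg evaluates_exists_less) auto
  then show ?thesis by simp
qed

lemma evaluates_times:
  assumes e: "evaluates w B W e v" and f: "evaluates w B W f u" and le: "v * u \<le> B"
  shows "evaluates w B W (times_expr e f) (v * u)"
  unfolding times_expr_def
proof (rule evaluates_iter[OF f, where A = "\<lambda>i. v * i"])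
  fix i W' x y
  assume i: "i < u" "extends B W W'" "evaluates w B W' x (v * i)" "evaluates w B W' y i"
  have "v * Suc i \<le> v * u" using i(1) by (intro mult_le_mono2) auto
  then have "evaluates w B W' (plus_expr x e) (v * i + v)"
    using le i by (intro evaluates_plus evaluates_mono[OF e]) auto
  then show "evaluates w B W' (plus_expr x e) (v * Suc i)"
    by (simp add: add.commute)
qed (simp add: evaluates_zero)

lemma evaluates_power:
  assumes e: "evaluates w B W e v" and f: "evaluates w B W f u" and le: "v ^ u \<le> B" and v: "1 \<le> v"
  shows "evaluates w B W (power_expr e f) (v ^ u)"
  unfolding power_expr_def
proof (rule evaluates_iter[OF f])
  fix i W' x y
  assume i: "i < u" "extends B W W'" "evaluates w B W' x (v ^ i)" "evaluates w B W' y i"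
  have "v ^ Suc i \<le> v ^ u" using i(1) v by (intro power_increasing) auto
  then have "evaluates w B W' (times_expr x e) (v ^ i * v)"
    using le i by (intro evaluates_times evaluates_mono[OF e]) (auto simp: mult.commute)
  then show "evaluates w B W' (times_expr x e) (v ^ Suc i)"
    by (simp add: mult.commute)
next
  have "1 \<le> v ^ u" using v by simp
  then show "evaluates w B W one_expr (v ^ 0)" using le by (simp add: evaluates_one[simplified])
qed

lemma evaluates_modulo:
  assumes e: "evaluates w B W e v" and f: "evaluates w B W f u" and B: "1 \<le> B"
  shows "evaluates w B W (modulo_expr e f) (v mod u)"
  unfolding modulo_expr_def
proof (rule evaluates_iter[OF e, where A = "\<lambda>i. i mod u"])
  fix i W' x y
  assume i: "i < v" "extends B W W'" "evaluates w B W' x (i mod u)" "evaluates w B W' y i"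
  have "v \<le> B" using e i(2) evaluates_le by blast
  then have "Suc (i mod u) \<le> B" using i(1) mod_less_eq_dividend[of i u] by linarith
  then have suc_x: "evaluates w B W' (suc_expr x) (Suc (i mod u))"
    using i by (intro evaluates_suc) auto
  show "evaluates w B W' (ifz_expr (eq_expr (suc_expr x) f) (suc_expr x) zero_expr) (Suc i mod u)"
    by (rule evaluates_ifz[OF evaluates_eq[OF suc_x evaluates_mono[OF f i(2)] B]])
      (use suc_x in \<open>auto simp: mod_Suc evaluates_zero\<close>)
qed (simp add: evaluates_zero)

lemma evaluates_divide:
  assumes e: "evaluates w B W e v" and f: "evaluates w B W f u" and B: "1 \<le> B"
  shows "evaluates w B W (divide_expr e f) (v div u)"
  unfolding divide_expr_def
proof (rule evaluates_iter[OF e, where A = "\<lambda>i. i div u"])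
  fix i W' x y
  assume i: "i < v" "extends B W W'" "evaluates w B W' x (i div u)" "evaluates w B W' y i"
  have v: "v \<le> B" using e i(2) evaluates_le by blast
  then have "Suc (i div u) \<le> B" using i(1) div_le_dividend[of i u] by linarith
  then have suc_x: "evaluates w B W' (suc_expr x) (Suc (i div u))"
    using i by (intro evaluates_suc) auto
  have suci: "evaluates w B W' (suc_expr y) (Suc i)"
    using i v by (intro evaluates_suc) auto
  show "evaluates w B W' (ifz_expr (modulo_expr (suc_expr y) f) (suc_expr x) x) (Suc i div u)"
    by (rule evaluates_ifz[OF evaluates_modulo[OF suci evaluates_mono[OF f i(2)] B]])
      (use suc_x i in \<open>auto simp: div_Suc\<close>)
qed (simp add: evaluates_zero)

lemma evaluates_digit:
  assumes m: "evaluates w B W m M" and D: "evaluates w B W D v" and j: "evaluates w B W j J"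
    and B: "1 \<le> B"
  shows "evaluates w B W (digit_expr m D j) (M div v ^ J mod v)"
  unfolding digit_expr_def
proof (rule evaluates_modulo[OF evaluates_iter[OF j] D B])
  fix i W' x y
  assume i: "i < J" "extends B W W'" "evaluates w B W' x (M div v ^ i)" "evaluates w B W' y i"
  have "evaluates w B W' (divide_expr x D) (M div v ^ i div v)"
    using i B by (intro evaluates_divide evaluates_mono[OF D])
  then show "evaluates w B W' (divide_expr x D) (M div v ^ Suc i)"
    by (simp add: div_mult2_eq mult.commute[of v])
qed (simp add: m)

lemma evaluates_evenp:
  assumes "evaluates w B W e v" "2 \<le> B"
  shows "evaluates w B W (even_expr e) (of_bool (even v))"
proof -
  have "evaluates w B W (modulo_expr e two_expr) (v mod 2)"
    using assms by (intro evaluates_modulo evaluates_two) auto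
  then have "evaluates w B W (modulo_expr e two_expr) (of_bool (odd v))"
    by (simp add: mod_2_eq_odd)
  then show ?thesis
    unfolding even_expr_def using assms(2) evaluates_neg by fastforce
qed

section \<open>The acceptance criterion on input words and its program\<close>

definition letter_at :: "nat list \<Rightarrow> nat \<Rightarrow> nat" where
  "letter_at w i = (if i < length w then w ! i else 0)"

definition occurrences :: "nat list \<Rightarrow> nat \<Rightarrow> nat \<Rightarrow> nat" where
  "occurrences w a p = card {i. i < p \<and> letter_at w i = a}"

text \<open>The codes of \<open>a\<close> and its inverse are \<open>6\<close> and \<open>7\<close>, those of \<open>t\<close> and its inverse \<open>8\<close> and \<open>9\<close>,
  and each constant is preceded by a \<open>5\<close>. The digits of \<open>m\<close> in base \<open>D\<close> are the cursor shifts of the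
  conjugators; digit \<open>0\<close> is not used, since the first constant comes after one \<open>5\<close>.\<close>

definition is_lamp :: "nat list \<Rightarrow> nat \<Rightarrow> bool" where
  "is_lamp w i \<longleftrightarrow> letter_at w i = 6 \<or> letter_at w i = 7"

definition lamps :: "nat list \<Rightarrow> nat" where
  "lamps w = card {i. i < length w \<and> is_lamp w i}"

text \<open>A lamp sits at the cursor, the number of 8s minus that of 9s, plus the shift of its
  constant. The 9s are moved to the other side of the congruence to avoid negative numbers.\<close>

definition lamps_at :: "nat list \<Rightarrow> nat \<Rightarrow> nat \<Rightarrow> nat \<Rightarrow> nat" where
  "lamps_at w D m r = card {i. i < length w \<and> is_lamp w i \<and>
     (occurrences w 8 i + m div D ^ occurrences w 5 i mod D) mod D = (occurrences w 9 i + r) mod D}"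

text \<open>At each 5 the cursor is a partial sum of the cursors of the constants; together with the
  total, divisibility of these sums by \<open>D\<close> amounts to divisibility of every cursor. The
  modulus \<open>2 * D\<close> makes \<open>D\<close> divide half of the total.\<close>

definition period :: "nat list \<Rightarrow> nat \<Rightarrow> bool" where
  "period w D \<longleftrightarrow>
     (\<forall>i<length w. letter_at w i = 5 \<longrightarrow> occurrences w 8 i mod D = occurrences w 9 i mod D) \<and>
     occurrences w 8 (length w) mod (2 * D) = occurrences w 9 (length w) mod (2 * D)"

text \<open>The range of \<open>m\<close> is the same for all \<open>D\<close>: as
  \<open>Suc D\<close> is at most twice the length, it contains all strings of digits in base
  \<open>Suc D\<close>, one for each number of 5s read so far.\<close>

definition lamps_cancel :: "nat list \<Rightarrow> bool" where
  "lamps_cancel w \<longleftrightarrow> (\<forall>D<2 * length w. period w (Suc D) \<longrightarrow>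
     (\<exists>m<(2 * length w) ^ Suc (occurrences w 5 (length w)). \<forall>r<Suc D. even (lamps_at w (Suc D) m r)))"

text \<open>Two symbols 4 after the initial 3 reveal a non-orientable equation of genus at least 2.
  There, as in the orientable case, the ideal is that of 1 + X, and the test reduces to a
  parity.\<close>

definition accepted :: "nat list \<Rightarrow> bool" where
  "accepted w \<longleftrightarrow>
     (if letter_at w 0 = 1 then
        occurrences w 8 (length w) = occurrences w 9 (length w) \<and> lamps_cancel w
      else if letter_at w 0 = 2 then
        occurrences w 8 (length w) = occurrences w 9 (length w) \<and> even (lamps w)
      else
        occurrences w 8 (length w) mod 2 = occurrences w 9 (length w) mod 2 \<and>
        (if letter_at w 1 = 4 \<and> letter_at w 2 = 4 then even (lamps w) else lamps_cancel w))"

definition occurrences_expr :: "nat \<Rightarrow> expr \<Rightarrow> expr" where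
  "occurrences_expr a p = count_expr p (symbol_expr a)"

definition is_lamp_expr :: "expr \<Rightarrow> expr" where
  "is_lamp_expr i = ifz_expr (symbol_expr 6 i) (symbol_expr 7 i) one_expr"

definition lamps_expr :: expr where
  "lamps_expr = count_expr length_expr is_lamp_expr"

definition lamps_at_expr :: "expr \<Rightarrow> expr \<Rightarrow> expr \<Rightarrow> expr" where
  "lamps_at_expr D m r = count_expr length_expr (\<lambda>i. conj_expr (is_lamp_expr i)
     (eq_expr (modulo_expr (plus_expr (occurrences_expr 8 i) (digit_expr m D (occurrences_expr 5 i))) D)
         (modulo_expr (plus_expr (occurrences_expr 9 i) r) D)))"

definition period_expr :: "expr \<Rightarrow> expr" where
  "period_expr D = conj_expr
     (all_less_expr length_expr (\<lambda>i. ifz_expr (symbol_expr 5 i) one_expr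
        (eq_expr (modulo_expr (occurrences_expr 8 i) D) (modulo_expr (occurrences_expr 9 i) D))))
     (eq_expr (modulo_expr (occurrences_expr 8 length_expr) (plus_expr D D))
         (modulo_expr (occurrences_expr 9 length_expr) (plus_expr D D)))"

definition lamps_cancel_expr :: expr where
  "lamps_cancel_expr = all_less_expr (plus_expr length_expr length_expr) (\<lambda>D. ifz_expr (period_expr (suc_expr D)) one_expr
     (exists_less_expr (power_expr (plus_expr length_expr length_expr) (suc_expr (occurrences_expr 5 length_expr)))
       (\<lambda>m. all_less_expr (suc_expr D) (\<lambda>r. even_expr (lamps_at_expr (suc_expr D) m r)))))"

definition accepted_expr :: expr where
  "accepted_expr =
     (let p = occurrences_expr 8 length_expr; q = occurrences_expr 9 length_expr in
      ifz_expr (symbol_expr 1 zero_expr)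
        (ifz_expr (symbol_expr 2 zero_expr)
          (conj_expr (eq_expr (modulo_expr p two_expr) (modulo_expr q two_expr))
            (ifz_expr (conj_expr (symbol_expr 4 one_expr) (symbol_expr 4 two_expr)) lamps_cancel_expr (even_expr lamps_expr)))
          (conj_expr (eq_expr p q) (even_expr lamps_expr)))
        (conj_expr (eq_expr p q) lamps_cancel_expr))"

lemma occurrences_le: "occurrences w a p \<le> p"
  unfolding occurrences_def using card_mono[of "{..<p}" "{i. i < p \<and> letter_at w i = a}"] by auto

lemma evaluates_symbol_letter_at:
  "evaluates w B W e p \<Longrightarrow> 1 \<le> B \<Longrightarrow> evaluates w B W (symbol_expr a e) (of_bool (letter_at w p = a))"
  unfolding letter_at_def by (rule evaluates_symbol)

lemma evaluates_occurrences:
  "evaluates w B W e p \<Longrightarrow> 1 \<le> B \<Longrightarrow> evaluates w B W (occurrences_expr a e) (occurrences w a p)"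
  unfolding occurrences_expr_def occurrences_def
  by (intro evaluates_count evaluates_symbol_letter_at)

lemma evaluates_is_lamp:
  assumes "evaluates w B W e p" "1 \<le> B"
  shows "evaluates w B W (is_lamp_expr e) (of_bool (is_lamp w p))"
  unfolding is_lamp_expr_def
  by (rule evaluates_ifz[OF evaluates_symbol_letter_at[OF assms]])
    (use assms evaluates_symbol_letter_at[OF assms, of 7] in
      \<open>auto simp: is_lamp_def evaluates_one[simplified]\<close>)

context
  fixes w :: "nat list" and B :: nat
  assumes w: "0 \<notin> set w" "w \<noteq> []"
    and B: "4 * length w \<le> B" "(2 * length w) ^ Suc (occurrences w 5 (length w)) \<le> B"
begin

lemma B_ge: "1 \<le> B" "2 \<le> B" "1 \<le> length w"
  using B(1) w(2) by (cases w; simp)+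

lemma evaluates_length: "evaluates w B W length_expr (length w)"
  using B(1) w(1) by (intro evaluates_input_length) auto

lemma evaluates_lamps: "evaluates w B W lamps_expr (lamps w)"
  unfolding lamps_expr_def lamps_def
  by (intro evaluates_count evaluates_length evaluates_is_lamp B_ge)

lemma evaluates_lamps_at:
  assumes D: "evaluates w B W D v" and m: "evaluates w B W m M" and r: "evaluates w B W r R"
    and v: "0 < v" "v \<le> 2 * length w" "R < v"
  shows "evaluates w B W (lamps_at_expr D m r) (lamps_at w v M R)"
  unfolding lamps_at_expr_def lamps_at_def
proof (intro evaluates_count evaluates_length evaluates_conj evaluates_eq evaluates_modulo
    evaluates_plus evaluates_digit evaluates_occurrences evaluates_is_lamp B_ge)
  fix i W' y
  assume i: "i < length w" "extends B W W'" "evaluates w B W' y i"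
  show "evaluates w B W' y i" "evaluates w B W' y i" "evaluates w B W' y i" "evaluates w B W' y i"
    by (rule i)+
  show "evaluates w B W' D v" "evaluates w B W' D v" "evaluates w B W' D v"
    by (rule evaluates_mono[OF D i(2)])+
  show "evaluates w B W' m M" by (rule evaluates_mono[OF m i(2)])
  show "evaluates w B W' r R" by (rule evaluates_mono[OF r i(2)])
  show "occurrences w 9 i + R \<le> B"
    using occurrences_le[of w 9 i] i(1) v B(1) by linarith
  have "M div v ^ occurrences w 5 i mod v < v" using v(1) by simp
  then show "occurrences w 8 i + M div v ^ occurrences w 5 i mod v \<le> B"
    using occurrences_le[of w 8 i] i(1) v B(1) by linarith
qed

lemma evaluates_period:
  assumes D: "evaluates w B W D v" and v: "v \<le> 2 * length w"
  shows "evaluates w B W (period_expr D) (of_bool (period w v))"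
  unfolding period_expr_def period_def
proof (intro evaluates_conj evaluates_all_less evaluates_length B_ge)
  fix i W' y
  assume i: "i < length w" "extends B W W'" "evaluates w B W' y i"
  have "evaluates w B W' (eq_expr (modulo_expr (occurrences_expr 8 y) D) (modulo_expr (occurrences_expr 9 y) D))
      (of_bool (occurrences w 8 i mod v = occurrences w 9 i mod v))"
    by (intro evaluates_eq evaluates_modulo evaluates_occurrences evaluates_mono[OF D i(2)] i(3) B_ge)
  then show "evaluates w B W' (ifz_expr (symbol_expr 5 y) one_expr
      (eq_expr (modulo_expr (occurrences_expr 8 y) D) (modulo_expr (occurrences_expr 9 y) D)))
     (of_bool (letter_at w i = 5 \<longrightarrow> occurrences w 8 i mod v = occurrences w 9 i mod v))"
    by (intro evaluates_ifz[OF evaluates_symbol_letter_at[OF i(3) B_ge(1)]])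
      (auto simp: evaluates_one[OF B_ge(1), simplified])
next
  show "evaluates w B W (eq_expr (modulo_expr (occurrences_expr 8 length_expr) (plus_expr D D))
         (modulo_expr (occurrences_expr 9 length_expr) (plus_expr D D)))
     (of_bool (occurrences w 8 (length w) mod (2 * v) = occurrences w 9 (length w) mod (2 * v)))"
    \<comment> \<open>The sum \<open>v + v\<close> with \<open>v \<le> 2 * length w\<close> is what
      requires room for \<open>4 * length w\<close>.\<close>
    unfolding mult_2 using v B(1)
    by (intro evaluates_eq evaluates_modulo evaluates_occurrences evaluates_length evaluates_plus D B_ge) auto
qed

lemma evaluates_lamps_cancel: "evaluates w B W lamps_cancel_expr (of_bool (lamps_cancel w))"
  unfolding lamps_cancel_expr_def lamps_cancel_def
proof (intro evaluates_all_less B_ge)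
  have twice: "evaluates w B W (plus_expr length_expr length_expr) (2 * length w)" for W
    unfolding mult_2 using B(1) by (intro evaluates_plus evaluates_length) auto
  then show "evaluates w B W (plus_expr length_expr length_expr) (2 * length w)" .
  fix D W' y
  assume D: "D < 2 * length w" "extends B W W'" "evaluates w B W' y D"
  have sucD: "evaluates w B W' (suc_expr y) (Suc D)"
    using D B(1) by (intro evaluates_suc) auto
  have "evaluates w B W' (power_expr (plus_expr length_expr length_expr) (suc_expr (occurrences_expr 5 length_expr)))
      ((2 * length w) ^ Suc (occurrences w 5 (length w)))"
  proof (intro evaluates_power twice evaluates_suc evaluates_occurrences evaluates_length B_ge B(2))
    show "Suc (occurrences w 5 (length w)) \<le> B"
      using occurrences_le[of w 5 "length w"] B(1) B_ge(3) by linarith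
  qed (use B_ge(3) in simp)
  then have "evaluates w B W' (exists_less_expr (power_expr (plus_expr length_expr length_expr) (suc_expr (occurrences_expr 5 length_expr)))
       (\<lambda>m. all_less_expr (suc_expr y) (\<lambda>r. even_expr (lamps_at_expr (suc_expr y) m r))))
     (of_bool (\<exists>m<(2 * length w) ^ Suc (occurrences w 5 (length w)). \<forall>r<Suc D. even (lamps_at w (Suc D) m r)))"
    using D(1)
    by (intro evaluates_exists_less evaluates_all_less evaluates_evenp evaluates_lamps_at B_ge)
      (auto intro: evaluates_mono[OF sucD] evaluates_mono extends_trans)
  then show "evaluates w B W' (ifz_expr (period_expr (suc_expr y)) one_expr
     (exists_less_expr (power_expr (plus_expr length_expr length_expr) (suc_expr (occurrences_expr 5 length_expr)))
       (\<lambda>m. all_less_expr (suc_expr y) (\<lambda>r. even_expr (lamps_at_expr (suc_expr y) m r)))))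
     (of_bool (period w (Suc D) \<longrightarrow>
       (\<exists>m<(2 * length w) ^ Suc (occurrences w 5 (length w)). \<forall>r<Suc D. even (lamps_at w (Suc D) m r))))"
    using D(1)
    by (intro evaluates_ifz[OF evaluates_period[OF sucD]])
      (auto simp: evaluates_one[OF B_ge(1), simplified])
qed

lemma evaluates_accepted: "evaluates w B W accepted_expr (of_bool (accepted w))"
  unfolding accepted_expr_def accepted_def Let_def
  by (intro evaluates_ifz_bool evaluates_conj evaluates_eq evaluates_modulo evaluates_occurrences
      evaluates_length evaluates_evenp evaluates_lamps evaluates_lamps_cancel evaluates_two
      evaluates_one evaluates_symbol_letter_at evaluates_zero B_ge)

end

text \<open>Depth 1 is the least depth that spares register 0, the head on the input, and it puts
  the verdict into register 1, where the machine looks for it.\<close>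

definition decider :: com where
  "decider = accepted_expr 1"

lemma decider_runs:
  assumes "0 \<notin> set w" "w \<noteq> []" "4 * length w \<le> B"
    "(2 * length w) ^ Suc (occurrences w 5 (length w)) \<le> B"
  shows "runs w B decider (\<lambda>_. 0) ((\<lambda>_. 0)(1 := of_bool (accepted w)))"
  unfolding decider_def
  by (rule evaluatesD[OF evaluates_accepted[OF assms], of "(1, \<lambda>_. 0)"])
    (auto simp: extends_def valid_state_def bounded_def)

section \<open>Running time\<close>

text \<open>On input \<open>1\<^sup>k\<close> the machine first writes \<open>r * (k + 1)\<close> ones on its second tape and then
  appends them to the input.\<close>

definition affine_machine :: "nat \<Rightarrow> tm" where
  "affine_machine r = \<lparr>ntapes = 2, nsymbols = 2, nstates = r + 4, start = 0, accept = r + 2,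
     reject = r + 3,
     delta = (\<lambda>q ss.
       if q < r then (q + 1, [(ss ! 0, Stay), (1, Move_Right)])
       else if q = r then
         (if ss ! 0 = 1 then (0, [(1, Move_Right), (ss ! 1, Stay)])
          else (r + 1, [(ss ! 0, Stay), (ss ! 1, Move_Left)]))
       else if ss ! 1 = 1 then (r + 1, [(1, Move_Right), (1, Move_Left)])
       else (r + 2, [(ss ! 0, Stay), (ss ! 1, Stay)]))\<rparr>"

lemma affine_machine_wf: "tm_wf (affine_machine r)"
  unfolding tm_wf_def
proof (intro conjI allI impI)
  fix q ss
  assume "q < nstates (affine_machine r)"
    and ss: "length ss = ntapes (affine_machine r) \<and> set ss \<subseteq> {..<nsymbols (affine_machine r)}"
  from ss obtain a b where "ss = [a, b]" "a < 2" "b < 2"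
    by (auto simp: affine_machine_def numeral_2_eq_2 length_Suc_conv)
  then show "case delta (affine_machine r) q ss of (q', acts) \<Rightarrow>
      q' < nstates (affine_machine r) \<and> length acts = ntapes (affine_machine r) \<and>
      fst ` set acts \<subseteq> {..<nsymbols (affine_machine r)}"
    by (auto simp: affine_machine_def)
qed (auto simp: affine_machine_def)

definition ones :: "nat \<Rightarrow> int \<Rightarrow> nat" where
  "ones k = word_tape (replicate k 1)"

lemma ones_at: "ones k p = (if 0 \<le> p \<and> p < int k then 1 else 0)"
  by (auto simp: ones_def word_tape_def)

lemma ones_extend: "(ones k)(int k := 1) = ones (Suc k)"
  by (auto simp: ones_at fun_eq_iff)

lemma ones_same: "ones k p = a \<Longrightarrow> (ones k)(p := a) = ones k"
  by auto

definition reaches :: "tm \<Rightarrow> config \<Rightarrow> config \<Rightarrow> bool" where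
  "reaches M x y \<longleftrightarrow> (\<exists>n. (tm_step M ^^ n) x = y)"

lemma reaches_refl: "reaches M x x"
  unfolding reaches_def by (rule exI[of _ 0]) simp

lemma reaches_trans: "reaches M x y \<Longrightarrow> reaches M y z \<Longrightarrow> reaches M x z"
  unfolding reaches_def by (metis funpow_add o_apply)

lemma reaches_step: "tm_step M x = y \<Longrightarrow> reaches M x y"
  unfolding reaches_def by (rule exI[of _ 1]) simp

lemma affine_machine_emit:
  "i \<le> r \<Longrightarrow> reaches (affine_machine r) (0, [(ones k, p), (ones e, int e)])
     (i, [(ones k, p), (ones (e + i), int (e + i))])"
proof (induction i)
  case (Suc i)
  have "tm_step (affine_machine r) (i, [(ones k, p), (ones (e + i), int (e + i))])
      = (Suc i, [(ones k, p), (ones (e + Suc i), int (e + Suc i))])"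
    using Suc.prems ones_extend[of "e + i"] by (simp add: affine_machine_def scanned_def)
  then show ?case
    using reaches_trans[OF Suc.IH reaches_step] Suc.prems by simp
qed (simp add: reaches_refl)

lemma affine_machine_scan:
  "j \<le> k \<Longrightarrow> reaches (affine_machine r) (0, [(ones k, 0), (ones 0, 0)])
     (r, [(ones k, int j), (ones (r * Suc j), int (r * Suc j))])"
proof (induction j)
  case 0
  then show ?case using affine_machine_emit[of r r k 0 0] by simp
next
  case (Suc j)
  have "tm_step (affine_machine r) (r, [(ones k, int j), (ones (r * Suc j), int (r * Suc j))])
      = (0, [(ones k, int (Suc j)), (ones (r * Suc j), int (r * Suc j))])"
    using Suc.prems by (simp add: affine_machine_def scanned_def ones_same ones_at del: mult_Suc_right of_nat_mult)
  then have "reaches (affine_machine r) (r, [(ones k, int j), (ones (r * Suc j), int (r * Suc j))])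
      (r, [(ones k, int (Suc j)), (ones (r * Suc j + r), int (r * Suc j + r))])"
    using reaches_trans[OF reaches_step affine_machine_emit[of r r k "int (Suc j)" "r * Suc j"]] by simp
  moreover have "r * Suc j + r = r * Suc (Suc j)" by simp
  ultimately show ?case
    using reaches_trans[OF Suc.IH] Suc.prems by (simp only: Suc_leD)
qed

lemma affine_machine_append:
  "x \<le> e \<Longrightarrow> reaches (affine_machine r) (r + 1, [(ones k, int k), (ones e, int e - 1)])
     (r + 1, [(ones (k + x), int (k + x)), (ones e, int e - 1 - int x)])"
proof (induction x)
  case (Suc x)
  have "tm_step (affine_machine r) (r + 1, [(ones (k + x), int (k + x)), (ones e, int e - 1 - int x)])
      = (r + 1, [(ones (k + Suc x), int (k + Suc x)), (ones e, int e - 1 - int (Suc x))])"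
    using Suc.prems ones_extend[of "k + x"]
    by (simp add: affine_machine_def scanned_def ones_same ones_at)
  then show ?case
    using reaches_trans[OF Suc.IH reaches_step] Suc.prems by simp
qed (simp add: reaches_refl)

text \<open>The exponent of the time bound has to be computable in the sense of the machine model.
  The summand \<open>k\<close> is the unary input itself, which remains on the first tape.\<close>

lemma computable_affine: "computable (\<lambda>k. k + r * Suc k)"
  unfolding computable_def
proof (intro exI[of _ "affine_machine r"] conjI allI affine_machine_wf)
  fix k
  let ?M = "affine_machine r" and ?e = "r * Suc k"
  let ?end = "[(ones (k + ?e), int (k + ?e)), (ones ?e, int ?e - 1 - int ?e)]"
  have init: "tm_init ?M (replicate k 1) = (0, [(ones k, 0), (ones 0, 0)])"
    by (simp add: tm_init_def affine_machine_def ones_def)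
  have turn: "tm_step ?M (r, [(ones k, int k), (ones e, int e)])
      = (r + 1, [(ones k, int k), (ones e, int e - 1)])" for e
    by (simp add: affine_machine_def scanned_def ones_same ones_at)
  have stop: "tm_step ?M (r + 1, [(ones x, int x), (ones e, int e - 1 - int e)])
      = (r + 2, [(ones x, int x), (ones e, int e - 1 - int e)])" for x e
    by (simp add: affine_machine_def scanned_def ones_same ones_at)
  have "reaches ?M (tm_init ?M (replicate k 1)) (r + 2, ?end)"
    unfolding init
    by (rule reaches_trans[OF affine_machine_scan[OF order_refl] reaches_trans[OF
      reaches_step[OF turn] reaches_trans[OF affine_machine_append[OF order_refl] reaches_step[OF stop]]]])
  then show "\<exists>n. fst (tm_run ?M (replicate k 1) n) = accept ?M \<and>
      fst (hd (snd (tm_run ?M (replicate k 1) n))) = word_tape (replicate (k + ?e) 1)"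
    unfolding reaches_def tm_run_def
  proof (elim exE, intro exI conjI)
    fix n assume "(tm_step ?M ^^ n) (tm_init ?M (replicate k 1)) = (r + 2, ?end)"
    then show "fst ((tm_step ?M ^^ n) (tm_init ?M (replicate k 1))) = accept ?M"
      "fst (hd (snd ((tm_step ?M ^^ n) (tm_init ?M (replicate k 1))))) = word_tape (replicate (k + ?e) 1)"
      by (simp_all add: ones_def affine_machine_def del: mult_Suc_right)
  qed
qed (simp add: affine_machine_def)


section \<open>The time bound in terms of the size of the equation\<close>

lemma occurrences_eq_count: "a \<noteq> 0 \<Longrightarrow> p \<le> length w \<Longrightarrow> occurrences w a p = count_list (take p w) a"
proof (induction p)
  case (Suc p)
  have "{i. i < Suc p \<and> letter_at w i = a}
      = {i. i < p \<and> letter_at w i = a} \<union> (if letter_at w p = a then {p} else {})"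
    by (auto simp: less_Suc_eq)
  then have "occurrences w a (Suc p) = occurrences w a p + of_bool (w ! p = a)"
    using Suc.prems by (simp add: occurrences_def letter_at_def)
  then show ?case
    using Suc by (simp add: take_Suc_conv_app_nth)
qed (simp add: occurrences_def)

lemma count_5_constants_code: "count_list (constants_code cs) 5 = length cs"
proof -
  have "5 \<notin> set (map letter_code c)" for c
  proof
    assume "5 \<in> set (map letter_code c)"
    then obtain l where "letter_code l = 5" by auto
    then show False using letter_code_bounds[of l] by simp
  qed
  then show ?thesis
    by (induction cs) (auto simp: constants_code_def count_notin)
qed

lemma count_5_equation_code: "count_list (equation_code E) 5 = num_constants E"
  by (cases E) (auto simp: num_constants_def count_5_constants_code count_notin)

lemma set_equation_code: "set (equation_code E) \<subseteq> {0<..<10}"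
proof -
  have "letter_code l \<in> {0<..<10}" for l
    using letter_code_bounds[of l] by auto
  then have "set (constants_code cs) \<subseteq> {0<..<10}" for cs
    by (induction cs) (auto simp: constants_code_def)
  then show ?thesis by (cases E) auto
qed

lemma decidable_in_XP:
  assumes correct: "\<And>E. standard_form E \<Longrightarrow> solvable_L2 E \<longleftrightarrow> accepted (equation_code E)"
  shows "\<exists>M r C. decides_in_time M equation_code {E. standard_form E} solvable_L2
    (\<lambda>E. C * equation_size E ^ (num_constants E + r * Suc (num_constants E)))"
proof -
  obtain m0 where "regs_below m0 decider" using ex_regs_below by blast
  then have m: "regs_below (m0 + 2) decider" by (rule regs_below_mono) simp
  define m where "m = m0 + 2"
  let ?Q = "card (residuals decider)"
  have "\<exists>n\<le>(?Q + 2) * equation_size E ^ (num_constants E + (4 * m) * Suc (num_constants E)).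
      fst (tm_run (machine m decider) (equation_code E) n) = (if solvable_L2 E then 1 else 2)"
    (is "\<exists>n\<le>?T E. _") if E: "standard_form E" for E
  proof -
    let ?w = "equation_code E" and ?s = "equation_size E" and ?k = "num_constants E"
    let ?n = "length ?w"
    \<comment> \<open>The base \<open>4 * ?n\<close> makes one power dominate both requirements on
      \<open>B\<close>, namely \<open>4 * ?n\<close> and \<open>(2 * ?n) ^ Suc ?k\<close>.\<close>
    define B where "B = (4 * ?n) ^ Suc ?k"
    have s: "2 \<le> ?s" using E by (rule equation_size_ge_2)
    have n: "1 \<le> ?n" by (cases E) auto
    have k: "occurrences ?w 5 ?n = ?k"
      by (simp add: occurrences_eq_count count_5_equation_code)
    have "(4 * ?n) ^ 1 \<le> B" unfolding B_def using n by (intro power_increasing) auto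
    moreover have "(2 * ?n) ^ Suc ?k \<le> B" unfolding B_def by (intro power_mono) auto
    moreover have "0 \<notin> set ?w" using set_equation_code[of E] by auto
    ultimately have "runs ?w B decider (\<lambda>_. 0) ((\<lambda>_. 0)(1 := of_bool (accepted ?w)))"
      using n by (intro decider_runs) (auto simp: k)
    from machine_decides[OF this, of m] obtain t where t: "t \<le> 2 + ?Q * (B + 1) ^ m"
      "fst (tm_run (machine m decider) ?w t) = (if accepted ?w then 1 else 2)"
      using m by (auto simp: m_def split: if_splits)
    have "1 \<le> B" unfolding B_def using n by simp
    then have "B + 1 \<le> 2 ^ 1 * B" by simp
    also have "\<dots> \<le> 2 ^ Suc ?k * B" by (intro mult_right_mono power_increasing) auto
    also have "\<dots> = (8 * ?n) ^ Suc ?k" unfolding B_def power_mult_distrib[symmetric] by simp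
    \<comment> \<open>Since the size is at least 2, the constant 8 is absorbed by a cube of it, and
      the length of the input by one more factor.\<close>
    also have "\<dots> \<le> (?s ^ 4) ^ Suc ?k"
    proof (intro power_mono)
      have "2 ^ 3 * ?n \<le> ?s ^ 3 * ?s"
        using s length_equation_code_le[OF E] by (intro mult_le_mono power_mono) auto
      then show "8 * ?n \<le> ?s ^ 4" by (simp add: eval_nat_numeral ac_simps)
    qed simp
    finally have "(B + 1) ^ m \<le> ((?s ^ 4) ^ Suc ?k) ^ m" by (intro power_mono) auto
    also have "\<dots> = ?s ^ ((4 * m) * Suc ?k)" by (simp only: power_mult[symmetric] ac_simps)
    \<comment> \<open>The exponent is raised by \<open>?k\<close> only to give it the form computed
      by the affine machine.\<close>
    also have "\<dots> \<le> ?s ^ (?k + (4 * m) * Suc ?k)" using s by (intro power_increasing) auto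
    finally have "?Q * (B + 1) ^ m \<le> ?Q * ?s ^ (?k + (4 * m) * Suc ?k)" by simp
    moreover have "1 \<le> ?s ^ (?k + (4 * m) * Suc ?k)" using s by simp
    ultimately have "t \<le> (?Q + 2) * ?s ^ (?k + (4 * m) * Suc ?k)"
      using t(1) unfolding distrib_right by linarith
    then show ?thesis using t(2) correct[OF E] by auto
  qed
  note run = this
  have "decides_in_time (machine m decider) equation_code {E. standard_form E} solvable_L2
    (\<lambda>E. (?Q + 2) * equation_size E ^ (num_constants E + (4 * m) * Suc (num_constants E)))"
    unfolding decides_in_time_def
  proof (intro conjI ballI)
    show "tm_wf (machine m decider)" by (rule machine_wf) (simp add: m_def)
  next
    fix E assume "E \<in> {E. standard_form E}"
    then show "\<exists>n\<le>?T E. fst (tm_run (machine m decider) (equation_code E) n) =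
        (if solvable_L2 E then accept (machine m decider) else reject (machine m decider))"
      using run[of E] by (simp only: machine_simps mem_Collect_eq)
  qed (simp only: machine_simps set_equation_code)
  then show ?thesis by blast
qed

section \<open>Solvability in the lamplighter group\<close>

type_synonym lamp_config = "int \<Rightarrow>\<^sub>0 bit"

lemma config_add_self [simp]: "f + f = (0 :: lamp_config)"
proof (rule poly_mapping_eqI)
  have "b + b = 0" for b :: bit by (cases b) simp_all
  then show "Poly_Mapping.lookup (f + f) k = Poly_Mapping.lookup 0 k" for k by (simp only: lookup_add lookup_zero)
qed

lemma config_add_self_left [simp]: "f + (f + g) = (g :: lamp_config)"
  by (simp add: add.assoc[symmetric])

lemma config_eq_iff: "f = g \<longleftrightarrow> f + g = (0 :: lamp_config)"
  by (metis add.right_neutral config_add_self config_add_self_left)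

text \<open>Under the identification of configurations with Laurent polynomials over the field with two
  elements, this is the principal ideal generated by \<open>1 + X\<^sup>d\<close>.\<close>

definition ideal_of :: "int \<Rightarrow> lamp_config set" where
  "ideal_of d = range (\<lambda>h. h + shift d h)"

lemma ideal_ofI: "u = h + shift d h \<Longrightarrow> u \<in> ideal_of d"
  by (auto simp: ideal_of_def)

lemma ideal_ofE:
  assumes "u \<in> ideal_of d"
  obtains h where "u = h + shift d h"
  using assms by (auto simp: ideal_of_def)

lemma ideal_of_0 [simp]: "ideal_of 0 = {0}"
  by (auto simp: ideal_of_def shift_0)

lemma zero_in_ideal [simp]: "0 \<in> ideal_of d"
  by (rule ideal_ofI[of _ 0]) (simp add: shift_zero)

lemma ideal_of_add: "u \<in> ideal_of d \<Longrightarrow> v \<in> ideal_of d \<Longrightarrow> u + v \<in> ideal_of d"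
  by (elim ideal_ofE) (auto intro!: ideal_ofI[of _ "_ + _"] simp: shift_add ac_simps)

lemma ideal_of_add_iff: "u + v \<in> ideal_of d \<Longrightarrow> u \<in> ideal_of d \<longleftrightarrow> v \<in> ideal_of d"
  by (metis add.commute config_add_self_left ideal_of_add)

lemma ideal_of_shift: "u \<in> ideal_of d \<Longrightarrow> shift b u \<in> ideal_of d"
  by (elim ideal_ofE) (auto intro!: ideal_ofI[of _ "shift b _"] simp: shift_add shift_shift ac_simps)

lemma ideal_of_shift_iff: "shift b u \<in> ideal_of d \<longleftrightarrow> u \<in> ideal_of d"
  using ideal_of_shift[of "shift b u" d "- b"] ideal_of_shift[of u d b]
  by (auto simp: shift_shift shift_0)

text \<open>Telescoping: 1 + X^(nd) is the sum of the terms X^(id) (1 + X^d) for i < n.\<close>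

lemma ideal_of_mult_nat: "h + shift (int n * d) h \<in> ideal_of d"
proof (induction n)
  case (Suc n)
  have eq: "h + shift (int (Suc n) * d) h
      = (h + shift (int n * d) h) + (shift (int n * d) h + shift d (shift (int n * d) h))"
    by (simp add: shift_shift algebra_simps)
  show ?case
    unfolding eq by (rule ideal_of_add[OF Suc ideal_ofI[OF refl]])
qed (simp add: shift_0)

lemma ideal_of_mult: "h + shift (c * d) h \<in> ideal_of d"
proof (cases "c \<ge> 0")
  case True
  then show ?thesis using ideal_of_mult_nat[of h "nat c" d] by simp
next
  case False
  define k where "k = shift (c * d) h"
  have "int (nat (- c)) = - c" using False by simp
  then have "shift (int (nat (- c)) * d) k = h"
    by (simp only: k_def shift_shift) (simp add: shift_0)
  then have "h + shift (c * d) h = k + shift (int (nat (- c)) * d) k"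
    by (simp only: k_def add.commute)
  then show ?thesis using ideal_of_mult_nat[of k "nat (- c)" d] by (simp only:)
qed

lemma shift_diff_in_ideal:
  assumes "d dvd a - b"
  shows "shift a h + shift b h \<in> ideal_of d"
proof -
  from assms obtain c where "a - b = d * c" by (rule dvdE)
  then have "a = c * d + b" by (simp add: algebra_simps)
  then have "shift a h = shift (c * d) (shift b h)" by (simp add: shift_shift)
  then show ?thesis using ideal_of_mult[of "shift b h" c d] by (simp add: add.commute)
qed

lemma ideal_of_mono: "d dvd e \<Longrightarrow> ideal_of e \<subseteq> ideal_of d"
  using ideal_of_mult by (force simp: ideal_of_def dvd_def mult.commute)

text \<open>The ideals of 1 + X^a and 1 + X^b have as their sum the ideal of 1 + X^gcd(a, b). In
  characteristic 2, \<open>u + v\<close> is the difference as well, so the right-hand side says that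
  \<open>u\<close> lies in this sum.\<close>

lemma ideal_of_gcd: "u \<in> ideal_of (gcd a b) \<longleftrightarrow> (\<exists>v \<in> ideal_of a. u + v \<in> ideal_of b)"
proof
  assume "u \<in> ideal_of (gcd a b)"
  then obtain h where h: "u = h + shift (gcd a b) h" by (rule ideal_ofE)
  \<comment> \<open>The Bezout coefficients split \<open>u\<close> into (1 + X^(xa)) h and (1 +
    X^(yb)) X^(xa) h.\<close>
  obtain x y where "x * a + y * b = gcd a b" using bezout_int by blast
  then have "u + (h + shift (x * a) h) = shift (x * a) h + shift (y * b) (shift (x * a) h)"
    by (simp add: h shift_shift ac_simps)
  then show "\<exists>v \<in> ideal_of a. u + v \<in> ideal_of b"
    using ideal_of_mult by metis
next
  assume "\<exists>v \<in> ideal_of a. u + v \<in> ideal_of b"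
  then obtain v where v: "v \<in> ideal_of a" "u + v \<in> ideal_of b" by blast
  then have "v \<in> ideal_of (gcd a b)" "u + v \<in> ideal_of (gcd a b)"
    using ideal_of_mono[of "gcd a b"] by auto
  then show "u \<in> ideal_of (gcd a b)" using ideal_of_add_iff by blast
qed

section \<open>Values of words\<close>

lemma L2_mult: "(d1, f1) \<otimes>\<^bsub>L2\<^esub> (d2, f2) = (d1 + d2, shift d2 f1 + f2)"
  by (simp add: L2_def)

lemma L2_one: "\<one>\<^bsub>L2\<^esub> = (0, 0)"
  by (simp add: L2_def)

lemma L2_carrier [simp]: "x \<in> carrier L2"
  by (simp add: L2_def)

lemma L2_inv: "inv\<^bsub>L2\<^esub> (d, f) = (- d, shift (- d) f)"
  by (rule group.inv_equality[OF group_L2]) (simp_all add: L2_mult L2_one shift_shift shift_0)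

lemma L2_assoc: "(x \<otimes>\<^bsub>L2\<^esub> y) \<otimes>\<^bsub>L2\<^esub> z = x \<otimes>\<^bsub>L2\<^esub> (y \<otimes>\<^bsub>L2\<^esub> z)"
  by (rule monoid.m_assoc[OF group.is_monoid[OF group_L2]]) simp_all

lemma word_val_Nil: "word_val \<sigma> [] = (0, 0)"
  by (simp add: word_val_def L2_one)

lemma word_val_Cons: "word_val \<sigma> (l # w) = letter_val \<sigma> l \<otimes>\<^bsub>L2\<^esub> word_val \<sigma> w"
  by (simp add: word_val_def)

lemma word_val_append: "word_val \<sigma> (v @ w) = word_val \<sigma> v \<otimes>\<^bsub>L2\<^esub> word_val \<sigma> w"
proof (induction v)
  case Nil
  show ?case by (cases "word_val \<sigma> w") (simp add: word_val_Nil L2_mult shift_zero)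
qed (simp add: word_val_Cons L2_assoc)

lemma word_val_cong:
  "(\<And>v e. (Var v, e) \<in> set w \<Longrightarrow> \<sigma> v = \<tau> v) \<Longrightarrow> word_val \<sigma> w = word_val \<tau> w"
proof (induction w)
  case (Cons l w)
  obtain s e where l: "l = (s, e)" by (cases l)
  have "atom_val \<sigma> s = atom_val \<tau> s" using Cons.prems l by (cases s) auto
  moreover have "word_val \<sigma> w = word_val \<tau> w"
    using Cons.prems by (intro Cons.IH) (meson list.set_intros(2))
  ultimately show ?case using l by (simp add: word_val_Cons)
qed (simp add: word_val_Nil)

fun cursor :: "gen word \<Rightarrow> int" where
  "cursor [] = 0"
| "cursor ((Gen_a, e) # c) = cursor c"
| "cursor ((Gen_t, e) # c) = (if e then -1 else 1) + cursor c"

fun lamp_positions :: "gen word \<Rightarrow> int list" where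
  "lamp_positions [] = []"
| "lamp_positions ((Gen_a, e) # c) = 0 # lamp_positions c"
| "lamp_positions ((Gen_t, e) # c) = map (\<lambda>p. (if e then -1 else 1) + p) (lamp_positions c)"

definition config_of :: "int list \<Rightarrow> lamp_config" where
  "config_of ps = (\<Sum>p\<leftarrow>ps. Poly_Mapping.single p 1)"

lemma config_of_simps [simp]:
  "config_of [] = 0"
  "config_of (p # ps) = Poly_Mapping.single p 1 + config_of ps"
  "config_of (ps @ qs) = config_of ps + config_of qs"
  by (simp_all add: config_of_def)

lemma shift_single: "shift b (Poly_Mapping.single p 1) = Poly_Mapping.single (p - b) 1"
  by (rule poly_mapping_eqI) (auto simp: lookup_shift lookup_single when_def)

lemma shift_config_of: "shift b (config_of ps) = config_of (map (\<lambda>p. p - b) ps)"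
  by (induction ps) (simp_all add: shift_zero shift_add shift_single)

text \<open>\<open>lamp_positions\<close> is measured from the initial position of the cursor,
  whereas the product of the group measures configurations from the final one; hence the shift by
  \<open>cursor c\<close>.\<close>

definition word_config :: "gen word \<Rightarrow> lamp_config" where
  "word_config c = shift (cursor c) (config_of (lamp_positions c))"

lemma word_val_gen_word: "word_val \<sigma> (map (\<lambda>(s, e). (Gen s, e)) c) = (cursor c, word_config c)"
proof (induction c rule: cursor.induct)
  case (2 e c)
  have "letter_val \<sigma> (Gen Gen_a, e) = (0, Poly_Mapping.single 0 1)"
    by (simp add: L2_inv shift_0)
  then show ?case
    using 2 by (simp add: word_val_Cons L2_mult word_config_def shift_add del: letter_val.simps)
next
  case (3 e c)
  have "letter_val \<sigma> (Gen Gen_t, e) = (if e then -1 else 1, 0)"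
    by (simp add: L2_inv shift_zero)
  moreover have "shift (cursor ((Gen_t, e) # c)) (config_of (lamp_positions ((Gen_t, e) # c)))
      = word_config c"
    by (simp add: word_config_def shift_config_of o_def algebra_simps)
  ultimately show ?case
    using 3 by (simp add: word_val_Cons L2_mult word_config_def shift_zero del: letter_val.simps)
qed (simp add: word_val_Nil word_config_def shift_zero)

section \<open>Values of products of conjugates\<close>

fun translate_sums :: "gen word list \<Rightarrow> lamp_config set" where
  "translate_sums [] = {0}"
| "translate_sums (c # cs) = {shift z (word_config c) + u | z u. u \<in> translate_sums cs}"

lemma translate_sums_snoc:
  "translate_sums (cs @ [c]) = {u + shift z (word_config c) | z u. u \<in> translate_sums cs}"
proof (induction cs)
  case (Cons b cs)
  have "v \<in> translate_sums ((b # cs) @ [c]) \<longleftrightarrow>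
      (\<exists>z y u. u \<in> translate_sums cs \<and> v = shift z (word_config b) + (u + shift y (word_config c)))" for v
    unfolding append_Cons translate_sums.simps(2) Cons by blast
  moreover have "v \<in> {u + shift z (word_config c) | z u. u \<in> translate_sums (b # cs)} \<longleftrightarrow>
      (\<exists>z y u. u \<in> translate_sums cs \<and> v = (shift z (word_config b) + u) + shift y (word_config c))" for v
    unfolding translate_sums.simps(2) by blast
  ultimately show ?case by (simp only: set_eq_iff add.assoc simp_thms)
qed auto

text \<open>In a product, each factor is shifted by the cursors of the factors to its right. As the
  translations are arbitrary anyway, this shift can be absorbed.\<close>

lemma translate_sums_shift: "u \<in> translate_sums cs \<Longrightarrow> shift b u \<in> translate_sums cs"
proof (induction cs arbitrary: u)
  case (Cons c cs)
  then obtain z v where "u = shift z (word_config c) + v" "v \<in> translate_sums cs" by auto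
  then have "shift b u = shift (b + z) (word_config c) + shift b v" "shift b v \<in> translate_sums cs"
    using Cons.IH by (auto simp: shift_add shift_shift)
  then show ?case by auto
qed (simp add: shift_zero)

definition common_period :: "gen word list \<Rightarrow> int" where
  "common_period cs = Gcd (cursor ` set cs)"

lemma common_period_snoc: "common_period (cs @ [c]) = gcd (common_period cs) (cursor c)"
  by (simp add: common_period_def gcd.commute)

definition total_cursor :: "gen word list \<Rightarrow> int" where
  "total_cursor cs = sum_list (map cursor cs)"

lemma conjugates_word_snoc:
  "conjugates_word (cs @ [c]) = conjugates_word cs @
     [(Var (Z (length cs)), True)] @ map (\<lambda>(s, e). (Gen s, e)) c @ [(Var (Z (length cs)), False)]"
proof -
  define F where "F = (\<lambda>ds j. [(Var (Z j), True)] @ map (\<lambda>(s, e). (Gen s, e)) (ds ! j) @ [(Var (Z j), False)])"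
  have "concat (map (F (cs @ [c])) [0..<length cs]) = concat (map (F cs) [0..<length cs])"
    by (intro arg_cong[where f = concat] map_cong) (simp_all add: F_def nth_append)
  moreover have "conjugates_word ds = concat (map (F ds) [0..<length ds])" for ds
    by (simp add: conjugates_word_def F_def)
  ultimately have "conjugates_word (cs @ [c]) = conjugates_word cs @ F (cs @ [c]) (length cs)" by simp
  then show ?thesis by (simp add: F_def)
qed

lemma Var_conjugates_word: "(Var v, e) \<in> set (conjugates_word cs) \<Longrightarrow> \<exists>j<length cs. v = Z j"
  by (auto simp: conjugates_word_def)

lemma word_val_conjugate:
  assumes "\<sigma> (Z j) = (z, h)"
  shows "word_val \<sigma> ([(Var (Z j), True)] @ map (\<lambda>(s, e). (Gen s, e)) c @ [(Var (Z j), False)])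
    = (cursor c, shift z (word_config c) + (h + shift (cursor c) h))"
  using assms
  by (simp add: word_val_append word_val_Cons word_val_Nil word_val_gen_word L2_mult L2_inv
      shift_add shift_shift shift_zero shift_0 ac_simps)

text \<open>A conjugate contributes a translate of its configuration and an arbitrary element of the
  ideal of its cursor. Later factors only shift this, which changes neither the set of translates
  nor the ideal, and the ideals of all cursors add up to that of their gcd. For no constants, the
  gcd is 0 and so is the ideal.\<close>

lemma conjugates_word_values:
  "(\<exists>\<sigma>. word_val \<sigma> (conjugates_word cs) = (d, F)) \<longleftrightarrow>
    d = total_cursor cs \<and> (\<exists>u \<in> translate_sums cs. F + u \<in> ideal_of (common_period cs))"
proof (induction cs arbitrary: d F rule: rev_induct)
  case Nil
  show ?case
    by (auto simp: conjugates_word_def word_val_Nil total_cursor_def common_period_def)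
next
  case (snoc c cs)
  let ?k = "length cs"
  show ?case
  proof
    assume "\<exists>\<sigma>. word_val \<sigma> (conjugates_word (cs @ [c])) = (d, F)"
    then obtain \<sigma> where \<sigma>: "word_val \<sigma> (conjugates_word (cs @ [c])) = (d, F)" ..
    obtain z h where z: "\<sigma> (Z ?k) = (z, h)" by (cases "\<sigma> (Z ?k)")
    obtain d' F' where F': "word_val \<sigma> (conjugates_word cs) = (d', F')"
      by (cases "word_val \<sigma> (conjugates_word cs)")
    then obtain u where u: "d' = total_cursor cs" "u \<in> translate_sums cs"
      "F' + u \<in> ideal_of (common_period cs)"
      using snoc.IH[of d' F'] by blast
    have dF: "d = d' + cursor c"
      "F = shift (cursor c) F' + (shift z (word_config c) + (h + shift (cursor c) h))"
      using \<sigma> F' unfolding conjugates_word_snoc word_val_append[of _ "conjugates_word cs"]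
        word_val_conjugate[of \<sigma> ?k z h, OF z] by (simp_all add: L2_mult)
    let ?u = "shift (cursor c) u + shift z (word_config c)"
    have "F + ?u = shift (cursor c) (F' + u) + (h + shift (cursor c) h)"
      by (simp add: dF shift_add ac_simps)
    moreover have "shift (cursor c) (F' + u) \<in> ideal_of (gcd (common_period cs) (cursor c))"
      using ideal_of_shift[OF u(3)] ideal_of_mono[of "gcd (common_period cs) (cursor c)"] by auto
    moreover have "h + shift (cursor c) h \<in> ideal_of (gcd (common_period cs) (cursor c))"
      using ideal_ofI[OF refl] ideal_of_mono[of "gcd (common_period cs) (cursor c)"] by blast
    ultimately have "F + ?u \<in> ideal_of (gcd (common_period cs) (cursor c))"
      by (simp add: ideal_of_add)
    moreover have "?u \<in> translate_sums (cs @ [c])"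
      unfolding translate_sums_snoc using translate_sums_shift[OF u(2)] by blast
    ultimately show "d = total_cursor (cs @ [c]) \<and>
        (\<exists>u \<in> translate_sums (cs @ [c]). F + u \<in> ideal_of (common_period (cs @ [c])))"
      unfolding common_period_snoc using dF(1) u(1) by (auto simp: total_cursor_def)
  next
    assume R: "d = total_cursor (cs @ [c]) \<and>
        (\<exists>u \<in> translate_sums (cs @ [c]). F + u \<in> ideal_of (common_period (cs @ [c])))"
    then obtain u z where u: "u \<in> translate_sums cs"
      "F + (u + shift z (word_config c)) \<in> ideal_of (gcd (common_period cs) (cursor c))"
      unfolding translate_sums_snoc common_period_snoc by blast
    then obtain v where v: "v \<in> ideal_of (common_period cs)"
      "F + (u + shift z (word_config c)) + v \<in> ideal_of (cursor c)"
      using ideal_of_gcd by blast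
    then obtain h where h: "F + (u + shift z (word_config c)) + v = h + shift (cursor c) h"
      by (elim ideal_ofE)
    \<comment> \<open>Chosen so that multiplying by the last conjugate gives \<open>F\<close>: that
      conjugate supplies everything but \<open>u + v\<close>, up to the shift by its cursor.\<close>
    define F' where "F' = shift (- cursor c) (u + v)"
    have "F' + shift (- cursor c) u = shift (- cursor c) v"
      by (simp add: F'_def shift_add ac_simps)
    then have "F' + shift (- cursor c) u \<in> ideal_of (common_period cs)"
      using v(1) by (simp add: ideal_of_shift_iff)
    then obtain \<sigma> where \<sigma>: "word_val \<sigma> (conjugates_word cs) = (total_cursor cs, F')"
      using snoc.IH[of "total_cursor cs" F'] translate_sums_shift[OF u(1)] by blast
    define \<tau> where "\<tau> = \<sigma>(Z ?k := (z, h))"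
    have "word_val \<tau> (conjugates_word cs) = (total_cursor cs, F')"
      unfolding \<sigma>[symmetric] \<tau>_def by (rule word_val_cong) (auto dest: Var_conjugates_word)
    moreover have "\<tau> (Z ?k) = (z, h)" by (simp add: \<tau>_def)
    moreover have "shift (cursor c) F' + (shift z (word_config c) + (h + shift (cursor c) h)) = F"
      unfolding h[symmetric] by (simp add: F'_def shift_shift shift_0 ac_simps)
    ultimately have "word_val \<tau> (conjugates_word (cs @ [c])) = (d, F)"
      unfolding conjugates_word_snoc word_val_append[of _ "conjugates_word cs"]
      using R by (simp add: word_val_conjugate[simplified] L2_mult total_cursor_def)
    then show "\<exists>\<sigma>. word_val \<sigma> (conjugates_word (cs @ [c])) = (d, F)" by blast
  qed
qed

section \<open>Values of products of commutators and of squares\<close>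

lemma commutators_word_Suc:
  "commutators_word (Suc g) = commutators_word g @
    [(Var (X g), True), (Var (Y g), True), (Var (X g), False), (Var (Y g), False)]"
  by (simp add: commutators_word_def)

lemma squares_word_Suc:
  "squares_word (Suc g) = squares_word g @ [(Var (X g), False), (Var (X g), False)]"
  by (simp add: squares_word_def)

lemma Var_commutators_word: "(Var v, e) \<in> set (commutators_word g) \<Longrightarrow> \<exists>i<g. v = X i \<or> v = Y i"
  by (auto simp: commutators_word_def)

lemma Var_squares_word: "(Var v, e) \<in> set (squares_word g) \<Longrightarrow> \<exists>i<g. v = X i"
  by (auto simp: squares_word_def)

lemma word_val_commutator:
  assumes "\<sigma> (X i) = (a, u)" "\<sigma> (Y i) = (b, v)"
  shows "word_val \<sigma> [(Var (X i), True), (Var (Y i), True), (Var (X i), False), (Var (Y i), False)]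
    = (0, (u + shift b u) + (v + shift a v))"
  using assms
  by (simp add: word_val_Cons word_val_Nil L2_mult L2_inv shift_add shift_shift shift_zero shift_0 ac_simps)

lemma word_val_square:
  assumes "\<sigma> (X i) = (a, u)"
  shows "word_val \<sigma> [(Var (X i), False), (Var (X i), False)] = (2 * a, u + shift a u)"
  using assms by (simp add: word_val_Cons word_val_Nil L2_mult shift_add shift_zero shift_0 ac_simps)

lemma diff_in_ideal_1: "h + shift b h \<in> ideal_of 1"
  using shift_diff_in_ideal[of 1 0 b h] by (simp add: shift_0)

lemma commutators_word_in_ideal:
  "\<exists>F \<in> ideal_of 1. word_val \<sigma> (commutators_word g) = (0, F)"
proof (induction g)
  case 0
  then show ?case by (auto simp: commutators_word_def word_val_Nil)
next
  case (Suc g)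
  obtain a u b v where ab: "\<sigma> (X g) = (a, u)" "\<sigma> (Y g) = (b, v)"
    by (cases "\<sigma> (X g)"; cases "\<sigma> (Y g)")
  from Suc show ?case
    unfolding commutators_word_Suc word_val_append word_val_commutator[of \<sigma> g a u b v, OF ab]
    by (auto simp: L2_mult shift_0 intro!: ideal_of_add diff_in_ideal_1)
qed

text \<open>The commutator of (0, h) and (1, 0) is (0, (1 + X) h), so a single one already attains
  the whole ideal; the other variables are set to 1.\<close>

lemma commutators_word_value:
  assumes "F \<in> ideal_of 1"
  shows "\<exists>\<sigma>. word_val \<sigma> (commutators_word (Suc g)) = (0, F)"
proof (induction g)
  case 0
  obtain h where h: "F = h + shift 1 h" using assms by (rule ideal_ofE)
  have "word_val (\<lambda>v. if v = X 0 then (0, h) else (1, 0)) (commutators_word (Suc 0)) = (0, F)"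
    unfolding commutators_word_Suc
    by (subst word_val_append, subst word_val_commutator[of _ 0 0 h 1 0])
      (simp_all add: commutators_word_def word_val_Nil L2_mult shift_zero h)
  then show ?case by blast
next
  case (Suc g)
  then obtain \<sigma> where \<sigma>: "word_val \<sigma> (commutators_word (Suc g)) = (0, F)" ..
  let ?\<tau> = "\<sigma>(X (Suc g) := (0, 0), Y (Suc g) := (0, 0))"
  have "word_val ?\<tau> (commutators_word (Suc g)) = (0, F)"
    unfolding \<sigma>[symmetric] by (rule word_val_cong) (auto dest!: Var_commutators_word)
  then have "word_val ?\<tau> (commutators_word (Suc (Suc g))) = (0, F)"
    unfolding commutators_word_Suc[of "Suc g"]
    by (subst word_val_append, subst word_val_commutator[of _ _ 0 0 0 0])
      (simp_all add: L2_mult shift_zero shift_0)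
  then show ?case by blast
qed

lemma squares_word_in_ideal:
  "\<exists>a. \<exists>F \<in> ideal_of 1. word_val \<sigma> (squares_word g) = (2 * a, F)"
proof (induction g)
  case 0
  have "word_val \<sigma> (squares_word 0) = (2 * 0, 0)"
    by (simp add: squares_word_def word_val_Nil)
  then show ?case using zero_in_ideal by blast
next
  case (Suc g)
  obtain a u where a: "\<sigma> (X g) = (a, u)" by (cases "\<sigma> (X g)")
  from Suc obtain b F where F: "F \<in> ideal_of 1" "word_val \<sigma> (squares_word g) = (2 * b, F)" by blast
  have "word_val \<sigma> (squares_word (Suc g)) = (2 * (b + a), shift (2 * a) F + (u + shift a u))"
    unfolding squares_word_Suc by (simp only: word_val_append word_val_square[of \<sigma> g a u, OF a] F(2) L2_mult distrib_left)
  then show ?case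
    using ideal_of_add[OF ideal_of_shift[OF F(1)] diff_in_ideal_1] by blast
qed

text \<open>With one square, the cursor \<open>2 * a\<close> and the ideal of \<open>a\<close> are
  tied together; this is why genus 1 needs a criterion of its own.\<close>

lemma squares_word_1: "(\<exists>\<sigma>. word_val \<sigma> (squares_word 1) = (d, F)) \<longleftrightarrow> (\<exists>a. d = 2 * a \<and> F \<in> ideal_of a)"
proof -
  have "word_val \<sigma> (squares_word 1) = (2 * a, u + shift a u)" if "\<sigma> (X 0) = (a, u)" for \<sigma> a u
    using word_val_square[of \<sigma> 0 a u] that by (simp add: squares_word_def)
  note val = this
  show ?thesis
  proof
    assume "\<exists>\<sigma>. word_val \<sigma> (squares_word 1) = (d, F)"
    then obtain \<sigma> where \<sigma>: "word_val \<sigma> (squares_word 1) = (d, F)" by blast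
    obtain a u where a: "\<sigma> (X 0) = (a, u)" by (cases "\<sigma> (X 0)")
    then show "\<exists>a. d = 2 * a \<and> F \<in> ideal_of a"
      using val[of \<sigma> a u, OF a] \<sigma> by (auto simp: ideal_of_def)
  next
    assume "\<exists>a. d = 2 * a \<and> F \<in> ideal_of a"
    then obtain a h where "d = 2 * a" "F = h + shift a h" by (auto elim: ideal_ofE)
    then have "word_val (\<lambda>_. (a, h)) (squares_word 1) = (d, F)"
      using val[of "\<lambda>_. (a, h)" a h] by simp
    then show "\<exists>\<sigma>. word_val \<sigma> (squares_word 1) = (d, F)" by blast
  qed
qed

text \<open>A variable of cursor 1 yields the full ideal of 1 + X, and a second variable adjusts the
  total cursor; from genus 2 on, cursor and configuration are therefore independent.\<close>

lemma squares_word_value: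
  assumes "F \<in> ideal_of 1"
  shows "\<exists>\<sigma>. word_val \<sigma> (squares_word (Suc (Suc g))) = (2 * a, F)"
proof (induction g)
  case 0
  \<comment> \<open>This undoes the shift that the second square, of cursor
    \<open>2 * a - 2\<close>, exerts on the first.\<close>
  have "shift (2 - 2 * a) F \<in> ideal_of 1" using assms by (rule ideal_of_shift)
  then obtain h where h: "shift (2 - 2 * a) F = h + shift 1 h" by (rule ideal_ofE)
  then have F: "F = shift (2 * a - 2) (h + shift 1 h)"
    by (simp add: h[symmetric] shift_shift shift_0)
  let ?\<sigma> = "\<lambda>v. if v = X 0 then (1, h) else (a - 1, 0)"
  have "word_val ?\<sigma> [(Var (X 0), False), (Var (X 0), False)] = (2, h + shift 1 h)"
    using word_val_square[of ?\<sigma> 0 1 h] by simp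
  moreover have "word_val ?\<sigma> [(Var (X (Suc 0)), False), (Var (X (Suc 0)), False)] = (2 * a - 2, 0)"
    using word_val_square[of ?\<sigma> "Suc 0" "a - 1" 0] by (simp add: shift_zero)
  moreover have "word_val ?\<sigma> (squares_word 0) = (0, 0)"
    by (simp add: squares_word_def word_val_Nil)
  ultimately have "word_val ?\<sigma> (squares_word (Suc (Suc 0))) = (2 * a, F)"
    unfolding squares_word_Suc word_val_append F by (simp add: L2_mult shift_zero)
  then show ?case by blast
next
  case (Suc g)
  then obtain \<sigma> where \<sigma>: "word_val \<sigma> (squares_word (Suc (Suc g))) = (2 * a, F)" ..
  let ?\<tau> = "\<sigma>(X (Suc (Suc g)) := (0, 0))"
  have "word_val ?\<tau> (squares_word (Suc (Suc g))) = (2 * a, F)"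
    unfolding \<sigma>[symmetric] by (rule word_val_cong) (auto dest!: Var_squares_word)
  then have "word_val ?\<tau> (squares_word (Suc (Suc (Suc g)))) = (2 * a, F)"
    unfolding squares_word_Suc[of "Suc (Suc g)"]
    by (subst word_val_append, subst word_val_square[of _ _ 0 0])
      (simp_all add: L2_mult shift_zero shift_0)
  then show ?case by blast
qed

section \<open>The criteria for solvability\<close>

definition vanishing :: "gen word list \<Rightarrow> int \<Rightarrow> bool" where
  "vanishing cs d \<longleftrightarrow> (\<exists>u \<in> translate_sums cs. u \<in> ideal_of (gcd d (common_period cs)))"

lemma solvable_Spherical: "solvable_L2 (Spherical cs) \<longleftrightarrow> total_cursor cs = 0 \<and> vanishing cs 0"
proof -
  have "gcd 0 (common_period cs) = common_period cs" by (simp add: common_period_def)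
  then show ?thesis
    unfolding solvable_L2_def vanishing_def L2_one lhs.simps conjugates_word_values
    by (simp add: eq_commute[of 0])
qed

text \<open>The surface part and the conjugates involve different variables, so their values are
  independent.\<close>

lemma solvable_product:
  assumes vars: "\<And>v e. (Var v, e) \<in> set w \<Longrightarrow> \<forall>j. v \<noteq> Z j"
  shows "(\<exists>\<sigma>. word_val \<sigma> (w @ conjugates_word cs) = (0, 0)) \<longleftrightarrow>
    (\<exists>F \<sigma>. word_val \<sigma> w = (- total_cursor cs, F) \<and>
      (\<exists>u \<in> translate_sums cs. F + u \<in> ideal_of (common_period cs)))" (is "?L \<longleftrightarrow> ?R")
proof
  assume ?L
  then obtain \<sigma> where \<sigma>: "word_val \<sigma> (w @ conjugates_word cs) = (0, 0)" ..
  obtain d F where F: "word_val \<sigma> w = (d, F)" by (cases "word_val \<sigma> w")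
  obtain d' F' where F': "word_val \<sigma> (conjugates_word cs) = (d', F')"
    by (cases "word_val \<sigma> (conjugates_word cs)")
  then obtain u where u: "d' = total_cursor cs" "u \<in> translate_sums cs"
    "F' + u \<in> ideal_of (common_period cs)"
    using conjugates_word_values by blast
  have eq: "d + d' = 0" "shift d' F + F' = 0"
    using \<sigma> by (simp_all add: word_val_append F F' L2_mult)
  then have "F' = shift d' F" using config_eq_iff by metis
  then have "F' + u = shift d' (F + shift (- d') u)"
    by (simp add: shift_add shift_shift shift_0)
  then have "F + shift (- d') u \<in> ideal_of (common_period cs)"
    using u(3) by (simp add: ideal_of_shift_iff)
  moreover have "d = - total_cursor cs" using eq(1) u(1) by simp
  ultimately show ?R using F translate_sums_shift[OF u(2)] by blast
next
  assume ?R
  then obtain F \<sigma> u where \<sigma>: "word_val \<sigma> w = (- total_cursor cs, F)"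
    and u: "u \<in> translate_sums cs" "F + u \<in> ideal_of (common_period cs)" by blast
  let ?d = "total_cursor cs"
  have "shift ?d F + shift ?d u \<in> ideal_of (common_period cs)"
    unfolding shift_add[symmetric] by (rule ideal_of_shift[OF u(2)])
  then obtain \<tau> where \<tau>: "word_val \<tau> (conjugates_word cs) = (?d, shift ?d F)"
    using conjugates_word_values[of cs ?d "shift ?d F"] translate_sums_shift[OF u(1)] by blast
  define \<upsilon> where "\<upsilon> = (\<lambda>v. case v of Z j \<Rightarrow> \<tau> (Z j) | _ \<Rightarrow> \<sigma> v)"
  have "word_val \<upsilon> w = word_val \<sigma> w"
    by (rule word_val_cong) (use vars in \<open>auto simp: \<upsilon>_def split: var.splits\<close>)
  moreover have "word_val \<upsilon> (conjugates_word cs) = word_val \<tau> (conjugates_word cs)"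
    by (rule word_val_cong) (auto dest!: Var_conjugates_word simp: \<upsilon>_def)
  ultimately have "word_val \<upsilon> (w @ conjugates_word cs) = (0, 0)"
    by (simp add: word_val_append \<sigma> \<tau> L2_mult)
  then show ?L by blast
qed

text \<open>Here \<open>F\<close> is the contribution of the surface part, which ranges over the
  ideal of \<open>d\<close>: \<open>d = 0\<close> for none, \<open>d = 1\<close> for commutators or
  several squares, and half of the total cursor, up to sign, for one square.\<close>

lemma vanishing_iff:
  "vanishing cs d \<longleftrightarrow>
    (\<exists>F \<in> ideal_of d. \<exists>u \<in> translate_sums cs. F + u \<in> ideal_of (common_period cs))"
  unfolding vanishing_def ideal_of_gcd by (metis add.commute)

lemma solvable_Orientable:
  assumes "1 \<le> g"
  shows "solvable_L2 (Orientable g cs) \<longleftrightarrow> total_cursor cs = 0 \<and> vanishing cs 1"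
proof -
  have "(\<exists>\<sigma>. word_val \<sigma> (commutators_word g) = (d, F)) \<longleftrightarrow> d = 0 \<and> F \<in> ideal_of 1" for d F
    using commutators_word_in_ideal[of _ g] commutators_word_value[of F "g - 1"] assms
    by (metis Pair_inject Suc_diff_le diff_Suc_1)
  moreover have "(Var v, e) \<in> set (commutators_word g) \<Longrightarrow> \<forall>j. v \<noteq> Z j" for v e
    by (auto dest!: Var_commutators_word)
  ultimately show ?thesis
    unfolding solvable_L2_def lhs.simps L2_one vanishing_iff by (subst solvable_product) auto
qed

lemma solvable_Nonorientable_1:
  "solvable_L2 (Nonorientable 1 cs) \<longleftrightarrow> even (total_cursor cs) \<and> vanishing cs (total_cursor cs div 2)"
proof -
  \<comment> \<open>The square has to cancel the total cursor, so its exponent is minus one half of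
    it; the ideal does not see the sign.\<close>
  have uminus: "ideal_of (- a) = ideal_of a" for a
    using ideal_of_mono[of a "- a"] ideal_of_mono[of "- a" a] by auto
  have "(Var v, e) \<in> set (squares_word 1) \<Longrightarrow> \<forall>j. v \<noteq> Z j" for v e
    by (auto dest!: Var_squares_word)
  then have "solvable_L2 (Nonorientable 1 cs) \<longleftrightarrow>
      (\<exists>a. - total_cursor cs = 2 * a \<and> vanishing cs a)"
    unfolding solvable_L2_def lhs.simps L2_one vanishing_iff
    by (subst solvable_product) (use squares_word_1 in \<open>blast+\<close>)
  also have "\<dots> \<longleftrightarrow> even (total_cursor cs) \<and> vanishing cs (- (total_cursor cs div 2))"
  proof -
    have "- total_cursor cs = 2 * a \<longleftrightarrow> even (total_cursor cs) \<and> a = - (total_cursor cs div 2)" for a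
      by presburger
    then show ?thesis by auto
  qed
  finally show ?thesis by (simp add: vanishing_iff uminus)
qed

lemma solvable_Nonorientable:
  assumes "2 \<le> g"
  shows "solvable_L2 (Nonorientable g cs) \<longleftrightarrow> even (total_cursor cs) \<and> vanishing cs 1"
proof -
  have g: "Suc (Suc (g - 2)) = g" using assms by simp
  have "(\<exists>\<sigma>. word_val \<sigma> (squares_word g) = (d, F)) \<longleftrightarrow> even d \<and> F \<in> ideal_of 1" for d F
    using squares_word_in_ideal[of _ g] squares_word_value[of F "g - 2" "d div 2"] g
    by (metis Pair_inject dvd_triv_left even_two_times_div_two)
  moreover have "(Var v, e) \<in> set (squares_word g) \<Longrightarrow> \<forall>j. v \<noteq> Z j" for v e
    by (auto dest!: Var_squares_word)
  ultimately show ?thesis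
    unfolding solvable_L2_def lhs.simps L2_one vanishing_iff by (subst solvable_product) auto
qed

section \<open>Reading the criterion off the input word\<close>

lemma bit_of_nat_eq_0: "of_nat n = (0 :: bit) \<longleftrightarrow> even n"
  by (induction n) auto

lemma lookup_config_of: "Poly_Mapping.lookup (config_of ps) x = of_nat (count_list ps x)"
  by (induction ps) (auto simp: lookup_add lookup_single when_def)

lemma config_of_eq_0: "config_of ps = 0 \<longleftrightarrow> (\<forall>x. even (count_list ps x))"
  by (simp add: poly_mapping_eq_iff fun_eq_iff lookup_config_of bit_of_nat_eq_0)

lemma keys_config_of: "Poly_Mapping.keys (config_of ps) \<subseteq> set ps"
proof
  fix x assume "x \<in> Poly_Mapping.keys (config_of ps)"
  then have "count_list ps x \<noteq> 0" by (metis in_keys_iff lookup_config_of of_nat_0)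
  then show "x \<in> set ps" using count_notin by metis
qed

lemma config_of_keys: "config_of (sorted_list_of_set (Poly_Mapping.keys u)) = u"
proof (rule poly_mapping_eqI)
  fix x
  have "distinct xs \<Longrightarrow> count_list xs x = of_bool (x \<in> set xs)" for xs :: "int list"
    by (induction xs) auto
  then have "count_list (sorted_list_of_set (Poly_Mapping.keys u)) x = of_bool (x \<in> Poly_Mapping.keys u)"
    by simp
  then show "Poly_Mapping.lookup (config_of (sorted_list_of_set (Poly_Mapping.keys u))) x
      = Poly_Mapping.lookup u x"
    by (simp add: lookup_config_of in_keys_iff)
qed

lemma even_length_filter:
  assumes "config_of ps = 0"
  shows "even (length (filter P ps))"
proof -
  have "length (filter P ps) = (\<Sum>x \<in> set (filter P ps). count_list (filter P ps) x)"
    by (simp add: sum_count_set)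
  also have "\<dots> = (\<Sum>x \<in> set (filter P ps). count_list ps x)"
  proof (rule sum.cong)
    have "P x \<Longrightarrow> count_list (filter P ps) x = count_list ps x" for x
      by (induction ps) auto
    then show "x \<in> set (filter P ps) \<Longrightarrow> count_list (filter P ps) x = count_list ps x" for x
      by simp
  qed simp
  also have "even \<dots>"
    using assms by (intro dvd_sum) (simp add: config_of_eq_0)
  finally show ?thesis .
qed

text \<open>Modulo 1 + X^D, every lamp may be moved to the residue of its position. What remains is
  a configuration on the circle of length \<open>D\<close>, which vanishes if and only if each point
  carries an even number of lamps.\<close>

lemma config_of_in_ideal:
  assumes "0 < D"
  shows "config_of ps \<in> ideal_of D \<longleftrightarrow> (\<forall>r. even (length (filter (\<lambda>p. p mod D = r) ps)))"
proof
  assume "config_of ps \<in> ideal_of D"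
  then obtain h where h: "config_of ps = h + shift D h" by (rule ideal_ofE)
  \<comment> \<open>With \<open>h\<close> written as a list of lamps, the joint list of lamps of
    \<open>ps\<close>, \<open>h\<close> and its translate cancels, and the last two have equally
    many lamps in each residue class.\<close>
  obtain qs where qs: "h = config_of qs" using config_of_keys by metis
  let ?qs = "map (\<lambda>q. q - D) qs"
  have "config_of (ps @ qs @ ?qs) = 0"
    by (simp add: h qs shift_config_of)
  then have "even (length (filter (\<lambda>p. p mod D = r) (ps @ qs @ ?qs)))" for r
    by (rule even_length_filter)
  moreover have "length (filter (\<lambda>p. p mod D = r) ?qs) = length (filter (\<lambda>p. p mod D = r) qs)" for r
    by (simp add: filter_map o_def)
  ultimately show "\<forall>r. even (length (filter (\<lambda>p. p mod D = r) ps))"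
    by simp
next
  assume even: "\<forall>r. even (length (filter (\<lambda>p. p mod D = r) ps))"
  have "count_list (map (\<lambda>p. p mod D) ps) r = length (filter (\<lambda>p. p mod D = r) ps)" for r
    by (induction ps) auto
  then have "config_of (map (\<lambda>p. p mod D) ps) = 0"
    using even by (simp add: config_of_eq_0)
  moreover have "config_of ps + config_of (map (\<lambda>p. p mod D) ps) \<in> ideal_of D"
  proof (induction ps)
    case (Cons p ps)
    have "D dvd - p - - (p mod D)" using dvd_minus_mod[of D p] by (simp add: dvd_diff_commute)
    then have "shift (- p) (Poly_Mapping.single 0 1) + shift (- (p mod D)) (Poly_Mapping.single 0 1)
        \<in> ideal_of D"
      by (rule shift_diff_in_ideal)
    then have "Poly_Mapping.single p 1 + Poly_Mapping.single (p mod D) 1 \<in> ideal_of D"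
      unfolding shift_single by simp
    then have "(Poly_Mapping.single p 1 + Poly_Mapping.single (p mod D) 1) +
        (config_of ps + config_of (map (\<lambda>p. p mod D) ps)) \<in> ideal_of D"
      using Cons by (rule ideal_of_add)
    then show ?case by (simp add: ac_simps)
  qed simp
  ultimately show "config_of ps \<in> ideal_of D" by simp
qed

text \<open>A word of codes is scanned with a cursor, starting at \<open>e\<close>, and a counter of the symbols \<open>5\<close>,
  starting at \<open>k\<close>; the lamps after the \<open>k\<close>-th of them are shifted by \<open>\<zeta> k\<close>.\<close>

fun scan :: "(nat \<Rightarrow> int) \<Rightarrow> int \<Rightarrow> nat \<Rightarrow> nat list \<Rightarrow> int list" where
  "scan \<zeta> e k [] = []"
| "scan \<zeta> e k (x # w) = (if x = 6 \<or> x = 7 then [e + \<zeta> k] else []) @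
     scan \<zeta> (e + of_bool (x = 8) - of_bool (x = 9)) (k + of_bool (x = 5)) w"

fun cursors_at_5 :: "int \<Rightarrow> nat list \<Rightarrow> int list" where
  "cursors_at_5 e [] = []"
| "cursors_at_5 e (x # w) = (if x = 5 then [e] else []) @
     cursors_at_5 (e + of_bool (x = 8) - of_bool (x = 9)) w"

section \<open>Reading constants from the input word\<close>

lemma constants_code_Cons: "constants_code (c # cs) = 5 # map letter_code c @ constants_code cs"
  by (simp add: constants_code_def)

lemma scan_word:
  "scan \<zeta> e k (map letter_code c @ w) =
    map (\<lambda>p. p + (e + \<zeta> k)) (lamp_positions c) @ scan \<zeta> (e + cursor c) k w"
proof (induction c arbitrary: e rule: cursor.induct)
  case (2 b c)
  then show ?case by (cases b) simp_all
next
  case (3 b c)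
  then show ?case by (cases b) (simp_all add: o_def algebra_simps)
qed simp

lemma cursors_at_5_word:
  "cursors_at_5 e (map letter_code c @ w) = cursors_at_5 (e + cursor c) w"
proof (induction c arbitrary: e rule: cursor.induct)
  case (2 b c)
  then show ?case by (cases b) simp_all
next
  case (3 b c)
  then show ?case by (cases b) (simp_all add: algebra_simps)
qed simp

lemma scan_cong:
  "(\<And>j. k < j \<Longrightarrow> \<zeta> j = \<xi> j) \<Longrightarrow> scan \<zeta> e k (constants_code cs) = scan \<xi> e k (constants_code cs)"
proof (induction cs arbitrary: e k)
  case (Cons c cs)
  then show ?case by (simp add: constants_code_Cons scan_word)
qed (simp add: constants_code_def)

text \<open>Each constant is read under its own count of the symbols 5, so the values of the shift
  function act on the constants independently.\<close>

lemma translate_sums_scan: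
  "translate_sums cs = range (\<lambda>\<zeta>. config_of (scan \<zeta> e k (constants_code cs)))"
proof (induction cs arbitrary: e k)
  case Nil
  then show ?case by (simp add: constants_code_def)
next
  case (Cons c cs)
  have scan: "config_of (scan \<zeta> e k (constants_code (c # cs))) =
      shift (- (e + \<zeta> (Suc k) + cursor c)) (word_config c) +
      config_of (scan \<zeta> (e + cursor c) (Suc k) (constants_code cs))" for \<zeta>
    by (simp add: constants_code_Cons scan_word word_config_def shift_shift shift_config_of o_def algebra_simps)
  show ?case
  proof (intro equalityI subsetI)
    fix v assume "v \<in> translate_sums (c # cs)"
    then obtain z u where u: "v = shift z (word_config c) + u" "u \<in> translate_sums cs" by auto
    then obtain \<zeta> where \<zeta>: "u = config_of (scan \<zeta> (e + cursor c) (Suc k) (constants_code cs))"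
      using Cons[of "e + cursor c" "Suc k"] by auto
    \<comment> \<open>This value cancels the initial cursor \<open>e\<close> and the shift inside
      \<open>word_config\<close>; later constants read only values beyond
      \<open>Suc k\<close>.\<close>
    let ?\<xi> = "\<zeta>(Suc k := - z - e - cursor c)"
    have "scan ?\<xi> (e + cursor c) (Suc k) (constants_code cs) = scan \<zeta> (e + cursor c) (Suc k) (constants_code cs)"
      by (rule scan_cong) simp
    then have "v = config_of (scan ?\<xi> e k (constants_code (c # cs)))"
      unfolding scan u \<zeta> by simp
    then show "v \<in> range (\<lambda>\<zeta>. config_of (scan \<zeta> e k (constants_code (c # cs))))" by blast
  next
    fix v assume "v \<in> range (\<lambda>\<zeta>. config_of (scan \<zeta> e k (constants_code (c # cs))))"
    then show "v \<in> translate_sums (c # cs)"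
      unfolding scan using Cons[of "e + cursor c" "Suc k"] by auto
  qed
qed

lemma scan_header: "set h \<subseteq> {1, 2, 3, 4} \<Longrightarrow> scan \<zeta> e k (h @ w) = scan \<zeta> e k w"
  by (induction h) auto

lemma cursors_at_5_header: "set h \<subseteq> {1, 2, 3, 4} \<Longrightarrow> cursors_at_5 e (h @ w) = cursors_at_5 e w"
  by (induction h) auto

lemma equation_code_split:
  obtains h where "set h \<subseteq> {1, 2, 3, 4}" "h \<noteq> []" "equation_code E = h @ constants_code (constants E)"
proof (cases E)
  case (Spherical cs)
  then show ?thesis using that[of "[1]"] by simp
next
  case (Orientable g cs)
  then show ?thesis using that[of "2 # replicate g 4"] by (simp add: set_replicate_conv_if)
next
  case (Nonorientable g cs)
  then show ?thesis using that[of "3 # replicate g 4"] by (simp add: set_replicate_conv_if)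
qed

lemma occurrences_Cons:
  "occurrences (x # w) a (Suc i) = of_bool (x = a) + occurrences w a i"
proof -
  have "{j. j < Suc i \<and> letter_at (x # w) j = a} =
      (if x = a then {0} else {}) \<union> Suc ` {j. j < i \<and> letter_at w j = a}"
    by (auto simp: letter_at_def image_iff less_Suc_eq_0_disj)
  then show ?thesis
    unfolding occurrences_def by (simp add: card_insert_if card_image)
qed

lemma letter_at_Cons: "letter_at (x # w) (Suc i) = letter_at w i" "letter_at (x # w) 0 = x"
  by (simp_all add: letter_at_def)

definition cursor_at :: "nat list \<Rightarrow> nat \<Rightarrow> int" where
  "cursor_at w i = int (occurrences w 8 i) - int (occurrences w 9 i)"

lemma cursor_at_0 [simp]: "cursor_at w 0 = 0"
  by (simp add: cursor_at_def occurrences_def)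

lemma cursor_at_Cons: "cursor_at (x # w) (Suc i) = of_bool (x = 8) - of_bool (x = 9) + cursor_at w i"
  by (simp add: cursor_at_def occurrences_Cons)

lemma upt_Suc_map: "[0..<Suc n] = 0 # map Suc [0..<n]"
  by (simp add: map_Suc_upt upt_conv_Cons del: upt_Suc)

lemma scan_eq_map:
  "scan \<zeta> e k w = map (\<lambda>i. e + cursor_at w i + \<zeta> (k + occurrences w 5 i))
     (filter (is_lamp w) [0..<length w])"
proof (induction w arbitrary: e k)
  case (Cons x w)
  have "occurrences w a 0 = 0" for a w by (simp add: occurrences_def)
  moreover have "is_lamp (x # w) \<circ> Suc = is_lamp w"
    by (simp add: fun_eq_iff is_lamp_def letter_at_Cons)
  ultimately show ?case
    by (simp add: Cons upt_Suc_map filter_map o_def is_lamp_def[of "x # w" 0] letter_at_Cons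
        cursor_at_Cons occurrences_Cons ac_simps del: upt_Suc)
qed simp

lemma cursors_at_5_eq_map:
  "cursors_at_5 e w = map (\<lambda>i. e + cursor_at w i) (filter (\<lambda>i. letter_at w i = 5) [0..<length w])"
proof (induction w arbitrary: e)
  case (Cons x w)
  have "occurrences w a 0 = 0" for a w by (simp add: occurrences_def)
  then show ?case
    by (simp add: Cons upt_Suc_map filter_map o_def letter_at_Cons
        cursor_at_Cons ac_simps del: upt_Suc)
qed simp

lemma cursor_at_append: "cursor_at (v @ w) (length v + i) = cursor_at v (length v) + cursor_at w i"
  by (induction v) (simp_all add: cursor_at_Cons)

lemma cursor_at_word: "cursor_at (map letter_code c) (length c) = cursor c"
proof (induction c rule: cursor.induct)
  case (2 b c)
  then show ?case by (cases b) (simp_all add: cursor_at_Cons)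
next
  case (3 b c)
  then show ?case by (cases b) (simp_all add: cursor_at_Cons)
qed simp

lemma cursor_at_constants_code:
  "cursor_at (constants_code cs) (length (constants_code cs)) = total_cursor cs"
proof (induction cs)
  case (Cons c cs)
  then show ?case
    using cursor_at_append[of "map letter_code c" "constants_code cs" "length (constants_code cs)"]
    by (simp add: constants_code_Cons cursor_at_Cons cursor_at_word total_cursor_def)
qed (simp add: constants_code_def total_cursor_def)

lemma cursor_at_header: "set h \<subseteq> {1, 2, 3, 4} \<Longrightarrow> cursor_at h (length h) = 0"
  by (induction h) (auto simp: cursor_at_Cons)

lemma cursor_at_equation_code:
  "cursor_at (equation_code E) (length (equation_code E)) = total_cursor (constants E)"
proof -
  obtain h where h: "set h \<subseteq> {1, 2, 3, 4}" "equation_code E = h @ constants_code (constants E)"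
    by (rule equation_code_split)
  then show ?thesis
    by (simp add: cursor_at_append cursor_at_header cursor_at_constants_code)
qed

lemma translate_sums_equation_code:
  "translate_sums (constants E) = range (\<lambda>\<zeta>. config_of (scan \<zeta> 0 0 (equation_code E)))"
proof -
  obtain h where "set h \<subseteq> {1, 2, 3, 4}" "equation_code E = h @ constants_code (constants E)"
    by (rule equation_code_split)
  then show ?thesis
    using translate_sums_scan[of "constants E" 0 0] by (simp add: scan_header)
qed

text \<open>Divisibility of all partial sums is divisibility of all their differences. No 5 follows
  the last constant, so the total has to be added to the list of partial sums.\<close>

lemma cursors_at_5_dvd:
  "(\<forall>x \<in> set (cursors_at_5 e (constants_code cs)). D dvd x) \<and> D dvd e + total_cursor cs \<longleftrightarrow>
    D dvd e \<and> (\<forall>c \<in> set cs. D dvd cursor c)"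
proof (induction cs arbitrary: e)
  case (Cons c cs)
  have "(\<forall>x \<in> set (cursors_at_5 e (constants_code (c # cs))). D dvd x) \<and> D dvd e + total_cursor (c # cs)
      \<longleftrightarrow> D dvd e \<and> (\<forall>x \<in> set (cursors_at_5 (e + cursor c) (constants_code cs)). D dvd x) \<and>
        D dvd (e + cursor c) + total_cursor cs"
    by (auto simp: constants_code_Cons cursors_at_5_word total_cursor_def add.assoc)
  also have "\<dots> \<longleftrightarrow> D dvd e \<and> D dvd e + cursor c \<and> (\<forall>c \<in> set cs. D dvd cursor c)"
    using Cons[of "e + cursor c"] by blast
  also have "\<dots> \<longleftrightarrow> D dvd e \<and> (\<forall>c \<in> set (c # cs). D dvd cursor c)"
    by (auto simp: dvd_add_right_iff)
  finally show ?case .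
qed (simp add: constants_code_def total_cursor_def)

lemma mod_eq_iff_dvd_cursor:
  "occurrences w 8 i mod D = occurrences w 9 i mod D \<longleftrightarrow> int D dvd cursor_at w i"
  unfolding cursor_at_def mod_eq_dvd_iff[symmetric] of_nat_mod[symmetric] of_nat_eq_iff ..

lemma period_iff:
  "period (equation_code E) D \<longleftrightarrow>
    (\<forall>c \<in> set (constants E). int D dvd cursor c) \<and> 2 * int D dvd total_cursor (constants E)"
proof -
  let ?w = "equation_code E"
  obtain h where h: "set h \<subseteq> {1, 2, 3, 4}" "?w = h @ constants_code (constants E)"
    by (rule equation_code_split)
  have "period ?w D \<longleftrightarrow> (\<forall>x \<in> set (cursors_at_5 0 ?w). int D dvd x) \<and>
      2 * int D dvd total_cursor (constants E)"
    unfolding period_def mod_eq_iff_dvd_cursor cursor_at_equation_code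
    by (auto simp: cursors_at_5_eq_map)
  also have "\<dots> \<longleftrightarrow> ((\<forall>x \<in> set (cursors_at_5 0 (constants_code (constants E))). int D dvd x) \<and>
      int D dvd 0 + total_cursor (constants E)) \<and> 2 * int D dvd total_cursor (constants E)"
    unfolding h(2) cursors_at_5_header[OF h(1)] by (auto dest: dvd_mult_right)
  finally show ?thesis unfolding cursors_at_5_dvd by simp
qed

section \<open>Shifts modulo \<open>D\<close> as digits of a number\<close>

lemma ex_digits:
  assumes f: "\<And>j. f j < (D::nat)"
  shows "\<exists>m < D ^ k. \<forall>j < k. m div D ^ j mod D = f j"
proof (induction k)
  case (Suc k)
  then obtain m where m: "m < D ^ k" "\<forall>j<k. m div D ^ j mod D = f j" by blast
  define m' where "m' = m + f k * D ^ k"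
  have D: "0 < D" using f[of 0] by simp
  have "m' < D ^ k + f k * D ^ k" unfolding m'_def using m(1) by simp
  also have "\<dots> \<le> D ^ Suc k"
    using f[of k] mult_le_mono1[of "Suc (f k)" D "D ^ k"] by simp
  finally have "m' < D ^ Suc k" .
  moreover have "m' div D ^ j mod D = f j" if "j < Suc k" for j
  proof (cases "j = k")
    case True
    then show ?thesis
      using m(1) D f[of k] by (simp add: m'_def)
  next
    case False
    then have j: "j < k" "k = j + Suc (k - Suc j)" using that by simp_all
    have "D ^ k = D ^ j * (D * D ^ (k - Suc j))"
      by (subst j(2)) (simp only: power_add power_Suc)
    then have eq: "m' = m + D ^ j * (D * (f k * D ^ (k - Suc j)))"
      unfolding m'_def by (simp only: ac_simps)
    have "D ^ j \<noteq> 0" using D by simp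
    then have "m' div D ^ j = D * (f k * D ^ (k - Suc j)) + m div D ^ j"
      unfolding eq by (rule div_mult_self2)
    then show ?thesis using m(2) j(1) by simp
  qed
  ultimately show ?case by blast
qed simp

lemma mod_shift_iff:
  assumes "r < D"
  shows "(a + b) mod D = (c + r) mod D \<longleftrightarrow> (int a - int c + int b) mod int D = int r"
proof -
  have "(a + b) mod D = (c + r) mod D \<longleftrightarrow> int D dvd (int a - int c + int b) - int r"
    unfolding of_nat_eq_iff[symmetric, where 'a = int] of_nat_mod mod_eq_dvd_iff
    by (simp add: algebra_simps)
  also have "\<dots> \<longleftrightarrow> (int a - int c + int b) mod int D = int r"
    unfolding mod_eq_dvd_iff[symmetric] using assms by simp
  finally show ?thesis .
qed

lemma lamps_at_eq:
  assumes "r < D"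
  shows "lamps_at w D m r =
    length (filter (\<lambda>p. p mod int D = int r) (scan (\<lambda>j. int (m div D ^ j mod D)) 0 0 w))"
proof -
  let ?f = "\<lambda>i. cursor_at w i + int (m div D ^ occurrences w 5 i mod D)"
  have "length (filter (\<lambda>p. p mod int D = int r) (scan (\<lambda>j. int (m div D ^ j mod D)) 0 0 w))
      = length (filter (\<lambda>i. is_lamp w i \<and> ?f i mod int D = int r) [0..<length w])"
    by (simp add: scan_eq_map filter_map o_def conj_commute)
  also have "\<dots> = card {i. i < length w \<and> is_lamp w i \<and> ?f i mod int D = int r}"
    unfolding length_filter_conv_card by (intro arg_cong[where f = card]) auto
  finally show ?thesis
    unfolding lamps_at_def mod_shift_iff[OF assms] cursor_at_def by simp
qed

lemma scan_mod_eq: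
  assumes "\<And>j. j \<le> occurrences w 5 (length w) \<Longrightarrow> \<zeta> j mod D = \<xi> j mod D"
  shows "length (filter (\<lambda>p. p mod D = r) (scan \<zeta> 0 0 w)) = length (filter (\<lambda>p. p mod D = r) (scan \<xi> 0 0 w))"
proof -
  have "(cursor_at w i + \<zeta> (occurrences w 5 i)) mod D = (cursor_at w i + \<xi> (occurrences w 5 i)) mod D"
    if "i < length w" for i
  proof -
    have "occurrences w 5 i \<le> occurrences w 5 (length w)"
      unfolding occurrences_def using that by (intro card_mono) auto
    then show ?thesis using assms mod_add_cong by blast
  qed
  then show ?thesis
    by (auto simp: scan_eq_map filter_map o_def intro!: arg_cong[where f = length] filter_cong)
qed

text \<open>Membership depends on the shifts only modulo \<open>D\<close>, so the search over
  integer shifts becomes one over digits. The slack between \<open>D\<close> and \<open>N\<close>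
  permits a range of \<open>m\<close> that is common to all \<open>D\<close>.\<close>

lemma ex_shifts_iff:
  assumes D: "0 < D" "D \<le> N"
  shows "(\<exists>\<zeta>. config_of (scan \<zeta> 0 0 w) \<in> ideal_of (int D)) \<longleftrightarrow>
    (\<exists>m < N ^ Suc (occurrences w 5 (length w)). \<forall>r<D. even (lamps_at w D m r))"
proof -
  have in_ideal: "config_of (scan \<zeta> 0 0 w) \<in> ideal_of (int D) \<longleftrightarrow>
      (\<forall>r<D. even (length (filter (\<lambda>p. p mod int D = int r) (scan \<zeta> 0 0 w))))" for \<zeta>
  proof -
    have "even (length (filter (\<lambda>p. p mod int D = r) (scan \<zeta> 0 0 w)))"
      if "\<forall>r<D. even (length (filter (\<lambda>p. p mod int D = int r) (scan \<zeta> 0 0 w)))" for r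
    proof (cases "0 \<le> r \<and> r < int D")
      case True
      then show ?thesis using that[rule_format, of "nat r"] by (simp add: nat_less_iff)
    next
      case False
      then have "filter (\<lambda>p. p mod int D = r) (scan \<zeta> 0 0 w) = []"
        using D(1) by (auto simp: filter_empty_conv)
      then show ?thesis by simp
    qed
    moreover have "0 < int D" using D(1) by simp
    ultimately show ?thesis by (subst config_of_in_ideal) blast+
  qed
  show ?thesis
  proof
    assume "\<exists>\<zeta>. config_of (scan \<zeta> 0 0 w) \<in> ideal_of (int D)"
    then obtain \<zeta> where \<zeta>: "config_of (scan \<zeta> 0 0 w) \<in> ideal_of (int D)" ..
    let ?k = "Suc (occurrences w 5 (length w))"
    have "nat (\<zeta> j mod int D) < D" for j using D(1) by (simp add: nat_less_iff)
    then obtain m where m: "m < D ^ ?k" "\<forall>j < ?k. m div D ^ j mod D = nat (\<zeta> j mod int D)"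
      using ex_digits[of "\<lambda>j. nat (\<zeta> j mod int D)" D ?k] by blast
    have "even (lamps_at w D m r)" if "r < D" for r
    proof -
      have "lamps_at w D m r = length (filter (\<lambda>p. p mod int D = int r) (scan \<zeta> 0 0 w))"
        unfolding lamps_at_eq[OF that] using D(1) m(2) by (intro scan_mod_eq) simp
      then show ?thesis using \<zeta> that in_ideal by simp
    qed
    moreover have "m < N ^ ?k" using m(1) power_mono[OF D(2), of ?k] by simp
    ultimately show "\<exists>m < N ^ ?k. \<forall>r<D. even (lamps_at w D m r)" by blast
  next
    assume "\<exists>m < N ^ Suc (occurrences w 5 (length w)). \<forall>r<D. even (lamps_at w D m r)"
    then show "\<exists>\<zeta>. config_of (scan \<zeta> 0 0 w) \<in> ideal_of (int D)"
      unfolding in_ideal by (auto simp: lamps_at_eq)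
  qed
qed

lemma length_scan: "length (scan \<zeta> 0 0 w) = lamps w"
  unfolding lamps_def scan_eq_map length_map length_filter_conv_card
  by (intro arg_cong[where f = card]) auto

text \<open>Modulo 1 there is a single residue class, so neither the translations nor the cursors
  matter.\<close>

lemma vanishing_1: "vanishing (constants E) 1 \<longleftrightarrow> even (lamps (equation_code E))"
proof -
  have "length (filter (\<lambda>p. p mod 1 = r) ps) = (if r = 0 then length ps else 0)" for r :: int and ps
    by simp
  then have "config_of ps \<in> ideal_of 1 \<longleftrightarrow> even (length ps)" for ps
    by (subst config_of_in_ideal) auto
  then show ?thesis
    by (simp add: vanishing_def translate_sums_equation_code length_scan)
qed

section \<open>Bounds on supports and the cut of the circle\<close>

lemma lamp_positions_bound: "p \<in> set (lamp_positions c) \<Longrightarrow> \<bar>p\<bar> \<le> int (length c)"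
  by (induction c arbitrary: p rule: lamp_positions.induct) (force split: if_splits)+

lemma cursor_bound: "\<bar>cursor c\<bar> \<le> int (length c)"
  by (induction c rule: cursor.induct) auto

lemma total_cursor_bound: "\<bar>total_cursor cs\<bar> \<le> int (sum_list (map length cs))"
proof (induction cs)
  case (Cons c cs)
  then show ?case using cursor_bound[of c] by (simp add: total_cursor_def)
qed (simp add: total_cursor_def)

text \<open>Cutting the circle of length \<open>D\<close> at a point \<open>p\<close> outside the intervals covered by the
  summands.\<close>

lemma translate_sums_cut:
  assumes D: "0 < D" and u: "u \<in> translate_sums cs"
  shows "\<exists>C. finite C \<and> card C \<le> (\<Sum>c\<leftarrow>cs. 2 * length c + 1) \<and>
    (\<forall>p. (\<forall>x\<in>C. \<not> D dvd x - p) \<longrightarrow>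
      (\<exists>v \<in> translate_sums cs. v + u \<in> ideal_of D \<and> Poly_Mapping.keys v \<subseteq> {p<..<p + D}))"
  using u
proof (induction cs arbitrary: u)
  case Nil
  then show ?case by (intro exI[of _ "{}"]) simp
next
  case (Cons c cs)
  then obtain z u' where u': "u = shift z (word_config c) + u'" "u' \<in> translate_sums cs" by auto
  from Cons.IH[OF u'(2)] obtain C where C: "finite C" "card C \<le> (\<Sum>c\<leftarrow>cs. 2 * length c + 1)"
    "\<And>p. (\<forall>x\<in>C. \<not> D dvd x - p) \<Longrightarrow>
      \<exists>v \<in> translate_sums cs. v + u' \<in> ideal_of D \<and> Poly_Mapping.keys v \<subseteq> {p<..<p + D}"
    by blast
  define l where "l = int (length c)"
  \<comment> \<open>The place where the reading of \<open>c\<close> starts in its translate; all its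
    lamps are within \<open>l\<close> of it, which gives an interval of
    \<open>2 * length c + 1\<close> points.\<close>
  define q where "q = - cursor c - z"
  have keys: "Poly_Mapping.keys (shift (z - t) (word_config c)) \<subseteq> {q + t - l..q + t + l}" for t
  proof -
    have "shift (z - t) (word_config c) = config_of (map (\<lambda>p. p + q + t) (lamp_positions c))"
      by (simp add: word_config_def shift_shift shift_config_of q_def o_def algebra_simps)
    then have "Poly_Mapping.keys (shift (z - t) (word_config c)) \<subseteq>
        (\<lambda>p. p + q + t) ` set (lamp_positions c)"
      using keys_config_of[of "map (\<lambda>p. p + q + t) (lamp_positions c)"] by simp
    then show ?thesis using lamp_positions_bound[of _ c] by (force simp: l_def)
  qed
  let ?C = "{q - l..q + l} \<union> C"
  have "card ?C \<le> card {q - l..q + l} + card C" by (rule card_Un_le)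
  also have "card {q - l..q + l} = 2 * length c + 1" by (simp add: l_def)
  finally have "card ?C \<le> (\<Sum>c\<leftarrow>c # cs. 2 * length c + 1)" using C(2) by simp
  moreover have "\<exists>v \<in> translate_sums (c # cs). v + u \<in> ideal_of D \<and> Poly_Mapping.keys v \<subseteq> {p<..<p + D}"
    if p: "\<forall>x\<in>?C. \<not> D dvd x - p" for p
  proof -
    obtain v where v: "v \<in> translate_sums cs" "v + u' \<in> ideal_of D" "Poly_Mapping.keys v \<subseteq> {p<..<p + D}"
      using C(3)[of p] p by auto
    \<comment> \<open>The multiple of \<open>D\<close> that brings the left end of the interval into
      the window of length \<open>D\<close> starting at \<open>p\<close>.\<close>
    define t where "t = - (D * ((q - l - p) div D))"
    have "q + t - l = p + (q - l - p) mod D"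
      unfolding t_def by (simp add: minus_mult_div_eq_mod[symmetric])
    then have range: "p \<le> q + t - l" "q + t - l < p + D" using D by simp_all
    have notin: "\<not> D dvd x - t - p" if "x \<in> {q + t - l..q + t + l}" for x
      using p that by auto
    have t: "D dvd t" by (simp add: t_def)
    have "\<not> (q + t - l \<le> x \<and> x \<le> q + t + l)" if "D dvd x - p" for x
    proof
      assume "q + t - l \<le> x \<and> x \<le> q + t + l"
      then have "\<not> D dvd x - t - p" by (intro notin) auto
      moreover have "D dvd (x - p) - t" using that t by (rule dvd_diff)
      ultimately show False by (simp add: algebra_simps)
    qed
    \<comment> \<open>Neither \<open>p\<close> nor \<open>p + D\<close> is covered, since both have
      the residue of the cut; an interval that starts between them cannot cross either one.\<close>
    from this[of p] this[of "p + D"] have "p < q + t - l" "q + t + l < p + D"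
      using range by (auto simp: l_def)
    then have k: "Poly_Mapping.keys (shift (z - t) (word_config c)) \<subseteq> {p<..<p + D}"
      using keys[of t] by fastforce
    let ?v = "shift (z - t) (word_config c) + v"
    have "Poly_Mapping.keys ?v \<subseteq> {p<..<p + D}"
      using Poly_Mapping.keys_add[of "shift (z - t) (word_config c)" v] k v(3) by blast
    moreover have "shift (z - t) (word_config c) + shift z (word_config c) \<in> ideal_of D"
      by (rule shift_diff_in_ideal) (simp add: t)
    then have "(shift (z - t) (word_config c) + shift z (word_config c)) + (v + u') \<in> ideal_of D"
      using v(2) by (rule ideal_of_add)
    then have "?v + u \<in> ideal_of D" by (simp add: u' ac_simps)
    moreover have "?v \<in> translate_sums (c # cs)" using v(1) by auto
    ultimately show ?thesis by blast
  qed
  ultimately show ?case using C(1) by (intro exI[of _ ?C]) blast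
qed

text \<open>An open window of length \<open>D\<close> contains each residue at most once, so a lamp
  in it has no partner in its class.\<close>

lemma ideal_of_short_support:
  assumes D: "0 < D" and u: "u \<in> ideal_of D" "Poly_Mapping.keys u \<subseteq> {p<..<p + D}"
  shows "u = 0"
proof (rule ccontr)
  assume "u \<noteq> 0"
  then obtain x where x: "x \<in> Poly_Mapping.keys u" by (metis all_not_in_conv keys_eq_empty)
  let ?ps = "sorted_list_of_set (Poly_Mapping.keys u)"
  have "y = x" if "y \<in> Poly_Mapping.keys u" "y mod D = x mod D" for y
  proof -
    have "D dvd y - x" using that(2) by (simp add: mod_eq_dvd_iff)
    moreover have "x \<in> {p<..<p + D}" "y \<in> {p<..<p + D}" using x that(1) u(2) by blast+
    then have "\<bar>y - x\<bar> < D" unfolding greaterThanLessThan_iff by linarith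
    ultimately show ?thesis using dvd_imp_le_int[of "y - x" D] D by auto
  qed
  then have "set (filter (\<lambda>y. y mod D = x mod D) ?ps) = {x}" using x by auto
  then have "length (filter (\<lambda>y. y mod D = x mod D) ?ps) = 1"
    using distinct_card[of "filter (\<lambda>y. y mod D = x mod D) ?ps"] by simp
  moreover have "even (length (filter (\<lambda>y. y mod D = x mod D) ?ps))"
    using u(1) config_of_in_ideal[OF D, of ?ps] by (simp add: config_of_keys)
  ultimately show False by simp
qed

text \<open>The intervals cover fewer than \<open>D\<close> residues, so some point \<open>p\<close>
  of the circle is free. Cutting there replaces \<open>u\<close> by a congruent sum of translates
  within one window, which still lies in the ideal and is therefore zero.\<close>

lemma translate_sums_zero:
  assumes D: "(\<Sum>c\<leftarrow>cs. 2 * length c + 1) < D"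
    and u: "u \<in> translate_sums cs" "u \<in> ideal_of (int D)"
  shows "0 \<in> translate_sums cs"
proof -
  have pos: "0 < int D" using D by simp
  from translate_sums_cut[OF pos u(1)] obtain C where C: "finite C"
    "card C \<le> (\<Sum>c\<leftarrow>cs. 2 * length c + 1)"
    "\<And>p. (\<forall>x\<in>C. \<not> int D dvd x - p) \<Longrightarrow>
      \<exists>v \<in> translate_sums cs. v + u \<in> ideal_of (int D) \<and> Poly_Mapping.keys v \<subseteq> {p<..<p + int D}"
    by blast
  have "card ((\<lambda>x. x mod int D) ` C) < card {0..<int D}"
    using card_image_le[OF C(1), of "\<lambda>x. x mod int D"] C(2) D by simp
  then have "\<not> {0..<int D} \<subseteq> (\<lambda>x. x mod int D) ` C"
    using card_mono[of "(\<lambda>x. x mod int D) ` C" "{0..<int D}"] C(1) by auto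
  then obtain p where p: "p \<in> {0..<int D}" "p \<notin> (\<lambda>x. x mod int D) ` C" by blast
  have "\<not> int D dvd x - p" if "x \<in> C" for x
    using that p by (auto simp: mod_eq_dvd_iff[symmetric])
  then obtain v where v: "v \<in> translate_sums cs" "v + u \<in> ideal_of (int D)"
    "Poly_Mapping.keys v \<subseteq> {p<..<p + int D}"
    using C(3) by blast
  have "v \<in> ideal_of (int D)" using ideal_of_add_iff[OF v(2)] u(2) by simp
  then show ?thesis using ideal_of_short_support[OF pos _ v(3)] v(1) by simp
qed

text \<open>The tested numbers are the divisors, up to \<open>2 * ?n\<close>, of the gcd
  \<open>?p\<close>. A solution for \<open>?p\<close> solves all its divisors; conversely one
  divisor decides, \<open>?p\<close> itself if it is nonzero and \<open>2 * ?n\<close>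
  otherwise.\<close>

lemma lamps_cancel_iff:
  assumes d: "total_cursor (constants E) = 2 * d"
  shows "lamps_cancel (equation_code E) \<longleftrightarrow> vanishing (constants E) d"
proof -
  let ?w = "equation_code E" and ?cs = "constants E"
  let ?n = "length ?w" and ?p = "gcd d (common_period ?cs)"
  obtain h where h: "h \<noteq> []" "?w = h @ constants_code ?cs"
    by (rule equation_code_split)
  have n: "length ?cs + sum_list (map length ?cs) < ?n"
    using h(1) unfolding h(2) by (simp add: length_constants_code)
  have period: "period ?w D \<longleftrightarrow> int D dvd ?p" for D
    unfolding period_iff d by (auto simp: common_period_def dvd_Gcd_iff)
  have ex: "(\<exists>m<(2 * ?n) ^ Suc (occurrences ?w 5 ?n). \<forall>r<Suc D. even (lamps_at ?w (Suc D) m r)) \<longleftrightarrow>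
      (\<exists>u \<in> translate_sums ?cs. u \<in> ideal_of (int (Suc D)))" if "D < 2 * ?n" for D
    unfolding translate_sums_equation_code bex_simps
    by (rule ex_shifts_iff[symmetric, THEN trans]) (use that in \<open>simp_all only: Suc_leI zero_less_Suc UNIV_I simp_thms\<close>)
  have "lamps_cancel ?w \<longleftrightarrow> (\<forall>D<2 * ?n. int (Suc D) dvd ?p \<longrightarrow>
      (\<exists>u \<in> translate_sums ?cs. u \<in> ideal_of (int (Suc D))))"
    unfolding lamps_cancel_def period by (intro all_cong imp_cong ex refl)
  also have "\<dots> \<longleftrightarrow> vanishing ?cs d"
  proof
    assume "vanishing ?cs d"
    then show "\<forall>D<2 * ?n. int (Suc D) dvd ?p \<longrightarrow> (\<exists>u \<in> translate_sums ?cs. u \<in> ideal_of (int (Suc D)))"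
      unfolding vanishing_def using ideal_of_mono by blast
  next
    assume *: "\<forall>D<2 * ?n. int (Suc D) dvd ?p \<longrightarrow> (\<exists>u \<in> translate_sums ?cs. u \<in> ideal_of (int (Suc D)))"
    have *: "\<exists>u \<in> translate_sums ?cs. u \<in> ideal_of (int D)" if "0 < D" "D \<le> 2 * ?n" "int D dvd ?p" for D
    proof -
      from that(1) obtain D' where "D = Suc D'" using gr0_implies_Suc by blast
      then show ?thesis using * that(2,3) by (simp only: Suc_le_eq)
    qed
    show "vanishing ?cs d"
    proof (cases "?p = 0")
      case True
      have sum: "(\<Sum>c\<leftarrow>cs. 2 * length c + 1) = 2 * sum_list (map length cs) + length cs"
        for cs :: "gen word list" by (induction cs) auto
      \<comment> \<open>The code has at least one symbol before the constants, so \<open>?n\<close>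
        exceeds the number of constants plus their total length; doubling allows for intervals that
        extend to both sides.\<close>
      have "(\<Sum>c\<leftarrow>?cs. 2 * length c + 1) < 2 * ?n" using n unfolding sum by linarith
      moreover have "\<exists>u \<in> translate_sums ?cs. u \<in> ideal_of (int (2 * ?n))"
        by (rule *) (use h True in simp_all)
      ultimately have "0 \<in> translate_sums ?cs" using translate_sums_zero by blast
      then show ?thesis unfolding vanishing_def using zero_in_ideal by blast
    next
      case False
      define P where "P = ?p"
      have dvd: "P dvd d" "P dvd common_period ?cs" by (simp_all add: P_def)
      have P: "P \<noteq> 0" "0 \<le> P" using False by (simp_all only: P_def gcd_ge_0_int) simp
      then have abs: "\<bar>P\<bar> = P" by simp
      \<comment> \<open>A nonzero gcd divides \<open>d\<close> or, if \<open>d = 0\<close>, some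
        nonzero cursor, and both are bounded by the lengths of the constants.\<close>
      have "P \<le> int ?n"
      proof (cases "d = 0")
        case True
        have "\<exists>c \<in> set ?cs. cursor c \<noteq> 0"
        proof (rule ccontr)
          assume "\<not> ?thesis"
          then have "cursor ` set ?cs \<subseteq> {0}" by blast
          then have "common_period ?cs = 0" unfolding common_period_def Gcd_0_iff .
          then show False using True False by simp
        qed
        then obtain c where c: "c \<in> set ?cs" "cursor c \<noteq> 0" by blast
        have "common_period ?cs dvd cursor c"
          unfolding common_period_def using c(1) by (intro Gcd_dvd imageI)
        then have "P dvd cursor c" using dvd(2) dvd_trans by blast
        then have "P \<le> \<bar>cursor c\<bar>" using dvd_imp_le_int[OF c(2)] abs by metis
        moreover have "length c \<le> sum_list (map length ?cs)"
          using c(1) by (intro member_le_sum_list) auto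
        ultimately show ?thesis using n cursor_bound[of c] by linarith
      next
        case False
        then have "P \<le> \<bar>d\<bar>" using dvd_imp_le_int[OF False dvd(1)] abs by metis
        then show ?thesis using d total_cursor_bound[of ?cs] n by linarith
      qed
      then have "0 < nat P" "nat P \<le> 2 * ?n" "int (nat P) = P" using P by linarith+
      then show ?thesis
        using *[of "nat P"] unfolding vanishing_def P_def[symmetric] by (simp only: dvd_refl)
    qed
  qed
  finally show ?thesis .
qed

lemma total_cursor_zero_iff:
  "occurrences (equation_code E) 8 (length (equation_code E)) =
     occurrences (equation_code E) 9 (length (equation_code E)) \<longleftrightarrow> total_cursor (constants E) = 0"
  unfolding cursor_at_equation_code[symmetric] cursor_at_def by simp

lemma total_cursor_even_iff:
  "occurrences (equation_code E) 8 (length (equation_code E)) mod 2 =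
     occurrences (equation_code E) 9 (length (equation_code E)) mod 2 \<longleftrightarrow>
   even (total_cursor (constants E))"
  unfolding mod_eq_iff_dvd_cursor cursor_at_equation_code by simp

lemma solvable_iff_accepted:
  assumes "standard_form E"
  shows "solvable_L2 E \<longleftrightarrow> accepted (equation_code E)"
proof -
  note iffs = total_cursor_zero_iff[of E] total_cursor_even_iff[of E] vanishing_1[of E]
  have half: "lamps_cancel (equation_code E) \<longleftrightarrow> vanishing (constants E) (total_cursor (constants E) div 2)"
    if "even (total_cursor (constants E))"
    using that by (intro lamps_cancel_iff) simp
  show ?thesis
  proof (cases E)
    case (Spherical cs)
    then have "letter_at (equation_code E) 0 = 1" by (simp add: letter_at_def)
    then show ?thesis
      using iffs half Spherical by (auto simp: accepted_def solvable_Spherical)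
  next
    case (Orientable g cs)
    then have "letter_at (equation_code E) 0 = 2" by (simp add: letter_at_def)
    then show ?thesis
      using iffs Orientable assms by (simp add: accepted_def solvable_Orientable)
  next
    case (Nonorientable g cs)
    then have l0: "letter_at (equation_code E) 0 = 3" by (simp add: letter_at_def)
    show ?thesis
    proof (cases "2 \<le> g")
      case True
      then obtain g' where "g = Suc (Suc g')" by (metis add_2_eq_Suc le_Suc_ex)
      then have "letter_at (equation_code E) 1 = 4" "letter_at (equation_code E) 2 = 4"
        using Nonorientable by (simp_all add: letter_at_def)
      then show ?thesis
        using iffs Nonorientable l0 True by (simp add: accepted_def solvable_Nonorientable)
    next
      case False
      then have g: "g = 1" using assms Nonorientable by simp
      \<comment> \<open>For genus 1 the third symbol is the 5 of the first constant, or, without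
        constants, lies beyond the word and counts as blank.\<close>
      have "letter_at (equation_code E) 2 \<noteq> 4"
        using Nonorientable g by (cases cs) (simp_all add: letter_at_def constants_code_def)
      then show ?thesis
        using iffs half Nonorientable l0 g solvable_Nonorientable_1[of cs]
        by (auto simp: accepted_def)
    qed
  qed
qed

theorem corollary6p2:
  fixes K :: nat
  shows "polynomial_time equation_code equation_size
           {E. standard_form E \<and> num_constants E \<le> K} solvable_L2 \<and>
         in_XP equation_code equation_size num_constants
           {E. standard_form E} solvable_L2"
proof -
  obtain M r C where M: "decides_in_time M equation_code {E. standard_form E} solvable_L2
      (\<lambda>E. C * equation_size E ^ (num_constants E + r * Suc (num_constants E)))"
    using decidable_in_XP[OF solvable_iff_accepted] by blast
  \<comment> \<open>The machine for the parametrized problem serves for all \<open>K\<close>: its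
    exponent increases with the number of constants, and the size is at least 2.\<close>
  have "decides_in_time M equation_code {E. standard_form E \<and> num_constants E \<le> K} solvable_L2
      (\<lambda>E. C * equation_size E ^ (K + r * Suc K))"
    unfolding decides_in_time_def
  proof (intro conjI ballI)
    show "tm_wf M" using M by (simp add: decides_in_time_def)
    fix E assume E: "E \<in> {E. standard_form E \<and> num_constants E \<le> K}"
    then show "set (equation_code E) \<subseteq> {0<..<nsymbols M}"
      using M unfolding decides_in_time_def by blast
    obtain n where n: "n \<le> C * equation_size E ^ (num_constants E + r * Suc (num_constants E))"
      "fst (tm_run M (equation_code E) n) = (if solvable_L2 E then accept M else reject M)"
      using M E unfolding decides_in_time_def by blast
    have "num_constants E + r * Suc (num_constants E) \<le> K + r * Suc K"
      using E by (intro add_mono mult_le_mono2) auto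
    then have "equation_size E ^ (num_constants E + r * Suc (num_constants E))
        \<le> equation_size E ^ (K + r * Suc K)"
      using E equation_size_ge_2[of E] by (intro power_increasing) auto
    then have "n \<le> C * equation_size E ^ (K + r * Suc K)"
      using n(1) mult_le_mono2 le_trans by blast
    then show "\<exists>n \<le> C * equation_size E ^ (K + r * Suc K).
        fst (tm_run M (equation_code E) n) = (if solvable_L2 E then accept M else reject M)"
      using n(2) by blast
  qed
  then show ?thesis
    unfolding polynomial_time_def in_XP_def using M computable_affine by blast
qed

end
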